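(* Let $n$ be a positive integer and let $g:[0,\infty)^n\to\mathbb{R}$ be a continuous function such that $g(t)=0$ for every $t\in\partial_{n-1}^n$. The following conditions are equivalent: (i) For any $d\in\mathbb{N}$ and discrete measures $\mu_i$ in $\mathbb{R}^d$ such that $\mu_i(\mathbb{R}^d)=0$, $1\le i\le n$, it holds that $$\int_{(\mathbb{R}^d)^n}\int_{(\mathbb{R}^d)^n}(-1)^ng(\|x_1-y_1\|^2,\ldots,\|x_n-y_n\|^2)\,d\Big[\mathop{\times}_{i=1}^n\mu_i\Big](x)\,d\Big[\mathop{\times}_{i=1}^n\mu_i\Big](y)\ge0.$$ (ii) For any $d\in\mathbb{N}$ and discrete probability $P$ in $(\mathbb{R}^d)^n$, its Lancaster interaction $\Lambda[P]$ satisfies $$\int_{(\mathbb{R}^d)^n}\int_{(\mathbb{R}^d)^n}(-1)^ng(\|x_1-y_1\|^2,\ldots,\|x_n-y_n\|^2)\,d[\Lambda[P]](x)\,d[\Lambda[P]](y)\ge0.$$ (ii') For any $d\in\mathbb{N}$ and discrete probability $P$ in $(\mathbb{R}^d)^n$, its Streitberg interaction $\Sigma[P]$ satisfies $$\int_{(\mathbb{R}^d)^n}\int_{(\mathbb{R}^d)^n}(-1)^ng(\|x_1-y_1\|^2,\ldots,\|x_n-y_n\|^2)\,d[\Sigma[P]](x)\,d[\Sigma[P]](y)\ge0.$$ (iii) The function $g$ is PDI$_n^\infty$. (iv) The function $g$ can be represented, for $t\in[0,\infty)^n$, as $$g(t)=\int_{[0,\infty)^n}\prod_{i=1}^n(1-e^{-r_it_i})\frac{1+r_i}{r_i}\,d\eta(r),$$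 where the measure $\eta\in\mathfrak{M}([0,\infty)^n)$ is nonnegative. The representation is unique. (v) The function $g$ is a Bernstein function of order $n$ in $(0,\infty)^n$.
   Context: A discrete measure is a finite real linear combination of Dirac measures. $\mathfrak{M}(A)$ denotes the finite (signed) Borel measures on $A$. $\partial_{n-1}^n:=\{t\in[0,\infty)^n:\ t_i=0\text{ for some }i\}$. In (iv), $(1-e^{-r_it_i})\frac{1+r_i}{r_i}$ is defined as its limit $t_i$ when $r_i=0$. $\mathcal{M}_n((\mathbb{R}^d)^n)$ is the space of discrete measures $\mu$ in the product $(\mathbb{R}^d)^n$ of $n$ copies of $\mathbb{R}^d$ such that $\mu(\prod_{i=1}^nA_i)=0$ for all $A_i\subset\mathbb{R}^d$ with $A_i=\mathbb{R}^d$ for at least one $i$. A function $g:[0,\infty)^n\to\mathbb{R}$ is PDI$_n^\infty$ (positive definite independent of order $n$ in all Euclidean spaces) if for every $d\in\mathbb{N}$ and $\mu\in\mathcal{M}_n((\mathbb{R}^d)^n)$, $$\int_{(\mathbb{R}^d)^n}\int_{(\mathbb{R}^d)^n}(-1)^ng(\|u_1-v_1\|^2,\ldots,\|u_n-v_n\|^2)\,d\mu(u)\,d\mu(v)\ge0.$$ For a discrete probability $P$ in $(\mathbb{R}^d)^n$, $P_F$ denotes its marginal on the coordinates in $F\subset\{1,\dots,n\}$, $P_j=P_{\{j\}}$, and products of marginals are taken with coordinates in their original positions. The Lancaster interaction is $\Lambda[P]=\sum_{F\subset\{1,\dots,n\}}(-1)^{n-|F|}P_F\times\big[\mathop{\times}_{j\in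 F^c}P_j\big]$. The Streitberg interaction is $\Sigma[P]=\sum_\pi(-1)^{|\pi|-1}(|\pi|-1)!\,P_\pi$, the sum over all partitions $\pi=\{F_1,\dots,F_\ell\}$ of $\{1,\dots,n\}$ into nonempty blocks, with $|\pi|=\ell$ and $P_\pi=\mathop{\times}_{i=1}^\ell P_{F_i}$. A function $h:(0,\infty)^n\to\mathbb{R}$ is completely monotone with $n$ variables if $h\in C^\infty((0,\infty)^n)$ and $(-1)^{|\alpha|}\partial^\alpha h\ge0$ for all $\alpha\in\mathbb{Z}_+^n$. $g$ is a Bernstein function of order $n$ in $(0,\infty)^n$ if it is $C^\infty$ on $(0,\infty)^n$ and $\partial_1\partial_2\cdots\partial_ng$ is completely monotone with $n$ variables.
   Formalization: The equivalences with (ii) and (ii') are stated only for n ≥ 2: for n = 1, Λ[P] = 0 makes (ii) hold for every g (e.g. g(t) = −t, not PDI), and Σ[P] = P makes (ii') fail for the Bernstein function g(t) = t. *)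

theory Defs
  imports "HOL-Analysis.Analysis" "HOL-Library.Disjoint_Sets"
begin

text \<open>
  The number of variables \<open>n\<close> is the cardinality of the finite index type \<open>'n\<close>.  The dimension \<open>d\<close>
  is quantified inside the conditions, so \<open>\<real>\<^sup>d\<close> is the carrier \<open>topspace (Euclidean_space d)\<close>
  of the library, i.e. the sequences vanishing from index \<open>d\<close> on.
\<close>

definition prod_points :: "nat \<Rightarrow> ('n::finite \<Rightarrow> nat \<Rightarrow> real) set" where
  "prod_points d = {x. \<forall>i. x i \<in> topspace (Euclidean_space d)}"

definition sqdists :: "nat \<Rightarrow> ('n::finite \<Rightarrow> nat \<Rightarrow> real) \<Rightarrow> ('n \<Rightarrow> nat \<Rightarrow> real) \<Rightarrow> real^'n" where
  "sqdists d x y = (\<chi> i. (L2_set (\<lambda>k. x i k - y i k) {..<d})\<^sup>2)"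


subsection \<open>Discrete signed measures\<close>

text \<open>
  A finite linear combination \<open>\<Sum>\<^sub>k c\<^sub>k \<delta>\<^bsub>x\<^sub>k\<^esub>\<close> (with distinct \<open>x\<^sub>k\<close>) is represented by its weight function
  \<open>\<mu> x = \<mu>({x})\<close>, which has finite support; \<open>dmeasure \<mu>\<close> is the set function and
  \<open>dintegral \<mu>\<close> the integral that it induces.
\<close>

definition discrete_measure_on :: "'a set \<Rightarrow> ('a \<Rightarrow> real) \<Rightarrow> bool" where
  "discrete_measure_on X \<mu> \<longleftrightarrow> finite {x. \<mu> x \<noteq> 0} \<and> {x. \<mu> x \<noteq> 0} \<subseteq> X"

definition dmeasure :: "('a \<Rightarrow> real) \<Rightarrow> 'a set \<Rightarrow> real" where
  "dmeasure \<mu> A = (\<Sum>x | x \<in> A \<and> \<mu> x \<noteq> 0. \<mu> x)"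

definition dintegral :: "('a \<Rightarrow> real) \<Rightarrow> ('a \<Rightarrow> real) \<Rightarrow> real" where
  "dintegral \<mu> f = (\<Sum>x | \<mu> x \<noteq> 0. \<mu> x * f x)"

definition discrete_probability_on :: "'a set \<Rightarrow> ('a \<Rightarrow> real) \<Rightarrow> bool" where
  "discrete_probability_on X P \<longleftrightarrow>
     discrete_measure_on X P \<and> (\<forall>x. 0 \<le> P x) \<and> dmeasure P X = 1"

definition product_measure :: "('n::finite \<Rightarrow> 'a \<Rightarrow> real) \<Rightarrow> ('n \<Rightarrow> 'a) \<Rightarrow> real" where
  "product_measure \<mu> x = (\<Prod>i\<in>UNIV. \<mu> i (x i))"

text \<open>
  \<open>marginal P F x\<close> is the weight that the marginal \<open>P\<^sub>F\<close> gives to the point \<open>(x\<^sub>i)\<^bsub>i\<in>F\<^esub>\<close>; it depends only on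
  these coordinates, and \<open>P\<^sub>\<emptyset>\<close> is the total mass.  Products of marginals over disjoint
  blocks, with coordinates in their original positions, are thus pointwise products of weights.
\<close>

definition marginal :: "(('n::finite \<Rightarrow> 'a) \<Rightarrow> real) \<Rightarrow> 'n set \<Rightarrow> ('n \<Rightarrow> 'a) \<Rightarrow> real" where
  "marginal P F x = dmeasure P {y. \<forall>i\<in>F. y i = x i}"

definition lancaster :: "(('n::finite \<Rightarrow> 'a) \<Rightarrow> real) \<Rightarrow> ('n \<Rightarrow> 'a) \<Rightarrow> real" where
  "lancaster P x =
     (\<Sum>F\<in>UNIV. (-1) ^ (CARD('n) - card F) * (marginal P F x * (\<Prod>j\<in>-F. marginal P {j} x)))"

definition streitberg :: "(('n::finite \<Rightarrow> 'a) \<Rightarrow> real) \<Rightarrow> ('n \<Rightarrow> 'a) \<Rightarrow> real" where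
  "streitberg P x =
     (\<Sum>\<pi> | partition_on (UNIV :: 'n set) \<pi>.
        (-1) ^ (card \<pi> - 1) * fact (card \<pi> - 1) * (\<Prod>F\<in>\<pi>. marginal P F x))"

text \<open>Finiteness of the supports: the sums in \<^const>\<open>dintegral\<close> never degenerate below.\<close>

lemma finite_support_if_marginals:
  fixes P :: "('n::finite \<Rightarrow> 'a) \<Rightarrow> real"
  assumes "finite {x. P x \<noteq> 0}"
    and "\<And>x. Q x \<noteq> 0 \<Longrightarrow> \<forall>i. \<exists>F. i \<in> F \<and> marginal P F x \<noteq> 0"
  shows "finite {x. Q x \<noteq> 0}"
proof (rule finite_subset)
  show "{x. Q x \<noteq> 0} \<subseteq> (UNIV \<rightarrow>\<^sub>E (\<Union>i. (\<lambda>y. y i) ` {y. P y \<noteq> 0}))"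
  proof (clarsimp simp: PiE_UNIV_domain)
    fix x i assume "Q x \<noteq> 0"
    then obtain F where F: "i \<in> F" "marginal P F x \<noteq> 0" using assms(2) by blast
    then obtain y where "y \<in> {y. \<forall>i\<in>F. y i = x i}" "P y \<noteq> 0"
      unfolding marginal_def dmeasure_def by (metis (mono_tags, lifting) mem_Collect_eq sum.neutral)
    then show "\<exists>j. x i \<in> (\<lambda>y. y j) ` {y. P y \<noteq> 0}"
      using F(1) by (auto simp: image_iff intro!: exI[of _ i] exI[of _ y])
  qed
  show "finite ((UNIV :: 'n set) \<rightarrow>\<^sub>E (\<Union>i. (\<lambda>y. y i) ` {y. P y \<noteq> 0}))"
    using assms(1) by (intro finite_PiE) auto
qed

lemma finite_support_lancaster:
  assumes "finite {x. P x \<noteq> 0}"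
  shows "finite {x. lancaster P x \<noteq> 0}"
proof (rule finite_support_if_marginals[OF assms], intro allI)
  fix x i assume "lancaster P x \<noteq> 0"
  then obtain F where F: "marginal P F x \<noteq> 0" "\<forall>j\<in>-F. marginal P {j} x \<noteq> 0"
    unfolding lancaster_def
    by (metis (no_types, lifting) finite_code mult_eq_0_iff prod_zero sum.neutral)
  then show "\<exists>F. i \<in> F \<and> marginal P F x \<noteq> 0"
    by (cases "i \<in> F") auto
qed

lemma finite_support_streitberg:
  assumes "finite {x. P x \<noteq> 0}"
  shows "finite {x. streitberg P x \<noteq> 0}"
proof (rule finite_support_if_marginals[OF assms], intro allI)
  fix x i assume "streitberg P x \<noteq> 0"
  then obtain \<pi> where \<pi>: "partition_on UNIV \<pi>" "(\<Prod>F\<in>\<pi>. marginal P F x) \<noteq> 0"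
    unfolding streitberg_def by (metis (mono_tags, lifting) mem_Collect_eq mult_zero_right sum.neutral)
  then have "i \<in> \<Union>\<pi>" by (simp add: partition_on_def)
  then obtain F where "F \<in> \<pi>" "i \<in> F" by blast
  with \<pi>(2) show "\<exists>F. i \<in> F \<and> marginal P F x \<noteq> 0"
    by (metis finite_code prod_zero)
qed


subsection \<open>Positive definite independent functions\<close>

definition energy :: "nat \<Rightarrow> (real^'n::finite \<Rightarrow> real) \<Rightarrow> (('n \<Rightarrow> nat \<Rightarrow> real) \<Rightarrow> real) \<Rightarrow> real" where
  "energy d g \<mu> =
     dintegral \<mu> (\<lambda>v. dintegral \<mu> (\<lambda>u. (-1) ^ CARD('n) * g (sqdists d u v)))"

definition null_marginal_measures :: "nat \<Rightarrow> (('n::finite \<Rightarrow> nat \<Rightarrow> real) \<Rightarrow> real) set" where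
  "null_marginal_measures d =
     {\<mu>. discrete_measure_on (prod_points d) \<mu> \<and>
         (\<forall>A. (\<forall>i. A i \<subseteq> topspace (Euclidean_space d)) \<and> (\<exists>i. A i = topspace (Euclidean_space d))
              \<longrightarrow> dmeasure \<mu> {x. \<forall>i. x i \<in> A i} = 0)}"

definition PDI_inf :: "(real^'n::finite \<Rightarrow> real) \<Rightarrow> bool" where
  "PDI_inf g \<longleftrightarrow> (\<forall>d\<ge>1. \<forall>\<mu> \<in> null_marginal_measures d. 0 \<le> energy d g \<mu>)"


subsection \<open>Bernstein functions of order \<open>n\<close>\<close>

definition closed_orthant :: "(real^'n::finite) set" where
  "closed_orthant = {t. \<forall>i. 0 \<le> t $ i}"

definition open_orthant :: "(real^'n::finite) set" where
  "open_orthant = {t. \<forall>i. 0 < t $ i}"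

definition partial_deriv :: "'n::finite \<Rightarrow> (real^'n \<Rightarrow> real) \<Rightarrow> real^'n \<Rightarrow> real" where
  "partial_deriv i f x = deriv (\<lambda>s. f (x + s *\<^sub>R axis i 1)) 0"

text \<open>
  A list of indices stands for the multi-index counting its entries: \<open>\<alpha>\<^sub>i\<close> is the number of
  occurrences of \<open>i\<close>, and \<open>|\<alpha>|\<close> is the length.  For smooth functions the order
  of the list is irrelevant, and below all orders are quantified over.
\<close>

definition partial_derivs :: "'n::finite list \<Rightarrow> (real^'n \<Rightarrow> real) \<Rightarrow> real^'n \<Rightarrow> real" where
  "partial_derivs is f = foldr partial_deriv is f"

definition C_infinity_on :: "(real^'n::finite) set \<Rightarrow> (real^'n \<Rightarrow> real) \<Rightarrow> bool" where
  "C_infinity_on U f \<longleftrightarrow>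
     (\<forall>is. continuous_on U (partial_derivs is f) \<and>
           (\<forall>x\<in>U. \<forall>i. (\<lambda>s::real. partial_derivs is f (x + s *\<^sub>R axis i 1)) differentiable (at 0)))"

definition completely_monotone :: "(real^'n::finite \<Rightarrow> real) \<Rightarrow> bool" where
  "completely_monotone h \<longleftrightarrow>
     C_infinity_on open_orthant h \<and>
     (\<forall>is. \<forall>x\<in>open_orthant. 0 \<le> (-1) ^ length is * partial_derivs is h x)"

definition bernstein_order_n :: "(real^'n::finite \<Rightarrow> real) \<Rightarrow> bool" where
  "bernstein_order_n g \<longleftrightarrow>
     C_infinity_on open_orthant g \<and>
     (\<forall>is. distinct is \<and> set is = (UNIV :: 'n set) \<longrightarrow> completely_monotone (partial_derivs is g))"


subsection \<open>The integral representation\<close>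

definition bernstein_factor :: "real \<Rightarrow> real \<Rightarrow> real" where
  "bernstein_factor r t = (if r = 0 then t else (1 - exp (- r * t)) * ((1 + r) / r))"

text \<open>For \<open>t\<close> in the closed orthant the integrand is bounded in \<open>r\<close>, hence integrable.\<close>

definition represents :: "(real^'n::finite) measure \<Rightarrow> (real^'n \<Rightarrow> real) \<Rightarrow> bool" where
  "represents \<eta> g \<longleftrightarrow>
     sets \<eta> = sets (restrict_space borel closed_orthant) \<and> finite_measure \<eta> \<and>
     (\<forall>t\<in>closed_orthant. g t = (\<integral>r. (\<Prod>i\<in>UNIV. bernstein_factor (r $ i) (t $ i)) \<partial>\<eta>))"

end

theory Submission
  imports Defs "HOL-Probability.Probability" "HOL-Computational_Algebra.Polynomial"
begin

text \<open>
  All conditions are compared with one about iterated differences.  Let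
  \<open>dec i h f t = f t - f (t + h e\<^sub>i)\<close>; the condition \<open>alternating_differences\<close> below says that
  all iterated differences of \<open>(-1)\<^sup>n g\<close> that involve every coordinate are nonnegative.

  \<^emph>\<open>From energies to differences\<close> (\<open>alternating_if_product_energies\<close>).  As the dimension is free,
  there is room for translations orthogonal to all points in use.  Replacing \<open>\<mu>\<^sub>i\<close> by \<open>\<mu>\<^sub>i\<close> minus its
  translate by a vector of length \<open>\<surd>h\<close> produces mass \<open>0\<close>, and turns the energy of \<open>g\<close> into twice
  the energy of \<open>dec i h g\<close>.  Replacing \<open>\<mu>\<^sub>i\<close> by the mean of \<open>N\<close> translates in orthogonal directions
  shifts the argument \<open>t\<^sub>i\<close>, up to a diagonal term of order \<open>1/N\<close>.  After all these replacements
  only the value of the iterated difference at a point is left.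

  \<^emph>\<open>From Bernstein functions to differences\<close> (\<open>alternating_if_bernstein\<close>).  This is the mean value
  theorem, and continuity for the boundary.

  \<^emph>\<open>From differences to the integral\<close> (\<open>represents_if_alternating\<close>).  The increments of \<open>g\<close> on the
  grid \<open>(1/N) \<nat>\<^sup>n\<close> form a completely monotone sequence.  By Hausdorff's theorem
  (\<open>hausdorff_moments\<close>) they are the moments of a measure \<open>\<rho>\<^sub>N\<close> on the cube, and
  summing them up gives \<open>g(m/N) = \<integral> \<Prod>\<^sub>i (1 - s\<^sub>i\<^bsup>m_i\<^esup>) / (1 - s\<^sub>i) d\<rho>\<^sub>N\<close>.  Moments determine a
  measure on the cube, so that the image of \<open>\<rho>\<^sub>N\<close> under \<open>s \<mapsto> s\<^sup>N\<close>, suitably weighted, is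
  \<open>\<rho>\<^sub>1\<close>; hence \<open>\<rho>\<^sub>1\<close> alone represents \<open>g\<close> at all rational points, and by continuity everywhere.  As
  \<open>g\<close> is continuous and vanishes on the boundary, \<open>\<rho>\<^sub>1\<close> has no mass where some \<open>s\<^sub>i = 0\<close>, and
  \<open>s = e\<^sup>-\<^sup>r\<close> gives \<open>\<eta>\<close>.  Uniqueness of \<open>\<eta>\<close> is again uniqueness in the moment problem.  The weak
  compactness behind Hausdorff's theorem in \<open>n\<close> variables is reduced to Helly's theorem on the
  line by lifting measures along a space-filling curve.

  \<^emph>\<open>Back from the integral\<close>.  The kernel is Bernstein in \<open>t\<close>, and one differentiates under the integral
  (\<open>bernstein_if_represents\<close>).  A measure with vanishing marginals sees in
  \<open>\<Prod>\<^sub>i (1 - e\<^bsup>-r_i t_i\<^esup>)\<close> only the product of all exponentials, which is a Gaussian kernel and thus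
  positive definite (\<open>PDI_if_represents\<close>).

  \<^emph>\<open>Interactions\<close>.  The Lancaster and Streitberg interactions have vanishing marginals.  Conversely, if
  \<open>Q\<close> is a product probability, then \<open>Q + \<epsilon> (\<mu>\<^sub>1 \<times> \<dots> \<times> \<mu>\<^sub>n)\<close> has the same proper marginals as
  \<open>Q\<close>, so that both of its interactions are \<open>\<epsilon> (\<mu>\<^sub>1 \<times> \<dots> \<times> \<mu>\<^sub>n)\<close>
  (\<open>product_measure_is_interaction\<close>).
\<close>

section \<open>Integrals against discrete measures\<close>

lemma dintegral_superset:
  assumes "finite S" "{x. \<mu> x \<noteq> 0} \<subseteq> S"
  shows "dintegral \<mu> f = (\<Sum>x\<in>S. \<mu> x * f x)"
  unfolding dintegral_def using assms by (intro sum.mono_neutral_left) auto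

lemma dmeasure_superset:
  assumes "finite S" "{x. \<mu> x \<noteq> 0} \<subseteq> S"
  shows "dmeasure \<mu> A = (\<Sum>x\<in>S. if x \<in> A then \<mu> x else 0)"
proof -
  have "dmeasure \<mu> A = (\<Sum>x | x \<in> A \<and> \<mu> x \<noteq> 0. if x \<in> A then \<mu> x else 0)"
    unfolding dmeasure_def by (intro sum.cong) auto
  also have "\<dots> = (\<Sum>x\<in>S. if x \<in> A then \<mu> x else 0)"
    using assms by (intro sum.mono_neutral_left) auto
  finally show ?thesis .
qed

lemma dmeasure_eq_dintegral:
  "finite {x. \<mu> x \<noteq> 0} \<Longrightarrow> dmeasure \<mu> A = dintegral \<mu> (indicator A)"
  unfolding dintegral_def
  by (subst dmeasure_superset[of "{x. \<mu> x \<noteq> 0}"], assumption, rule order_refl, rule sum.cong[OF refl])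
     (simp add: indicator_def)

section \<open>Vanishing marginals\<close>

lemma marginal_delete_eq_sum:
  fixes \<nu> :: "('n::finite \<Rightarrow> 'a) \<Rightarrow> real"
  assumes fin: "finite {y. \<nu> y \<noteq> 0}" and S: "finite S" "\<And>y. \<nu> y \<noteq> 0 \<Longrightarrow> y i \<in> S" and iF: "i \<in> F"
  shows "marginal \<nu> (F - {i}) x = (\<Sum>z\<in>S. marginal \<nu> F (x(i := z)))"
proof -
  let ?T = "{y. \<nu> y \<noteq> 0}"
  have "(\<Sum>z\<in>S. marginal \<nu> F (x(i := z))) = (\<Sum>z\<in>S. \<Sum>y\<in>?T. if \<forall>j\<in>F. y j = (x(i := z)) j then \<nu> y else 0)"
    unfolding marginal_def by (simp add: dmeasure_superset[OF fin order_refl])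
  also have "\<dots> = (\<Sum>y\<in>?T. \<Sum>z\<in>S. if \<forall>j\<in>F. y j = (x(i := z)) j then \<nu> y else 0)"
    by (rule sum.swap)
  also have "\<dots> = (\<Sum>y\<in>?T. if \<forall>j\<in>F-{i}. y j = x j then \<nu> y else 0)"
  proof (intro sum.cong refl)
    fix y assume "y \<in> ?T"
    then have "y i \<in> S" using S by auto
    have "(\<forall>j\<in>F. y j = (x(i := z)) j) \<longleftrightarrow> z = y i \<and> (\<forall>j\<in>F-{i}. y j = x j)" for z
      using iF by auto
    then have "(\<Sum>z\<in>S. if \<forall>j\<in>F. y j = (x(i := z)) j then \<nu> y else 0)
        = (\<Sum>z\<in>S. if z = y i then (if \<forall>j\<in>F-{i}. y j = x j then \<nu> y else 0) else 0)"
      by (intro sum.cong) auto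
    also have "\<dots> = (if \<forall>j\<in>F-{i}. y j = x j then \<nu> y else 0)"
      using \<open>y i \<in> S\<close> S(1) by (subst sum.delta) auto
    finally show "(\<Sum>z\<in>S. if \<forall>j\<in>F. y j = (x(i := z)) j then \<nu> y else 0) = \<dots>" .
  qed
  also have "\<dots> = marginal \<nu> (F - {i}) x"
    unfolding marginal_def by (simp add: dmeasure_superset[OF fin order_refl])
  finally show ?thesis by simp
qed

lemma marginal_UNIV: "marginal P UNIV x = P x"
proof -
  have *: "{y. y \<in> {y. \<forall>i\<in>UNIV. y i = x i} \<and> P y \<noteq> 0} = (if P x = 0 then {} else {x})"
    by (auto simp: fun_eq_iff[symmetric])
  then show ?thesis
    unfolding marginal_def dmeasure_def * by simp
qed

lemma marginal_upd_notin: "i \<notin> F \<Longrightarrow> marginal P F (x(i := z)) = marginal P F x"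
  unfolding marginal_def by (rule arg_cong[where f = "dmeasure P"]) auto

text \<open>A discrete measure with vanishing marginals on all coordinates but \<open>i\<close> cannot see functions
  that do not depend on the coordinate \<open>i\<close>: such a function is constant on the fibres over which
  the marginal sums the weights.\<close>

lemma dintegral_null_marginal:
  assumes fin: "finite {y. \<mu> y \<noteq> 0}" and null: "\<And>x. marginal \<mu> (-{i}) x = 0"
    and indep: "\<And>x y. (\<forall>j. j \<noteq> i \<longrightarrow> x j = y j) \<Longrightarrow> \<phi> x = \<phi> y"
  shows "dintegral \<mu> \<phi> = 0"
proof -
  let ?T = "{y. \<mu> y \<noteq> 0}" and ?f = "\<lambda>y::'a \<Rightarrow> 'b. y(i := undefined)"
  have "dintegral \<mu> \<phi> = (\<Sum>y\<in>?T. \<mu> y * \<phi> y)" by (simp add: dintegral_def)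
  also have "\<dots> = (\<Sum>c\<in>?f ` ?T. \<Sum>y\<in>{y\<in>?T. ?f y = c}. \<mu> y * \<phi> y)"
    by (rule sum.image_gen[OF fin])
  also have "\<dots> = 0"
  proof (rule sum.neutral, rule ballI)
    fix c assume "c \<in> ?f ` ?T"
    then obtain y0 where c: "c = ?f y0" by auto
    have eq: "?f y = ?f y0 \<longleftrightarrow> (\<forall>j. j \<noteq> i \<longrightarrow> y j = y0 j)" for y
      by (auto simp: fun_eq_iff split: if_splits)
    have "(\<Sum>y\<in>{y\<in>?T. ?f y = c}. \<mu> y * \<phi> y) = (\<Sum>y\<in>{y\<in>?T. ?f y = c}. \<mu> y) * \<phi> y0"
      unfolding sum_distrib_right c using indep by (intro sum.cong refl) (auto simp: eq)
    also have "(\<Sum>y\<in>{y\<in>?T. ?f y = c}. \<mu> y) = marginal \<mu> (-{i}) y0"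
      unfolding marginal_def dmeasure_def c by (intro sum.cong) (auto simp: eq)
    finally show "(\<Sum>y\<in>{y\<in>?T. ?f y = c}. \<mu> y * \<phi> y) = 0" by (simp only: null mult_zero_left)
  qed
  finally show ?thesis .
qed

text \<open>Testing with singletons in all coordinates but \<open>i\<close> gives the weights of the marginal.  Conversely,
  the indicator of a product set that is the whole space in coordinate \<open>i\<close> does not depend on
  this coordinate.\<close>

lemma null_marginal_measures_iff:
  "\<mu> \<in> null_marginal_measures d \<longleftrightarrow>
     discrete_measure_on (prod_points d) \<mu> \<and> (\<forall>i x. marginal \<mu> (-{i}) x = 0)"
proof (rule iffI, intro conjI allI)
  assume "\<mu> \<in> null_marginal_measures d"
  then have dm: "discrete_measure_on (prod_points d) \<mu>"
    and null: "\<And>A. (\<forall>i. A i \<subseteq> topspace (Euclidean_space d)) \<Longrightarrow> (\<exists>i. A i = topspace (Euclidean_space d))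
              \<Longrightarrow> dmeasure \<mu> {x. \<forall>i. x i \<in> A i} = 0"
    by (auto simp: null_marginal_measures_def)
  show "discrete_measure_on (prod_points d) \<mu>" by fact
  fix i x
  have pp: "\<And>y. \<mu> y \<noteq> 0 \<Longrightarrow> y \<in> prod_points d" using dm by (auto simp: discrete_measure_on_def)
  let ?E = "topspace (Euclidean_space d)"
  show "marginal \<mu> (-{i}) x = 0"
  proof (cases "\<forall>j. j \<noteq> i \<longrightarrow> x j \<in> ?E")
    case True
    let ?A = "(\<lambda>j. {x j})(i := ?E)"
    have "marginal \<mu> (-{i}) x = dmeasure \<mu> {y. \<forall>j. y j \<in> ?A j}"
      unfolding marginal_def dmeasure_def
    proof (rule sum.cong[OF _ refl], rule Collect_cong)
      fix y
      have "\<mu> y \<noteq> 0 \<Longrightarrow> y i \<in> ?E" using pp by (auto simp: prod_points_def)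
      then show "(y \<in> {y. \<forall>j\<in>- {i}. y j = x j} \<and> \<mu> y \<noteq> 0) = (y \<in> {y. \<forall>j. y j \<in> ?A j} \<and> \<mu> y \<noteq> 0)"
        by auto
    qed
    also have "\<dots> = 0" using True by (intro null) auto
    finally show ?thesis .
  next
    case False
    then obtain j where "j \<noteq> i" "x j \<notin> ?E" by blast
    have "\<mu> y = 0" if "\<forall>k\<in>-{i}. y k = x k" for y
    proof (rule ccontr)
      assume "\<mu> y \<noteq> 0"
      then have "y j \<in> ?E" using pp by (simp add: prod_points_def)
      moreover have "y j = x j" using that \<open>j \<noteq> i\<close> by simp
      ultimately show False using \<open>x j \<notin> ?E\<close> by simp
    qed
    then show ?thesis unfolding marginal_def dmeasure_def by (intro sum.neutral) blast
  qed
next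
  assume *: "discrete_measure_on (prod_points d) \<mu> \<and> (\<forall>i x. marginal \<mu> (-{i}) x = 0)"
  then have fin: "finite {y. \<mu> y \<noteq> 0}" by (simp add: discrete_measure_on_def)
  have pp: "\<And>y. \<mu> y \<noteq> 0 \<Longrightarrow> y \<in> prod_points d" using conjunct1[OF *] by (auto simp: discrete_measure_on_def)
  have "dmeasure \<mu> {x. \<forall>i. x i \<in> A i} = 0"
    if "A i = topspace (Euclidean_space d)" for A i
  proof -
    have eq: "(y \<in> {x. \<forall>i. x i \<in> A i} \<and> \<mu> y \<noteq> 0) = (y \<in> {x. \<forall>j. j \<noteq> i \<longrightarrow> x j \<in> A j} \<and> \<mu> y \<noteq> 0)" for y
    proof -
      have "\<mu> y \<noteq> 0 \<Longrightarrow> y i \<in> A i" using pp that by (auto simp: prod_points_def)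
      moreover have "(\<forall>j. y j \<in> A j) \<longleftrightarrow> y i \<in> A i \<and> (\<forall>j. j \<noteq> i \<longrightarrow> y j \<in> A j)" by auto
      ultimately show ?thesis by blast
    qed
    have "dmeasure \<mu> {x. \<forall>i. x i \<in> A i} = dmeasure \<mu> {x. \<forall>j. j \<noteq> i \<longrightarrow> x j \<in> A j}"
      unfolding dmeasure_def
      by (simp only: eq)
    also have "\<dots> = dintegral \<mu> (indicator {x. \<forall>j. j \<noteq> i \<longrightarrow> x j \<in> A j})"
      by (rule dmeasure_eq_dintegral[OF fin])
    also have "\<dots> = 0"
      using conjunct2[OF *]
      by (intro dintegral_null_marginal[OF fin, of i]) (blast, auto simp: indicator_def)
    finally show ?thesis .
  qed
  with * show "\<mu> \<in> null_marginal_measures d" unfolding null_marginal_measures_def by blast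
qed

section \<open>The Lancaster and Streitberg interactions have vanishing marginals\<close>

lemma lancaster_nonzeroD:
  assumes "lancaster P x \<noteq> 0" shows "\<exists>F. i \<in> F \<and> marginal P F x \<noteq> 0"
proof -
  obtain F where F: "marginal P F x \<noteq> 0" "\<forall>j\<in>-F. marginal P {j} x \<noteq> 0"
    using assms unfolding lancaster_def
    by (metis (no_types, lifting) finite_code mult_eq_0_iff prod_zero sum.neutral)
  then show ?thesis by (cases "i \<in> F") auto
qed

lemma streitberg_nonzeroD:
  assumes "streitberg P x \<noteq> 0" shows "\<exists>F. i \<in> F \<and> marginal P F x \<noteq> 0"
proof -
  obtain \<pi> where \<pi>: "partition_on UNIV \<pi>" "(\<Prod>F\<in>\<pi>. marginal P F x) \<noteq> 0"
    using assms unfolding streitberg_def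
    by (metis (mono_tags, lifting) mem_Collect_eq mult_zero_right sum.neutral)
  then have "i \<in> \<Union>\<pi>" by (simp add: partition_on_def)
  then obtain F where "F \<in> \<pi>" "i \<in> F" by blast
  with \<pi>(2) show ?thesis by (metis finite_code prod_zero)
qed

lemma marginal_nonzeroD:
  assumes "marginal P F x \<noteq> 0" "i \<in> F"
  shows "\<exists>y. P y \<noteq> 0 \<and> y i = x i"
proof (rule ccontr)
  assume "\<nexists>y. P y \<noteq> 0 \<and> y i = x i"
  then have "marginal P F x = 0"
    using assms(2) unfolding marginal_def dmeasure_def by (intro sum.neutral) blast
  with assms(1) show False by simp
qed

text \<open>Both interactions are built from products of marginals of \<open>P\<close>, so that the support of each
  coordinate is that of \<open>P\<close>, and summing out a coordinate is a finite sum over this support.\<close>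

lemma null_marginal_interaction:
  fixes P Q :: "('n::finite \<Rightarrow> nat \<Rightarrow> real) \<Rightarrow> real"
  assumes P: "discrete_measure_on (prod_points d) P"
    and fin: "finite {x. Q x \<noteq> 0}"
    and nz: "\<And>x i. Q x \<noteq> 0 \<Longrightarrow> \<exists>F. i \<in> F \<and> marginal P F x \<noteq> 0"
    and zero: "\<And>i x S. finite S \<Longrightarrow> (\<And>y. P y \<noteq> 0 \<Longrightarrow> y i \<in> S) \<Longrightarrow> (\<Sum>z\<in>S. Q (x(i := z))) = 0"
  shows "Q \<in> null_marginal_measures d"
  unfolding null_marginal_measures_iff
proof (intro conjI allI)
  have finP: "finite {x. P x \<noteq> 0}" using P by (simp add: discrete_measure_on_def)
  have coord: "\<exists>y. P y \<noteq> 0 \<and> y i = x i" if Qx: "Q x \<noteq> 0" for x i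
  proof -
    obtain F where "i \<in> F" "marginal P F x \<noteq> 0" using nz[OF Qx, of i] by blast
    then show ?thesis by (intro marginal_nonzeroD)
  qed
  show "discrete_measure_on (prod_points d) Q"
    unfolding discrete_measure_on_def
  proof (intro conjI subsetI fin)
    fix x assume "x \<in> {x. Q x \<noteq> 0}"
    then have "Q x \<noteq> 0" by simp
    have "x i \<in> topspace (Euclidean_space d)" for i
    proof -
      obtain y where "P y \<noteq> 0" "y i = x i" using coord[OF \<open>Q x \<noteq> 0\<close>] by blast
      have "y \<in> prod_points d" using \<open>P y \<noteq> 0\<close> P by (auto simp: discrete_measure_on_def)
      then have "y i \<in> topspace (Euclidean_space d)" by (simp only: prod_points_def mem_Collect_eq)
      then show ?thesis by (simp only: \<open>y i = x i\<close>)
    qed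
    then show "x \<in> prod_points d" by (simp add: prod_points_def)
  qed
  fix i x
  let ?S = "(\<lambda>y. y i) ` {y. P y \<noteq> 0}"
  have "marginal Q (UNIV - {i}) x = (\<Sum>z\<in>?S. marginal Q UNIV (x(i := z)))"
  proof (intro marginal_delete_eq_sum[OF fin])
    show "y i \<in> ?S" if nzy: "Q y \<noteq> 0" for y
    proof -
      obtain y' where "P y' \<noteq> 0" "y' i = y i" using coord[OF nzy, of i] by blast
      then show ?thesis by (intro image_eqI[of _ _ y']) simp_all
    qed
  qed (use finP in auto)
  also have "\<dots> = (\<Sum>z\<in>?S. Q (x(i := z)))" by (simp add: marginal_UNIV)
  also have "\<dots> = 0" using finP by (intro zero) auto
  finally show "marginal Q (-{i}) x = 0" by (simp add: Compl_eq_Diff_UNIV)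
qed

lemma discrete_probabilityD:
  assumes "discrete_probability_on X P"
  shows "finite {x. P x \<noteq> 0}" "discrete_measure_on X P" "\<And>x. marginal P {} x = 1"
proof -
  show 1: "discrete_measure_on X P" "finite {x. P x \<noteq> 0}"
    using assms by (auto simp: discrete_probability_on_def discrete_measure_on_def)
  have "dmeasure P UNIV = dmeasure P X"
    using 1 unfolding dmeasure_def discrete_measure_on_def by (intro sum.cong) auto
  then show "marginal P {} x = 1" for x
    using assms by (auto simp: discrete_probability_on_def marginal_def)
qed

text \<open>Summing out coordinate \<open>i\<close> turns the terms of \<open>F\<close> and of \<open>F \<union> {i}\<close> into the same product of
  marginals, with opposite signs.\<close>

lemma lancaster_null:
  assumes "discrete_probability_on (prod_points d) P"
  shows "lancaster P \<in> null_marginal_measures d"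
proof (rule null_marginal_interaction)
  note P = discrete_probabilityD[OF assms]
  show "discrete_measure_on (prod_points d) P" "finite {x. lancaster P x \<noteq> 0}"
    by (fact P, rule finite_support_lancaster[OF P(1)])
  show "lancaster P x \<noteq> 0 \<Longrightarrow> \<exists>F. i \<in> F \<and> marginal P F x \<noteq> 0" for x i
    by (rule lancaster_nonzeroD)
  fix i :: 'a and x S assume S: "finite S" "\<And>y. P y \<noteq> 0 \<Longrightarrow> y i \<in> S"
  define h where "h F y = (-1) ^ (CARD('a) - card F) * (marginal P F y * (\<Prod>j\<in>-F. marginal P {j} y))"
    for F :: "'a set" and y
  have margin: "(\<Sum>z\<in>S. marginal P F (x(i := z))) = marginal P (F - {i}) x" if "i \<in> F" for F
    by (subst marginal_delete_eq_sum[where S=S and i=i, OF P(1) S(1) _ that]) (auto intro: S(2))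
  have UN: "UNIV = {F. i \<notin> F} \<union> insert i ` {F. i \<notin> F}"
  proof (intro equalityI subsetI)
    fix F show "F \<in> {F. i \<notin> F} \<union> insert i ` {F. i \<notin> F}"
      by (cases "i \<in> F") (auto simp: image_iff intro!: exI[of _ "F - {i}"])
  qed auto
  have inj: "inj_on (insert i) {F. i \<notin> F}" by (rule inj_onI) auto
  have pair: "(\<Sum>z\<in>S. h F (x(i := z))) + (\<Sum>z\<in>S. h (insert i F) (x(i := z))) = 0" if "i \<notin> F" for F
  proof -
    let ?c = "(-1::real) ^ (CARD('a) - card F)"
    let ?R = "\<Prod>j\<in>-(insert i F). marginal P {j} x"
    have "card (insert i F) \<le> CARD('a)" by (rule card_mono) auto
    then have lt: "CARD('a) - card F = Suc (CARD('a) - card (insert i F))"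
      using that by simp
    have pw: "?c = - ((-1) ^ (CARD('a) - card (insert i F)))" unfolding lt by simp
    have comp: "- F = insert i (- insert i F)" using that by auto
    have "(\<Sum>z\<in>S. h F (x(i := z))) = (\<Sum>z\<in>S. ?c * marginal P F x * ?R * marginal P {i} (x(i := z)))"
    proof (intro sum.cong refl)
      fix z
      have "(\<Prod>j\<in>-F. marginal P {j} (x(i := z))) = marginal P {i} (x(i := z)) * ?R"
        by (subst comp, subst prod.insert) (auto intro!: prod.cong marginal_upd_notin)
      then show "h F (x(i := z)) = ?c * marginal P F x * ?R * marginal P {i} (x(i := z))"
        using that by (simp add: h_def marginal_upd_notin)
    qed
    also have "\<dots> = ?c * marginal P F x * ?R"
      by (simp add: sum_distrib_left[symmetric] margin P(3))
    finally have 1: "(\<Sum>z\<in>S. h F (x(i := z))) = ?c * marginal P F x * ?R" .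
    have "(\<Sum>z\<in>S. h (insert i F) (x(i := z))) =
        (\<Sum>z\<in>S. - ?c * ?R * marginal P (insert i F) (x(i := z)))"
    proof (intro sum.cong refl)
      fix z
      have "(\<Prod>j\<in>-insert i F. marginal P {j} (x(i := z))) = ?R"
        by (auto intro!: prod.cong marginal_upd_notin)
      then show "h (insert i F) (x(i := z)) = - ?c * ?R * marginal P (insert i F) (x(i := z))"
        by (simp only: h_def pw minus_minus mult_ac)
    qed
    also have "\<dots> = - ?c * ?R * marginal P F x"
      using that by (simp add: sum_distrib_left[symmetric] sum_negf margin)
    finally show ?thesis using 1 by simp
  qed
  have "(\<Sum>z\<in>S. lancaster P (x(i := z))) = (\<Sum>z\<in>S. \<Sum>F\<in>UNIV. h F (x(i := z)))"
    by (simp add: lancaster_def h_def)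
  also have "\<dots> = (\<Sum>F\<in>UNIV. \<Sum>z\<in>S. h F (x(i := z)))" by (rule sum.swap)
  also have "\<dots> = (\<Sum>F\<in>{F. i \<notin> F}. \<Sum>z\<in>S. h F (x(i := z))) + (\<Sum>F\<in>insert i ` {F. i \<notin> F}. \<Sum>z\<in>S. h F (x(i := z)))"
    by (subst UN, rule sum.union_disjoint) auto
  also have "\<dots> = (\<Sum>F\<in>{F. i \<notin> F}. (\<Sum>z\<in>S. h F (x(i := z))) + (\<Sum>z\<in>S. h (insert i F) (x(i := z))))"
    by (simp add: sum.reindex[OF inj] sum.distrib)
  also have "\<dots> = 0" using pair by (intro sum.neutral) auto
  finally show "(\<Sum>z\<in>S. lancaster P (x(i := z))) = 0" .
qed


text \<open>The component \<open>B\<close> is the block that \<open>i\<close> joins; \<open>B = {}\<close> makes \<open>{i}\<close> a block of its own.\<close>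

lemma partition_on_insert_bij:
  assumes "i \<notin> A"
  shows "bij_betw (\<lambda>(\<sigma>, B). insert (insert i B) (\<sigma> - {B}))
           (SIGMA \<sigma>:{\<sigma>. partition_on A \<sigma>}. insert {} \<sigma>) {\<pi>. partition_on (insert i A) \<pi>}"
    (is "bij_betw ?f ?S ?T")
proof (intro bij_betwI')
  fix a b assume "a \<in> ?S" "b \<in> ?S"
  then obtain \<sigma> B \<sigma>' B' where ab: "a = (\<sigma>, B)" "b = (\<sigma>', B')" "partition_on A \<sigma>" "partition_on A \<sigma>'"
      "B \<in> insert {} \<sigma>" "B' \<in> insert {} \<sigma>'"
    by auto
  have ni: "i \<notin> F" if "F \<in> insert {} \<sigma> \<or> F \<in> insert {} \<sigma>'" for F
    using that assms ab(3,4) by (auto simp: partition_on_def)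
  have ne: "{} \<notin> \<sigma>" "{} \<notin> \<sigma>'" using ab by (auto simp: partition_on_def)
  show "(?f a = ?f b) = (a = b)"
  proof
    assume "?f a = ?f b"
    then have eq: "insert (insert i B) (\<sigma> - {B}) = insert (insert i B') (\<sigma>' - {B'})" by (simp add: ab)
    have "insert i B \<in> insert (insert i B') (\<sigma>' - {B'})" unfolding eq[symmetric] by simp
    moreover have "insert i B \<notin> \<sigma>'" using ni[of "insert i B"] by auto
    ultimately have "insert i B = insert i B'" by blast
    then have BB: "B = B'" using ni[of B] ni[of B'] ab by auto
    have "insert i B \<notin> \<sigma>" "insert i B \<notin> \<sigma>'" using ni[of "insert i B"] by auto
    then have "insert i B \<notin> \<sigma> - {B}" "insert i B \<notin> \<sigma>' - {B}" by simp_all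
    then have eqB: "\<sigma> - {B} = \<sigma>' - {B}" using eq unfolding BB[symmetric] by (metis Diff_insert_absorb)
    have "\<sigma> = \<sigma>'"
    proof (cases "B = {}")
      case True
      then show ?thesis using eqB ne by simp
    next
      case False
      then have "B \<in> \<sigma>" "B \<in> \<sigma>'" using ab(5,6) BB by simp_all
      then show ?thesis using eqB by (metis insert_Diff)
    qed
    then show "a = b" using ab BB by simp
  qed simp
next
  fix a assume "a \<in> ?S"
  then obtain \<sigma> B where a: "a = (\<sigma>, B)" "partition_on A \<sigma>" "B \<in> insert {} \<sigma>" by auto
  have "partition_on (insert i A) (insert (insert i B) (\<sigma> - {B}))"
  proof (rule partition_onI)
    have U: "\<Union>\<sigma> = A" using a by (auto simp: partition_on_def)
    have "\<Union>(\<sigma> - {B}) \<union> B = A" unfolding U[symmetric] using a(3) by blast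
    then show "\<Union>(insert (insert i B) (\<sigma> - {B})) = insert i A" by auto
    show "{} \<notin> insert (insert i B) (\<sigma> - {B})" using a by (auto simp: partition_on_def)
  next
    fix p q assume pq: "p \<in> insert (insert i B) (\<sigma> - {B})" "q \<in> insert (insert i B) (\<sigma> - {B})" "p \<noteq> q"
    have dj: "F \<inter> G = {}" if "F \<in> insert {} \<sigma>" "G \<in> \<sigma>" "F \<noteq> G" for F G
      using that a(2) by (auto simp: partition_on_def disjoint_def)
    have ni: "i \<notin> F" if "F \<in> \<sigma>" for F using that assms a(2) by (auto simp: partition_on_def)
    have new: "disjnt (insert i B) r" "disjnt r (insert i B)" if "r \<in> \<sigma> - {B}" for r
      unfolding disjnt_def using dj[of B r] ni[of r] that a(3) by blast+
    have old: "disjnt p q" if "p \<in> \<sigma> - {B}" "q \<in> \<sigma> - {B}"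
      unfolding disjnt_def using dj[of p q] that pq(3) by blast
    from pq(1) show "disjnt p q"
    proof (rule insertE)
      assume "p = insert i B"
      with pq(2,3) show ?thesis using new(1)[of q] by blast
    next
      assume "p \<in> \<sigma> - {B}"
      with pq(2) show ?thesis using new(2)[of p] old by blast
    qed
  qed
  then show "?f a \<in> ?T" by (simp add: a)
next
  fix \<pi> assume "\<pi> \<in> ?T"
  then have \<pi>: "\<Union>\<pi> = insert i A" "disjoint \<pi>" "{} \<notin> \<pi>" by (auto simp: partition_on_def)
  then obtain C where C: "C \<in> \<pi>" "i \<in> C" by blast
  define B where "B = C - {i}"
  define \<sigma> where "\<sigma> = (\<pi> - {C}) \<union> ({B} - {{}})"
  have iB: "insert i B = C" "i \<notin> B" using C by (auto simp: B_def)
  have dj: "F \<inter> G = {}" if "F \<in> \<pi>" "G \<in> \<pi>" "F \<noteq> G" for F G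
    using that \<pi>(2) by (auto simp: disjoint_def)
  have BC: "B \<subseteq> C" using iB by blast
  have Bnot: "B \<notin> \<pi> - {C}"
  proof
    assume B: "B \<in> \<pi> - {C}"
    then have "B \<inter> C = {}" using dj C by blast
    then have "B = {}" using BC by blast
    then show False using B \<pi>(3) by blast
  qed
  have "partition_on A \<sigma>"
  proof (rule partition_onI)
    have "\<Union>\<sigma> = \<Union>(\<pi> - {C}) \<union> B" by (auto simp: \<sigma>_def)
    also have "\<dots> = \<Union>\<pi> - {i}" using iB C(1) dj[OF _ C(1)] by blast
    also have "\<dots> = A" using \<pi>(1) assms by blast
    finally show "\<Union>\<sigma> = A" .
    show "{} \<notin> \<sigma>" using \<pi>(3) by (auto simp: \<sigma>_def)
  next
    fix p q assume pq: "p \<in> \<sigma>" "q \<in> \<sigma>" "p \<noteq> q"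
    have new: "disjnt B r" "disjnt r B" if "r \<in> \<pi> - {C}" for r
      unfolding disjnt_def using dj[of C r] that C(1) BC by blast+
    have old: "disjnt p q" if "p \<in> \<pi> - {C}" "q \<in> \<pi> - {C}"
      unfolding disjnt_def using dj[of p q] that pq(3) by blast
    from pq(1,2) have "p \<in> \<pi> - {C} \<or> p = B" "q \<in> \<pi> - {C} \<or> q = B" by (auto simp: \<sigma>_def)
    then show "disjnt p q" using new(1)[of q] new(2)[of p] old pq(3) by blast
  qed
  moreover have "B \<in> insert {} \<sigma>" by (auto simp: \<sigma>_def)
  moreover have "insert (insert i B) (\<sigma> - {B}) = \<pi>"
    unfolding iB(1) \<sigma>_def using Bnot C(1) \<pi>(3) by blast
  ultimately show "\<exists>a\<in>?S. \<pi> = ?f a" by (intro bexI[of _ "(\<sigma>, B)"]) auto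
qed

text \<open>A partition of \<open>{1,\<dots>,n}\<close> arises from a partition \<open>\<sigma>\<close> of \<open>{1,\<dots>,n} - {i}\<close> by adding the
  block \<open>{i}\<close> or by enlarging one of the \<open>\<ell>\<close> blocks of \<open>\<sigma>\<close>.  Summing out coordinate \<open>i\<close> maps
  all of them to \<open>P\<^sub>\<sigma>\<close>, with total coefficient
  \<open>(-1)\<^sup>\<ell> \<ell>! + \<ell> (-1)\<^bsup>\<ell>-1\<^esup> (\<ell>-1)! = 0\<close>; here \<open>\<ell> \<ge> 1\<close> because \<open>n \<ge> 2\<close>.\<close>

lemma streitberg_null:
  fixes P :: "('n::finite \<Rightarrow> nat \<Rightarrow> real) \<Rightarrow> real"
  assumes prob: "discrete_probability_on (prod_points d) P" and n2: "2 \<le> CARD('n)"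
  shows "streitberg P \<in> null_marginal_measures d"
proof (rule null_marginal_interaction)
  note P = discrete_probabilityD[OF prob]
  show "discrete_measure_on (prod_points d) P" "finite {x. streitberg P x \<noteq> 0}"
    by (fact P, rule finite_support_streitberg[OF P(1)])
  show "streitberg P x \<noteq> 0 \<Longrightarrow> \<exists>F. i \<in> F \<and> marginal P F x \<noteq> 0" for x i
    by (rule streitberg_nonzeroD)
  fix i :: 'n and x S assume S: "finite S" "\<And>y. P y \<noteq> 0 \<Longrightarrow> y i \<in> S"
  define c where "c k = (-1) ^ (k - 1) * (fact (k - 1) :: real)" for k :: nat
  define p where "p F = marginal P F x" for F
  let ?Pt = "{\<sigma>. partition_on (UNIV - {i}) \<sigma>}"
  let ?Q = "{\<pi>. partition_on (UNIV :: 'n set) \<pi>}"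
  let ?f = "\<lambda>(\<sigma>, B). insert (insert i B) (\<sigma> - {B})"
  have margin: "(\<Sum>z\<in>S. marginal P F (x(i := z))) = p (F - {i})" if "i \<in> F" for F
    unfolding p_def by (subst marginal_delete_eq_sum[where S=S and i=i, OF P(1) S(1) _ that]) (auto intro: S(2))
  have sum_out: "(\<Sum>z\<in>S. c (card \<pi>) * (\<Prod>F\<in>\<pi>. marginal P F (x(i := z)))) = c (card \<pi>) * (\<Prod>F\<in>\<pi>. p (F - {i}))"
    if \<pi>: "partition_on UNIV \<pi>" for \<pi>
  proof -
    have "i \<in> \<Union>\<pi>" using \<pi> by (simp add: partition_on_def)
    then obtain B where B: "B \<in> \<pi>" "i \<in> B" by blast
    have ni: "i \<notin> F" if "F \<in> \<pi> - {B}" for F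
    proof -
      have "F \<inter> B = {}" using that by (intro disjointD[OF partition_onD2[OF \<pi>] _ B(1)]) blast+
      then show ?thesis using B(2) by blast
    qed
    have fin: "finite \<pi>" by simp
    have "(\<Sum>z\<in>S. c (card \<pi>) * (\<Prod>F\<in>\<pi>. marginal P F (x(i := z)))) =
        (\<Sum>z\<in>S. c (card \<pi>) * (\<Prod>F\<in>\<pi>-{B}. p F) * marginal P B (x(i := z)))"
    proof (intro sum.cong refl)
      fix z
      have "(\<Prod>F\<in>\<pi>. marginal P F (x(i := z))) = marginal P B (x(i := z)) * (\<Prod>F\<in>\<pi>-{B}. p F)"
      proof -
        have "(\<Prod>F\<in>\<pi>-{B}. marginal P F (x(i := z))) = (\<Prod>F\<in>\<pi>-{B}. p F)"
          by (intro prod.cong refl) (simp add: p_def marginal_upd_notin ni)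
        then show ?thesis by (simp add: prod.remove[OF fin B(1)])
      qed
      then show "c (card \<pi>) * (\<Prod>F\<in>\<pi>. marginal P F (x(i := z))) = c (card \<pi>) * (\<Prod>F\<in>\<pi>-{B}. p F) * marginal P B (x(i := z))"
        by simp
    qed
    also have "\<dots> = c (card \<pi>) * (p (B - {i}) * (\<Prod>F\<in>\<pi>-{B}. p F))"
      by (simp add: sum_distrib_left[symmetric] margin[OF B(2)])
    also have "p (B - {i}) * (\<Prod>F\<in>\<pi>-{B}. p F) = (\<Prod>F\<in>\<pi>. p (F - {i}))"
    proof -
      have "(\<Prod>F\<in>\<pi>-{B}. p (F - {i})) = (\<Prod>F\<in>\<pi>-{B}. p F)"
        by (intro prod.cong refl arg_cong[where f = p]) (simp add: ni)
      then show ?thesis by (simp add: prod.remove[OF fin B(1)])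
    qed
    finally show ?thesis .
  qed
  have bij: "bij_betw ?f (SIGMA \<sigma>:?Pt. insert {} \<sigma>) ?Q"
    using partition_on_insert_bij[of i "UNIV - {i}"] by (simp add: insert_UNIV)
  have "(\<Sum>z\<in>S. streitberg P (x(i := z))) = (\<Sum>z\<in>S. \<Sum>\<pi>\<in>?Q. c (card \<pi>) * (\<Prod>F\<in>\<pi>. marginal P F (x(i := z))))"
    by (simp add: streitberg_def c_def)
  also have "\<dots> = (\<Sum>\<pi>\<in>?Q. \<Sum>z\<in>S. c (card \<pi>) * (\<Prod>F\<in>\<pi>. marginal P F (x(i := z))))"
    by (rule sum.swap)
  also have "\<dots> = (\<Sum>\<pi>\<in>?Q. c (card \<pi>) * (\<Prod>F\<in>\<pi>. p (F - {i})))"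
    by (intro sum.cong refl sum_out) simp
  also have "\<dots> = (\<Sum>a\<in>(SIGMA \<sigma>:?Pt. insert {} \<sigma>). c (card (?f a)) * (\<Prod>F\<in>?f a. p (F - {i})))"
    by (rule sum.reindex_bij_betw[OF bij, symmetric])
  also have "\<dots> = (\<Sum>\<sigma>\<in>?Pt. \<Sum>B\<in>insert {} \<sigma>. c (card (?f (\<sigma>, B))) * (\<Prod>F\<in>?f (\<sigma>, B). p (F - {i})))"
    by (subst sum.Sigma) (auto simp: case_prod_beta intro!: sum.cong)
  also have "\<dots> = 0"
  proof (rule sum.neutral, rule ballI)
    fix \<sigma> assume "\<sigma> \<in> ?Pt"
    then have \<sigma>: "\<Union>\<sigma> = UNIV - {i}" "{} \<notin> \<sigma>" by (auto simp: partition_on_def)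
    have ni: "i \<notin> F" if "F \<in> \<sigma>" for F using that \<sigma> by blast
    let ?R = "\<Prod>F\<in>\<sigma>. p F"
    have R: "(\<Prod>F\<in>\<tau>. p (F - {i})) = (\<Prod>F\<in>\<tau>. p F)" if "\<tau> \<subseteq> \<sigma>" for \<tau>
      using that ni by (intro prod.cong refl arg_cong[where f = p]) auto
    have ins: "(\<Prod>F\<in>insert (insert i B) \<tau>. p (F - {i})) = p B * (\<Prod>F\<in>\<tau>. p F)"
      "card (insert (insert i B) \<tau>) = Suc (card \<tau>)" if "\<tau> \<subseteq> \<sigma>" "i \<notin> B" for B \<tau>
    proof -
      have "insert i B \<notin> \<tau>" using that ni by blast
      then show "(\<Prod>F\<in>insert (insert i B) \<tau>. p (F - {i})) = p B * (\<Prod>F\<in>\<tau>. p F)"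
        "card (insert (insert i B) \<tau>) = Suc (card \<tau>)"
        using R[OF that(1)] that(2) by simp_all
    qed
    have "\<sigma> \<noteq> {}"
    proof
      assume "\<sigma> = {}"
      then have "UNIV = {i}" using \<sigma>(1) by auto
      then have "CARD('n) = 1" by (metis card_1_singleton_iff One_nat_def)
      with n2 show False by simp
    qed
    then have l: "card \<sigma> \<noteq> 0" by simp
    have 1: "c (card (?f (\<sigma>, B))) * (\<Prod>F\<in>?f (\<sigma>, B). p (F - {i})) = c (card \<sigma>) * ?R" if "B \<in> \<sigma>" for B
    proof -
      have "?R = p B * (\<Prod>F\<in>\<sigma>-{B}. p F)" using that by (simp add: prod.remove)
      moreover have "Suc (card (\<sigma> - {B})) = card \<sigma>" using that by (intro card_Suc_Diff1) auto
      ultimately show ?thesis using ins[of "\<sigma> - {B}" B] ni[OF that] by simp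
    qed
    have 2: "c (card (?f (\<sigma>, {}))) * (\<Prod>F\<in>?f (\<sigma>, {}). p (F - {i})) = c (Suc (card \<sigma>)) * ?R"
      using ins[of \<sigma> "{}"] \<sigma>(2) P(3) by (simp add: p_def)
    have "(\<Sum>B\<in>insert {} \<sigma>. c (card (?f (\<sigma>, B))) * (\<Prod>F\<in>?f (\<sigma>, B). p (F - {i})))
       = c (Suc (card \<sigma>)) * ?R + (\<Sum>B\<in>\<sigma>. c (card \<sigma>) * ?R)"
      by (subst sum.insert) (use \<sigma>(2) 1 2 in \<open>auto intro!: sum.cong\<close>)
    also have "\<dots> = (c (Suc (card \<sigma>)) + real (card \<sigma>) * c (card \<sigma>)) * ?R"
      by (simp add: algebra_simps)
    also have "c (Suc (card \<sigma>)) + real (card \<sigma>) * c (card \<sigma>) = 0"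
      using l by (cases "card \<sigma>") (auto simp: c_def algebra_simps)
    finally show "(\<Sum>B\<in>insert {} \<sigma>. c (card (?f (\<sigma>, B))) * (\<Prod>F\<in>?f (\<sigma>, B). p (F - {i}))) = 0" by simp
  qed
  finally show "(\<Sum>z\<in>S. streitberg P (x(i := z))) = 0" .
qed

section \<open>Product measures as interactions\<close>

lemma finite_support_product_measure:
  assumes "\<And>i. finite {x. \<mu> i x \<noteq> 0}"
  shows "finite {x. product_measure \<mu> x \<noteq> 0}"
proof (rule finite_subset)
  show "{x. product_measure \<mu> x \<noteq> 0} \<subseteq> (UNIV \<rightarrow>\<^sub>E (\<Union>i. {x. \<mu> i x \<noteq> 0}))"
    by (auto simp: product_measure_def PiE_UNIV_domain)
  show "finite ((UNIV :: 'a set) \<rightarrow>\<^sub>E (\<Union>i. {x. \<mu> i x \<noteq> 0}))"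
    using assms by (intro finite_PiE) auto
qed

lemma discrete_measure_product_measure:
  assumes "\<And>i. discrete_measure_on (topspace (Euclidean_space d)) (\<mu> i)"
  shows "discrete_measure_on (prod_points d) (product_measure \<mu>)"
proof -
  have "finite {x. product_measure \<mu> x \<noteq> 0}"
    using assms by (intro finite_support_product_measure) (auto simp: discrete_measure_on_def)
  moreover have "{x. product_measure \<mu> x \<noteq> 0} \<subseteq> prod_points d"
    using assms by (fastforce simp: discrete_measure_on_def product_measure_def prod_points_def)
  ultimately show ?thesis by (simp add: discrete_measure_on_def)
qed

lemma marginal_product_measure:
  fixes \<mu> :: "'n::finite \<Rightarrow> 'a \<Rightarrow> real"
  assumes fin: "\<And>i. finite {x. \<mu> i x \<noteq> 0}"
  shows "marginal (product_measure \<mu>) F x =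
     (\<Prod>i\<in>F. \<mu> i (x i)) * (\<Prod>i\<in>-F. dmeasure (\<mu> i) UNIV)"
proof -
  have "marginal (product_measure \<mu>) (-G) x = (\<Prod>i\<in>-G. \<mu> i (x i)) * (\<Prod>i\<in>G. dmeasure (\<mu> i) UNIV)" for G x
  proof (induction G arbitrary: x rule: infinite_finite_induct)
    case empty
    then show ?case by (simp add: marginal_UNIV product_measure_def)
  next
    case (insert i G)
    let ?S = "{z. \<mu> i z \<noteq> 0}"
    have eq: "- insert i G = -G - {i}" by auto
    have "marginal (product_measure \<mu>) (-G - {i}) x = (\<Sum>z\<in>?S. marginal (product_measure \<mu>) (-G) (x(i := z)))"
      using insert.hyps
      by (intro marginal_delete_eq_sum finite_support_product_measure fin) (auto simp: product_measure_def)
    also have "\<dots> = (\<Sum>z\<in>?S. (\<Prod>j\<in>-G-{i}. \<mu> j (x j)) * (\<Prod>i\<in>G. dmeasure (\<mu> i) UNIV) * \<mu> i z)"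
    proof (intro sum.cong refl)
      fix z
      have "(\<Prod>j\<in>-G. \<mu> j ((x(i := z)) j)) = \<mu> i z * (\<Prod>j\<in>-G-{i}. \<mu> j (x j))"
        using insert.hyps by (subst prod.remove[of _ i]) (auto intro!: prod.cong)
      then show "marginal (product_measure \<mu>) (-G) (x(i := z)) =
        (\<Prod>j\<in>-G-{i}. \<mu> j (x j)) * (\<Prod>i\<in>G. dmeasure (\<mu> i) UNIV) * \<mu> i z"
        by (simp add: insert.IH)
    qed
    also have "\<dots> = (\<Prod>j\<in>-G-{i}. \<mu> j (x j)) * (\<Prod>i\<in>G. dmeasure (\<mu> i) UNIV) * dmeasure (\<mu> i) UNIV"
      by (simp add: sum_distrib_left[symmetric] dmeasure_def)
    finally show ?case using insert.hyps by (simp add: eq mult_ac)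
  qed simp
  from this[of "-F" x] show ?thesis by simp
qed

lemma product_measure_null:
  fixes \<mu> :: "'n::finite \<Rightarrow> (nat \<Rightarrow> real) \<Rightarrow> real"
  assumes "\<And>i. discrete_measure_on (topspace (Euclidean_space d)) (\<mu> i)"
    and "\<And>i. dmeasure (\<mu> i) UNIV = 0"
  shows "product_measure \<mu> \<in> null_marginal_measures d"
proof -
  have fin: "\<And>i. finite {x. \<mu> i x \<noteq> 0}" using assms by (auto simp: discrete_measure_on_def)
  show ?thesis
    unfolding null_marginal_measures_iff
    using discrete_measure_product_measure[OF assms(1)] assms(2)
    by (simp add: marginal_product_measure[OF fin])
qed

lemma dmeasure_UNIV_eq:
  "discrete_measure_on X \<mu> \<Longrightarrow> dmeasure \<mu> X = dmeasure \<mu> UNIV"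
  unfolding dmeasure_def discrete_measure_on_def by (intro sum.cong) auto

lemma marginal_add_scaled:
  assumes "finite {x. A x \<noteq> 0}" "finite {x. B x \<noteq> 0}"
  shows "marginal (\<lambda>x. A x + e * B x) F x = marginal A F x + e * marginal B F x"
proof -
  let ?S = "{x. A x \<noteq> 0} \<union> {x. B x \<noteq> 0}"
  have S: "finite ?S" using assms by simp
  show ?thesis
    unfolding marginal_def
    by (subst (1 2 3) dmeasure_superset[OF S])
       (auto simp: sum.distrib[symmetric] sum_distrib_left intro!: sum.cong)
qed

lemma null_total_mass:
  assumes "\<mu> \<in> null_marginal_measures d" shows "marginal \<mu> {} x = 0"
proof -
  have fin: "finite {y. \<mu> y \<noteq> 0}" using assms by (simp add: null_marginal_measures_iff discrete_measure_on_def)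
  have "marginal \<mu> {} x = dintegral \<mu> (indicator UNIV)"
    unfolding marginal_def by (simp add: dmeasure_eq_dintegral[OF fin])
  also have "\<dots> = 0"
    using assms fin unfolding null_marginal_measures_iff
    by (intro dintegral_null_marginal) auto
  finally show ?thesis .
qed

text \<open>Every interaction of a product probability \<open>Q\<close> is a multiple of \<open>Q\<close>, and it has total mass
  \<open>0\<close> because its marginals vanish; so it is \<open>0\<close>.\<close>

lemma lancaster_product_measure:
  fixes q :: "'n::finite \<Rightarrow> (nat \<Rightarrow> real) \<Rightarrow> real"
  assumes prob: "discrete_probability_on (prod_points d) (product_measure q)"
    and fin: "\<And>i. finite {x. q i x \<noteq> 0}" and one: "\<And>i. dmeasure (q i) UNIV = 1"
  shows "lancaster (product_measure q) x = 0"
proof -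
  define c :: real where "c = (\<Sum>F\<in>(UNIV :: 'n set set). (-1) ^ (CARD('n) - card F))"
  have marg: "marginal (product_measure q) F x = (\<Prod>i\<in>F. q i (x i))" for F x
    by (simp add: marginal_product_measure[OF fin] one)
  have eq: "lancaster (product_measure q) = (\<lambda>x. 0 + c * product_measure q x)"
  proof
    fix x
    have "(\<Prod>i\<in>F. q i (x i)) * (\<Prod>j\<in>-F. q j (x j)) = product_measure q x" for F
      unfolding product_measure_def
      by (subst prod.union_disjoint[symmetric]) (auto intro!: prod.cong)
    then show "lancaster (product_measure q) x = 0 + c * product_measure q x"
      by (simp add: lancaster_def marg c_def sum_distrib_right)
  qed
  have "0 = marginal (lancaster (product_measure q)) {} x"
    by (rule null_total_mass[OF lancaster_null[OF prob], symmetric])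
  also have "\<dots> = marginal (\<lambda>x. 0) {} x + c * marginal (product_measure q) {} x"
    unfolding eq by (rule marginal_add_scaled) (auto intro: discrete_probabilityD[OF prob])
  also have "\<dots> = c" by (simp add: marg) (simp add: marginal_def dmeasure_def)
  finally show ?thesis by (simp add: eq)
qed

lemma streitberg_product_measure:
  fixes q :: "'n::finite \<Rightarrow> (nat \<Rightarrow> real) \<Rightarrow> real"
  assumes prob: "discrete_probability_on (prod_points d) (product_measure q)"
    and fin: "\<And>i. finite {x. q i x \<noteq> 0}" and one: "\<And>i. dmeasure (q i) UNIV = 1"
    and n2: "2 \<le> CARD('n)"
  shows "streitberg (product_measure q) x = 0"
proof -
  define c :: real where "c = (\<Sum>\<pi> | partition_on (UNIV :: 'n set) \<pi>. (-1) ^ (card \<pi> - 1) * fact (card \<pi> - 1))"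
  have marg: "marginal (product_measure q) F x = (\<Prod>i\<in>F. q i (x i))" for F x
    by (simp add: marginal_product_measure[OF fin] one)
  have eq: "streitberg (product_measure q) = (\<lambda>x. 0 + c * product_measure q x)"
  proof
    fix x
    have *: "(\<Prod>F\<in>\<pi>. \<Prod>i\<in>F. q i (x i)) = product_measure q x" if "partition_on UNIV \<pi>" for \<pi>
    proof -
      have "(\<Prod>i\<in>\<Union>\<pi>. q i (x i)) = (\<Prod>F\<in>\<pi>. \<Prod>i\<in>F. q i (x i))"
        using that by (subst prod.Union_disjoint) (auto simp: partition_on_def disjoint_def)
      moreover have "\<Union>\<pi> = UNIV" using that by (simp add: partition_on_def)
      ultimately show ?thesis by (simp add: product_measure_def)
    qed
    show "streitberg (product_measure q) x = 0 + c * product_measure q x"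
      by (simp add: streitberg_def marg c_def sum_distrib_right *)
  qed
  have "0 = marginal (streitberg (product_measure q)) {} x"
    by (rule null_total_mass[OF streitberg_null[OF prob n2], symmetric])
  also have "\<dots> = marginal (\<lambda>x. 0) {} x + c * marginal (product_measure q) {} x"
    unfolding eq by (rule marginal_add_scaled) (auto intro: discrete_probabilityD[OF prob])
  also have "\<dots> = c" by (simp add: marg) (simp add: marginal_def dmeasure_def)
  finally show ?thesis by (simp add: eq)
qed

text \<open>Conversely, a product of measures of mass \<open>0\<close> is up to scaling an interaction: perturb a
  product probability \<open>Q\<close> by a small multiple of it.  This changes no proper marginal, so that the
  interaction changes only in the term of \<open>P\<close> itself.\<close>

lemma product_measure_is_interaction:
  fixes \<mu> :: "'n::finite \<Rightarrow> (nat \<Rightarrow> real) \<Rightarrow> real"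
  assumes dm: "\<And>i. discrete_measure_on (topspace (Euclidean_space d)) (\<mu> i)"
    and zero: "\<And>i. dmeasure (\<mu> i) UNIV = 0" and n2: "2 \<le> CARD('n)"
  obtains P \<epsilon> where "discrete_probability_on (prod_points d) P" "\<epsilon> > 0"
    "lancaster P = (\<lambda>x. \<epsilon> * product_measure \<mu> x)" "streitberg P = (\<lambda>x. \<epsilon> * product_measure \<mu> x)"
proof -
  let ?E = "topspace (Euclidean_space d)"
  define S where "S i = insert (\<lambda>_. 0) {x. \<mu> i x \<noteq> 0}" for i
  have S: "finite (S i)" "S i \<subseteq> ?E" "card (S i) > 0" for i
    using dm[of i] by (auto simp: S_def discrete_measure_on_def topspace_Euclidean_space card_gt_0_iff)
  define q where "q i x = (if x \<in> S i then 1 / card (S i) else 0)" for i x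
  have q_supp: "{x. q i x \<noteq> 0} = S i" for i using S(3)[of i] by (auto simp: q_def)
  have finq: "finite {x. q i x \<noteq> 0}" for i by (simp add: q_supp S)
  have fin\<mu>: "finite {x. \<mu> i x \<noteq> 0}" for i using dm by (simp add: discrete_measure_on_def)
  have one: "dmeasure (q i) UNIV = 1" for i
  proof -
    have "dmeasure (q i) UNIV = (\<Sum>x\<in>S i. q i x)" by (simp add: dmeasure_def q_supp)
    also have "\<dots> = 1" using S(3)[of i] by (simp add: q_def)
    finally show ?thesis .
  qed
  define M where "M = product_measure \<mu>"
  define Q where "Q = product_measure q"
  have M_null: "M \<in> null_marginal_measures d" unfolding M_def by (rule product_measure_null[OF dm zero])
  have finM: "finite {x. M x \<noteq> 0}" unfolding M_def by (rule finite_support_product_measure[OF fin\<mu>])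
  have finQ: "finite {x. Q x \<noteq> 0}" unfolding Q_def by (rule finite_support_product_measure[OF finq])
  have Q_dm: "discrete_measure_on (prod_points d) Q"
    unfolding Q_def by (rule discrete_measure_product_measure) (simp add: discrete_measure_on_def q_supp S)
  have Q_nonneg: "Q x \<ge> 0" for x unfolding Q_def product_measure_def by (intro prod_nonneg) (simp add: q_def)
  have margQ: "marginal Q F x = (\<Prod>i\<in>F. q i (x i))" for F x
    unfolding Q_def by (simp add: marginal_product_measure[OF finq] one)
  have margM: "marginal M F x = 0" if "F \<noteq> UNIV" for F x
    unfolding M_def using that by (auto simp: marginal_product_measure[OF fin\<mu>] zero)
  have Q_prob: "discrete_probability_on (prod_points d) Q"
    using Q_dm Q_nonneg margQ[of "{}"]
    by (simp add: discrete_probability_on_def dmeasure_UNIV_eq marginal_def)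
  (* On the support of M the probability Q has the constant weight q0, so that a multiple of M
     of size at most q0 keeps P nonnegative. *)
  define q0 where "q0 = (\<Prod>i\<in>UNIV. 1 / real (card (S i)))"
  define K where "K = (\<Sum>x | M x \<noteq> 0. \<bar>M x\<bar>)"
  have q0: "q0 > 0" unfolding q0_def using S(3) by (intro prod_pos) auto
  have K: "K \<ge> 0" unfolding K_def by (intro sum_nonneg) auto
  define \<epsilon> where "\<epsilon> = q0 / (K + 1)"
  have \<epsilon>: "\<epsilon> > 0" using q0 K by (simp add: \<epsilon>_def)
  define P where "P x = Q x + \<epsilon> * M x" for x
  have P_nonneg: "P x \<ge> 0" for x
  proof (cases "M x = 0")
    case True
    then show ?thesis using Q_nonneg by (simp add: P_def)
  next
    case False
    then have "x i \<in> S i" for i by (auto simp: M_def product_measure_def S_def)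
    then have Qx: "Q x = q0" by (simp add: Q_def product_measure_def q_def q0_def)
    have "\<bar>M x\<bar> \<le> K" unfolding K_def using False finM by (intro member_le_sum) auto
    then have "\<epsilon> * \<bar>M x\<bar> \<le> \<epsilon> * (K + 1)" using \<epsilon> by (intro mult_left_mono) auto
    also have "\<dots> = q0" using K by (simp add: \<epsilon>_def)
    finally have "\<bar>\<epsilon> * M x\<bar> \<le> q0" using \<epsilon> by (simp add: abs_mult)
    then show ?thesis by (simp add: P_def Qx)
  qed
  have margP: "marginal P F x = marginal Q F x + \<epsilon> * marginal M F x" for F x
    unfolding P_def using marginal_add_scaled[OF finQ finM] .
  have P_dm: "discrete_measure_on (prod_points d) P"
  proof -
    have sub: "{x. P x \<noteq> 0} \<subseteq> {x. Q x \<noteq> 0} \<union> {x. M x \<noteq> 0}" by (auto simp: P_def)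
    moreover have "discrete_measure_on (prod_points d) M"
      using M_null by (simp add: null_marginal_measures_iff)
    ultimately show ?thesis
      using Q_dm finite_subset[OF sub] finQ finM unfolding discrete_measure_on_def by blast
  qed
  have P_prob: "discrete_probability_on (prod_points d) P"
    using P_dm P_nonneg margP[of "{}"] margQ[of "{}"] margM[of "{}"]
    by (simp add: discrete_probability_on_def dmeasure_UNIV_eq marginal_def)
  have single: "{j} \<noteq> (UNIV :: 'n set)" for j
  proof
    assume "{j} = (UNIV :: 'n set)"
    then have "CARD('n) = card {j}" by simp
    with n2 show False by simp
  qed
  have proper: "marginal P F x = marginal Q F x" if "F \<noteq> UNIV" for F x
    using that by (simp add: margP margM)
  have "lancaster P x = \<epsilon> * M x" for x
  proof -
    have "lancaster P x - lancaster Q x =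
      (\<Sum>F\<in>UNIV. (-1) ^ (CARD('n) - card F) * ((marginal P F x - marginal Q F x) * (\<Prod>j\<in>-F. marginal Q {j} x)))"
      unfolding lancaster_def by (simp add: proper[OF single] sum_subtractf[symmetric] algebra_simps)
    also have "\<dots> = (\<Sum>F\<in>{UNIV}. (-1) ^ (CARD('n) - card F) * ((marginal P F x - marginal Q F x) * (\<Prod>j\<in>-F. marginal Q {j} x)))"
      by (intro sum.mono_neutral_right) (auto simp: proper)
    also have "\<dots> = \<epsilon> * M x" by (simp add: marginal_UNIV P_def)
    finally show ?thesis
      using lancaster_product_measure[OF Q_prob[unfolded Q_def] finq one] by (simp add: Q_def)
  qed
  moreover have "streitberg P x = \<epsilon> * M x" for x
  proof -
    let ?c = "\<lambda>\<pi>::'n set set. (-1) ^ (card \<pi> - 1) * (fact (card \<pi> - 1) :: real)"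
    have top: "\<pi> = {UNIV}" if "partition_on UNIV \<pi>" "UNIV \<in> \<pi>" for \<pi> :: "'n set set"
    proof -
      have "F = UNIV" if "F \<in> \<pi>" for F
      proof (rule ccontr)
        assume "F \<noteq> UNIV"
        then have "F \<inter> UNIV = {}"
          by (intro disjointD[OF partition_onD2[OF \<open>partition_on UNIV \<pi>\<close>]] that \<open>UNIV \<in> \<pi>\<close>)
        then have "F = {}" by simp
        with that partition_onD3[OF \<open>partition_on UNIV \<pi>\<close>] show False by simp
      qed
      then show ?thesis using that(2) by blast
    qed
    have proper_part: "(\<Prod>F\<in>\<pi>. marginal P F x) = (\<Prod>F\<in>\<pi>. marginal Q F x)"
      if "partition_on UNIV \<pi>" "\<pi> \<noteq> {UNIV}" for \<pi> :: "'n set set"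
    proof (intro prod.cong refl proper notI)
      fix F assume "F \<in> \<pi>" "F = UNIV"
      then have "\<pi> = {UNIV}" using top[OF that(1)] by simp
      with that(2) show False by contradiction
    qed
    have "streitberg P x - streitberg Q x =
      (\<Sum>\<pi> | partition_on UNIV \<pi>. ?c \<pi> * ((\<Prod>F\<in>\<pi>. marginal P F x) - (\<Prod>F\<in>\<pi>. marginal Q F x)))"
      unfolding streitberg_def by (simp add: sum_subtractf[symmetric] right_diff_distrib)
    also have "\<dots> = (\<Sum>\<pi>\<in>{{UNIV}}. ?c \<pi> * ((\<Prod>F\<in>\<pi>. marginal P F x) - (\<Prod>F\<in>\<pi>. marginal Q F x)))"
    proof (rule sum.mono_neutral_right)
      show "{{UNIV}} \<subseteq> {\<pi>. partition_on (UNIV :: 'n set) \<pi>}" by (simp add: partition_on_def)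
    qed (use proper_part in auto)
    also have "\<dots> = \<epsilon> * M x" by (simp add: marginal_UNIV P_def)
    finally show ?thesis
      using streitberg_product_measure[OF Q_prob[unfolded Q_def] finq one n2] by (simp add: Q_def)
  qed
  ultimately show ?thesis using that[OF P_prob \<epsilon>] by (auto simp: M_def fun_eq_iff)
qed

lemma dintegral_scale: "e \<noteq> 0 \<Longrightarrow> dintegral (\<lambda>x. e * \<mu> x) f = e * dintegral \<mu> f"
  unfolding dintegral_def by (simp add: sum_distrib_left mult_ac)

lemma dintegral_cmult: "dintegral \<mu> (\<lambda>x. e * f x) = e * dintegral \<mu> f"
  unfolding dintegral_def by (simp add: sum_distrib_left mult_ac)

lemma energy_scale: "e \<noteq> 0 \<Longrightarrow> energy d g (\<lambda>x. e * \<mu> x) = e\<^sup>2 * energy d g \<mu>"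
  unfolding energy_def by (simp add: dintegral_scale dintegral_cmult power2_eq_square)

section \<open>Gaussian kernels\<close>

text \<open>\<open>exp \<langle>x(u), x(v)\<rangle>\<close> is positive definite: so are the powers of the inner product, by
  expanding one factor at a time, and hence the exponential series.\<close>

lemma exp_inner_positive_definite:
  fixes x :: "'a \<Rightarrow> 'b \<Rightarrow> real"
  assumes "finite S" "finite I"
  shows "0 \<le> (\<Sum>u\<in>S. \<Sum>v\<in>S. c u * c v * exp (\<Sum>a\<in>I. x a u * x a v))"
proof -
  let ?p = "\<lambda>u v. \<Sum>a\<in>I. x a u * x a v"
  have pow: "0 \<le> (\<Sum>u\<in>S. \<Sum>v\<in>S. c u * c v * ?p u v ^ k)" for c k
  proof (induction k arbitrary: c)
    case 0
    have "(\<Sum>u\<in>S. \<Sum>v\<in>S. c u * c v) = (\<Sum>u\<in>S. c u)\<^sup>2"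
      by (simp add: power2_eq_square sum_product)
    then show ?case by simp
  next
    case (Suc k)
    have "(\<Sum>u\<in>S. \<Sum>v\<in>S. c u * c v * ?p u v ^ Suc k)
        = (\<Sum>u\<in>S. \<Sum>v\<in>S. \<Sum>a\<in>I. (c u * x a u) * (c v * x a v) * ?p u v ^ k)"
      by (simp add: sum_distrib_left sum_distrib_right mult_ac)
    also have "\<dots> = (\<Sum>u\<in>S. \<Sum>a\<in>I. \<Sum>v\<in>S. (c u * x a u) * (c v * x a v) * ?p u v ^ k)"
      by (intro sum.cong refl, rule sum.swap)
    also have "\<dots> = (\<Sum>a\<in>I. \<Sum>u\<in>S. \<Sum>v\<in>S. (c u * x a u) * (c v * x a v) * ?p u v ^ k)"
      by (rule sum.swap)
    also have "\<dots> \<ge> 0" by (intro sum_nonneg Suc.IH)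
    finally show ?case .
  qed
  have "(\<lambda>N. \<Sum>k<N. ?p u v ^ k / fact k) \<longlonglongrightarrow> exp (?p u v)" for u v
    using exp_converges[of "?p u v"] by (simp add: sums_def divide_inverse mult.commute)
  then have "(\<lambda>N. \<Sum>u\<in>S. \<Sum>v\<in>S. c u * c v * (\<Sum>k<N. ?p u v ^ k / fact k))
      \<longlonglongrightarrow> (\<Sum>u\<in>S. \<Sum>v\<in>S. c u * c v * exp (?p u v))"
    by (intro tendsto_sum tendsto_mult tendsto_const)
  moreover have "0 \<le> (\<Sum>u\<in>S. \<Sum>v\<in>S. c u * c v * (\<Sum>k<N. ?p u v ^ k / fact k))" for N
  proof -
    have "(\<Sum>u\<in>S. \<Sum>v\<in>S. c u * c v * (\<Sum>k<N. ?p u v ^ k / fact k))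
        = (\<Sum>u\<in>S. \<Sum>v\<in>S. \<Sum>k<N. c u * c v * ?p u v ^ k / fact k)"
      by (simp add: sum_distrib_left)
    also have "\<dots> = (\<Sum>u\<in>S. \<Sum>k<N. \<Sum>v\<in>S. c u * c v * ?p u v ^ k / fact k)"
      by (intro sum.cong refl, rule sum.swap)
    also have "\<dots> = (\<Sum>k<N. \<Sum>u\<in>S. \<Sum>v\<in>S. c u * c v * ?p u v ^ k / fact k)"
      by (rule sum.swap)
    also have "\<dots> = (\<Sum>k<N. (\<Sum>u\<in>S. \<Sum>v\<in>S. c u * c v * ?p u v ^ k) / fact k)"
      by (simp only: sum_divide_distrib)
    also have "\<dots> \<ge> 0" by (intro sum_nonneg divide_nonneg_pos pow) simp
    finally show ?thesis .
  qed
  ultimately show ?thesis by (intro LIMSEQ_le_const) auto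
qed

lemma sqdists_nth: "sqdists d u v $ i = (\<Sum>k<d. (u i k - v i k)\<^sup>2)"
  unfolding sqdists_def L2_set_def by (simp add: sum_nonneg)

lemma sqdists_in_orthant: "sqdists d u v \<in> closed_orthant"
  by (simp add: closed_orthant_def sqdists_nth sum_nonneg)

text \<open>In \<open>-\<Sum>\<^sub>i r\<^sub>i \<parallel>u\<^sub>i - v\<^sub>i\<parallel>\<^sup>2\<close> the squares are absorbed by the weights, and the mixed term is the
  inner product of the vectors \<open>\<surd>(2 r\<^sub>i) u\<^sub>i\<close> and \<open>\<surd>(2 r\<^sub>i) v\<^sub>i\<close>.\<close>

lemma gaussian_energy_nonneg:
  fixes \<mu> :: "('n::finite \<Rightarrow> nat \<Rightarrow> real) \<Rightarrow> real"
  assumes fin: "finite S" and r: "\<And>i. 0 \<le> r i"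
  shows "0 \<le> (\<Sum>v\<in>S. \<Sum>u\<in>S. \<mu> v * \<mu> u * (\<Prod>i\<in>UNIV. exp (- r i * sqdists d u v $ i)))"
proof -
  define q where "q u = (\<Sum>i\<in>UNIV. \<Sum>k<d. r i * (u i k)\<^sup>2)" for u :: "'n \<Rightarrow> nat \<Rightarrow> real"
  define x where "x a u = sqrt (2 * r (fst a)) * u (fst a) (snd a)" for a and u :: "'n \<Rightarrow> nat \<Rightarrow> real"
  let ?I = "(UNIV :: 'n set) \<times> {..<d}"
  have x: "(\<Sum>a\<in>?I. x a u * x a v) = (\<Sum>i\<in>UNIV. \<Sum>k<d. 2 * r i * u i k * v i k)" for u v
  proof -
    have "x a u * x a v = 2 * r (fst a) * u (fst a) (snd a) * v (fst a) (snd a)" for a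
    proof -
      have "sqrt (2 * r (fst a)) * sqrt (2 * r (fst a)) = 2 * r (fst a)" using r[of "fst a"] by simp
      then show ?thesis by (simp add: x_def algebra_simps)
    qed
    then show ?thesis by (simp add: sum.cartesian_product case_prod_unfold)
  qed
  have "(\<Prod>i\<in>UNIV. exp (- r i * sqdists d u v $ i)) = exp (- q v) * exp (- q u) * exp (\<Sum>a\<in>?I. x a v * x a u)" for u v
  proof -
    have "(\<Sum>i\<in>UNIV. - r i * sqdists d u v $ i) = - q v + - q u + (\<Sum>a\<in>?I. x a v * x a u)"
      unfolding x q_def sqdists_nth sum_negf[symmetric] sum.distrib[symmetric] sum_distrib_left
      by (intro sum.cong refl) (simp add: power2_eq_square algebra_simps)
    then show ?thesis by (simp only: exp_sum[symmetric, OF finite_class.finite_UNIV] exp_add)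
  qed
  then have "(\<Sum>v\<in>S. \<Sum>u\<in>S. \<mu> v * \<mu> u * (\<Prod>i\<in>UNIV. exp (- r i * sqdists d u v $ i)))
    = (\<Sum>v\<in>S. \<Sum>u\<in>S. (\<mu> v * exp (- q v)) * (\<mu> u * exp (- q u)) * exp (\<Sum>a\<in>?I. x a v * x a u))"
    by (simp add: mult_ac)
  also have "\<dots> \<ge> 0" by (intro exp_inner_positive_definite fin) simp
  finally show ?thesis .
qed

text \<open>In the expansion of \<open>\<Prod>\<^sub>i (1 - e\<^bsup>-r_i d_i\<^esup>)\<close> every term but the full Gaussian lacks some
  coordinate, so that it is not seen by a measure with vanishing marginals.\<close>

lemma energy_exp_nonneg:
  fixes \<mu> :: "('n::finite \<Rightarrow> nat \<Rightarrow> real) \<Rightarrow> real"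
  assumes \<mu>: "\<mu> \<in> null_marginal_measures d" and r: "\<And>i. 0 \<le> r i"
  shows "0 \<le> energy d (\<lambda>t. \<Prod>i\<in>UNIV. 1 - exp (- r i * t $ i)) \<mu>"
proof -
  let ?S = "{x. \<mu> x \<noteq> 0}"
  have fin: "finite ?S" and null: "\<And>i x. marginal \<mu> (-{i}) x = 0"
    using \<mu> by (auto simp: null_marginal_measures_iff discrete_measure_on_def)
  let ?e = "\<lambda>i u v. - exp (- r i * sqdists d u v $ i)"
  have expand: "dintegral \<mu> (\<lambda>u. \<Prod>i\<in>UNIV. 1 - exp (- r i * sqdists d u v $ i)) = dintegral \<mu> (\<lambda>u. \<Prod>i\<in>UNIV. ?e i u v)" for v
  proof -
    have "(\<Prod>i\<in>UNIV. 1 - exp (- r i * sqdists d u v $ i)) = (\<Sum>F\<in>Pow UNIV. (\<Prod>i\<in>F. ?e i u v) * (\<Prod>i\<in>UNIV-F. 1))" for u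
      by (subst prod_add[symmetric]) simp_all
    then have "dintegral \<mu> (\<lambda>u. \<Prod>i\<in>UNIV. 1 - exp (- r i * sqdists d u v $ i)) = (\<Sum>u\<in>?S. \<Sum>F\<in>UNIV. \<mu> u * (\<Prod>i\<in>F. ?e i u v))"
      by (simp add: dintegral_def sum_distrib_left)
    also have "\<dots> = (\<Sum>F\<in>UNIV. dintegral \<mu> (\<lambda>u. \<Prod>i\<in>F. ?e i u v))"
      unfolding dintegral_def by (rule sum.swap)
    also have "\<dots> = (\<Sum>F\<in>{UNIV}. dintegral \<mu> (\<lambda>u. \<Prod>i\<in>F. ?e i u v))"
    proof (rule sum.mono_neutral_right)
      show "\<forall>F\<in>UNIV - {UNIV}. dintegral \<mu> (\<lambda>u. \<Prod>i\<in>F. ?e i u v) = 0"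
      proof
        fix F :: "'n set" assume "F \<in> UNIV - {UNIV}"
        then obtain i where i: "i \<notin> F" by blast
        show "dintegral \<mu> (\<lambda>u. \<Prod>i\<in>F. ?e i u v) = 0"
        proof (rule dintegral_null_marginal[OF fin null])
          fix x y :: "'n \<Rightarrow> nat \<Rightarrow> real" assume eq: "\<forall>j. j \<noteq> i \<longrightarrow> x j = y j"
          show "(\<Prod>i\<in>F. ?e i x v) = (\<Prod>i\<in>F. ?e i y v)"
          proof (rule prod.cong[OF refl])
            fix j assume "j \<in> F"
            then have "j \<noteq> i" using i by auto
            then have "x j = y j" using eq by simp
            then show "?e j x v = ?e j y v" by (simp add: sqdists_nth)
          qed
        qed
      qed
    qed auto
    finally show ?thesis by simp
  qed
  have sign: "(-1) ^ CARD('n) * (\<Prod>i\<in>UNIV. ?e i u v) = (\<Prod>i\<in>UNIV. exp (- r i * sqdists d u v $ i))" for u v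
  proof -
    have "(\<Prod>i\<in>UNIV. ?e i u v) = (-1) ^ CARD('n) * (\<Prod>i\<in>UNIV. exp (- r i * sqdists d u v $ i))"
      by (simp add: prod_uminus)
    then show ?thesis by (simp add: power_mult_distrib[symmetric] mult.assoc[symmetric])
  qed
  have "energy d (\<lambda>t. \<Prod>i\<in>UNIV. 1 - exp (- r i * t $ i)) \<mu>
      = dintegral \<mu> (\<lambda>v. dintegral \<mu> (\<lambda>u. (-1) ^ CARD('n) * (\<Prod>i\<in>UNIV. ?e i u v)))"
    unfolding energy_def dintegral_cmult expand ..
  also have "\<dots> = (\<Sum>v\<in>?S. \<Sum>u\<in>?S. \<mu> v * \<mu> u * (\<Prod>i\<in>UNIV. exp (- r i * sqdists d u v $ i)))"
    unfolding sign by (simp add: dintegral_def sum_distrib_left mult.assoc)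
  also have "\<dots> \<ge> 0" by (rule gaussian_energy_nonneg[OF fin r])
  finally show ?thesis .
qed

lemma energy_sum_form:
  "energy d g \<mu> = (\<Sum>v | \<mu> v \<noteq> 0. \<Sum>u | \<mu> u \<noteq> 0. \<mu> v * \<mu> u * ((-1) ^ CARD('n) * g (sqdists d u v)))"
  for g :: "real^'n::finite \<Rightarrow> real"
  by (simp add: energy_def dintegral_def sum_distrib_left mult.assoc)

lemma bernstein_factor_tendsto:
  assumes "0 \<le> r"
  shows "(\<lambda>k. bernstein_factor (r + 1 / real (Suc k)) t) \<longlonglongrightarrow> bernstein_factor r t"
proof -
  have h: "(\<lambda>k. 1 / real (Suc k)) \<longlonglongrightarrow> 0"
    using LIMSEQ_inverse_real_of_nat by (simp add: inverse_eq_divide)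
  from tendsto_add[OF tendsto_const this, of r] have h1: "(\<lambda>k. r + 1 / real (Suc k)) \<longlonglongrightarrow> r" by simp
  have pos: "r + 1 / real (Suc k) > 0" for k
  proof -
    have "1 / real (Suc k) > 0" by simp
    with assms show ?thesis by linarith
  qed
  have eq: "bernstein_factor (r + 1 / real (Suc k)) t
      = (1 - exp (- (r + 1 / real (Suc k)) * t)) / (r + 1 / real (Suc k)) * (1 + (r + 1 / real (Suc k)))" for k
    using pos[of k] by (simp add: bernstein_factor_def)
  show ?thesis
  proof (cases "r = 0")
    case False
    have "(\<lambda>k. (1 - exp (- (r + 1 / real (Suc k)) * t)) / (r + 1 / real (Suc k)) * (1 + (r + 1 / real (Suc k))))
        \<longlonglongrightarrow> (1 - exp (- r * t)) / r * (1 + r)"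
      using False
      by (intro tendsto_mult tendsto_divide tendsto_diff tendsto_add tendsto_const tendsto_exp tendsto_minus h1)
    then show ?thesis using False unfolding eq by (simp add: bernstein_factor_def)
  next
    case True
    have "((\<lambda>h. 1 - exp (- h * t)) has_real_derivative t) (at 0)"
      by (auto intro!: derivative_eq_intros)
    then have "((\<lambda>h. (1 - exp (- h * t)) / h) \<longlongrightarrow> t) (at 0)"
      by (simp add: has_field_derivative_iff)
    then have "(\<lambda>k. (1 - exp (- (1 / real (Suc k)) * t)) / (1 / real (Suc k))) \<longlonglongrightarrow> t"
      by (rule filterlim_compose[of _ _ "at 0"]) (use h in \<open>auto simp: filterlim_at\<close>)
    moreover have "(\<lambda>k. 1 + 1 / real (Suc k)) \<longlonglongrightarrow> 1 + 0" by (intro tendsto_add tendsto_const h)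
    ultimately have "(\<lambda>k. (1 - exp (- (1 / real (Suc k)) * t)) / (1 / real (Suc k)) * (1 + 1 / real (Suc k))) \<longlonglongrightarrow> t * (1 + 0)"
      by (rule tendsto_mult)
    then show ?thesis unfolding eq unfolding True by (simp add: bernstein_factor_def)
  qed
qed

text \<open>Positive parameters only rescale the exponential kernel; a parameter \<open>0\<close> is reached as a limit.\<close>

lemma energy_bernstein_nonneg:
  fixes \<mu> :: "('n::finite \<Rightarrow> nat \<Rightarrow> real) \<Rightarrow> real"
  assumes \<mu>: "\<mu> \<in> null_marginal_measures d" and r: "\<And>i. 0 \<le> r i"
  shows "0 \<le> energy d (\<lambda>t. \<Prod>i\<in>UNIV. bernstein_factor (r i) (t $ i)) \<mu>"
proof -
  let ?r = "\<lambda>k i. r i + 1 / real (Suc k)"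
  have pos: "?r k i > 0" for k i
  proof -
    have "1 / real (Suc k) > 0" by simp
    with r[of i] show ?thesis by linarith
  qed
  have "0 \<le> energy d (\<lambda>t. \<Prod>i\<in>UNIV. bernstein_factor (?r k i) (t $ i)) \<mu>" for k
  proof -
    let ?c = "\<Prod>i\<in>UNIV. (1 + ?r k i) / ?r k i"
    have eq: "(\<Prod>i\<in>UNIV. bernstein_factor (?r k i) (t $ i)) = ?c * (\<Prod>i\<in>UNIV. 1 - exp (- ?r k i * t $ i))" for t :: "real^'n"
      unfolding prod.distrib[symmetric]
    proof (rule prod.cong[OF refl])
      fix i
      show "bernstein_factor (?r k i) (t $ i) = (1 + ?r k i) / ?r k i * (1 - exp (- ?r k i * t $ i))"
        using pos[where k = k and i = i] by (simp only: bernstein_factor_def mult.commute) simp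
    qed
    have "energy d (\<lambda>t. \<Prod>i\<in>UNIV. bernstein_factor (?r k i) (t $ i)) \<mu>
        = ?c * energy d (\<lambda>t. \<Prod>i\<in>UNIV. 1 - exp (- ?r k i * t $ i)) \<mu>"
      unfolding eq energy_def mult.left_commute[of _ ?c] dintegral_cmult ..
    also have "\<dots> \<ge> 0"
    proof (rule mult_nonneg_nonneg)
      have "0 \<le> (1 + ?r k i) / ?r k i" for i
        by (rule divide_nonneg_pos) (use pos[where k = k and i = i] in linarith)+
      then show "0 \<le> ?c" by (intro prod_nonneg)
      show "0 \<le> energy d (\<lambda>t. \<Prod>i\<in>UNIV. 1 - exp (- ?r k i * t $ i)) \<mu>"
        by (rule energy_exp_nonneg[OF \<mu>]) (rule less_imp_le[OF pos])
    qed
    finally show ?thesis .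
  qed
  moreover have "(\<lambda>k. energy d (\<lambda>t. \<Prod>i\<in>UNIV. bernstein_factor (?r k i) (t $ i)) \<mu>)
      \<longlonglongrightarrow> energy d (\<lambda>t. \<Prod>i\<in>UNIV. bernstein_factor (r i) (t $ i)) \<mu>"
    unfolding energy_sum_form
    by (intro tendsto_sum tendsto_mult tendsto_const tendsto_prod bernstein_factor_tendsto r)
  ultimately show ?thesis by (intro LIMSEQ_le_const) auto
qed

lemma bernstein_factor_bounds:
  assumes "0 \<le> r" "0 \<le> t" shows "0 \<le> bernstein_factor r t" "bernstein_factor r t \<le> 1 + t"
proof -
  show "0 \<le> bernstein_factor r t" using assms by (auto simp: bernstein_factor_def)
  show "bernstein_factor r t \<le> 1 + t"
  proof (cases "r = 0")
    case False
    then have r: "r > 0" using assms by simp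
    have "1 - exp (- r * t) \<le> r * t" using exp_ge_add_one_self[of "- r * t"] by simp
    moreover have "(1 - exp (- r * t)) * r \<le> 1 * r" using r by (intro mult_right_mono) auto
    ultimately have "(1 - exp (- r * t)) * (1 + r) \<le> (1 + t) * r" by (simp add: algebra_simps)
    then show ?thesis using r by (simp add: bernstein_factor_def divide_le_eq)
  qed (use assms in \<open>simp add: bernstein_factor_def\<close>)
qed

lemma bernstein_factor_measurable [measurable]: "(\<lambda>r. bernstein_factor r t) \<in> borel_measurable borel"
  unfolding bernstein_factor_def by measurable

lemma prod_bernstein_factor_measurable:
  "(\<lambda>r::real^'n::finite. \<Prod>i\<in>UNIV. bernstein_factor (r $ i) (t i)) \<in> borel_measurable borel"
  by measurable

lemma represents_space:
  assumes "represents \<eta> g" shows "space \<eta> = closed_orthant"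
  using assms sets_eq_imp_space_eq[of \<eta> "restrict_space borel closed_orthant"]
  by (simp add: represents_def space_restrict_space)

lemma represents_measurable:
  assumes "represents \<eta> g" "f \<in> measurable borel N" shows "f \<in> measurable \<eta> N"
proof -
  have "sets \<eta> = sets (restrict_space borel closed_orthant)" using assms(1) by (simp add: represents_def)
  then show ?thesis using measurable_restrict_space1[OF assms(2)] measurable_cong_sets by blast
qed

lemma represents_integrable:
  fixes \<eta> :: "(real^'n::finite) measure"
  assumes rep: "represents \<eta> g" and t: "t \<in> closed_orthant"
  shows "integrable \<eta> (\<lambda>r. \<Prod>i\<in>UNIV. bernstein_factor (r $ i) (t $ i))"
proof (rule finite_measure.integrable_const_bound[of _ _ "\<Prod>i\<in>UNIV. 1 + t $ i"])
  show "finite_measure \<eta>" using rep by (simp add: represents_def)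
  show "(\<lambda>r. \<Prod>i\<in>UNIV. bernstein_factor (r $ i) (t $ i)) \<in> borel_measurable \<eta>"
    by (rule represents_measurable[OF rep prod_bernstein_factor_measurable])
  show "AE r in \<eta>. norm (\<Prod>i\<in>UNIV. bernstein_factor (r $ i) (t $ i)) \<le> (\<Prod>i\<in>UNIV. 1 + t $ i)"
  proof (rule AE_I2)
    fix r assume "r \<in> space \<eta>"
    then have r: "0 \<le> r $ i" for i using represents_space[OF rep] by (simp add: closed_orthant_def)
    have t0: "0 \<le> t $ i" for i using t by (simp add: closed_orthant_def)
    have "norm (\<Prod>i\<in>UNIV. bernstein_factor (r $ i) (t $ i)) = (\<Prod>i\<in>UNIV. bernstein_factor (r $ i) (t $ i))"
      unfolding real_norm_def by (intro abs_of_nonneg prod_nonneg bernstein_factor_bounds r t0)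
    also have "\<dots> \<le> (\<Prod>i\<in>UNIV. 1 + t $ i)"
      by (intro prod_mono conjI bernstein_factor_bounds r t0)
    finally show "norm (\<Prod>i\<in>UNIV. bernstein_factor (r $ i) (t $ i)) \<le> (\<Prod>i\<in>UNIV. 1 + t $ i)" .
  qed
qed

theorem PDI_if_represents:
  fixes g :: "real^'n::finite \<Rightarrow> real"
  assumes rep: "represents \<eta> g" shows "PDI_inf g"
  unfolding PDI_inf_def
proof (intro allI impI ballI)
  fix d :: nat and \<mu> :: "('n \<Rightarrow> nat \<Rightarrow> real) \<Rightarrow> real"
  assume \<mu>: "\<mu> \<in> null_marginal_measures d"
  let ?b = "\<lambda>t r. \<Prod>i\<in>UNIV. bernstein_factor (r $ i) (t $ i)"
  have int: "integrable \<eta> (?b (sqdists d u v))" for u v :: "'n \<Rightarrow> nat \<Rightarrow> real"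
    by (rule represents_integrable[OF rep sqdists_in_orthant])
  have g: "g (sqdists d u v) = (\<integral>r. ?b (sqdists d u v) r \<partial>\<eta>)" for u v :: "'n \<Rightarrow> nat \<Rightarrow> real"
    using rep sqdists_in_orthant[of d u v] by (simp add: represents_def)
  have "energy d g \<mu> = (\<Sum>v | \<mu> v \<noteq> 0. \<Sum>u | \<mu> u \<noteq> 0. \<mu> v * \<mu> u * ((-1) ^ CARD('n) * (\<integral>r. ?b (sqdists d u v) r \<partial>\<eta>)))"
    unfolding energy_sum_form g ..
  also have "\<dots> = (\<integral>r. (\<Sum>v | \<mu> v \<noteq> 0. \<Sum>u | \<mu> u \<noteq> 0. \<mu> v * \<mu> u * ((-1) ^ CARD('n) * ?b (sqdists d u v) r)) \<partial>\<eta>)"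
    by (simp add: int)
  also have "\<dots> = (\<integral>r. energy d (\<lambda>t. ?b t r) \<mu> \<partial>\<eta>)"
    unfolding energy_sum_form ..
  also have "\<dots> \<ge> 0"
  proof (rule integral_nonneg_AE, rule AE_I2)
    fix r assume "r \<in> space \<eta>"
    then have "0 \<le> r $ i" for i using represents_space[OF rep] by (simp add: closed_orthant_def)
    then show "0 \<le> energy d (\<lambda>t. ?b t r) \<mu>" by (intro energy_bernstein_nonneg \<mu>)
  qed
  finally show "0 \<le> energy d g \<mu>" .
qed

section \<open>Iterated differences\<close>

definition dec :: "'n::finite \<Rightarrow> real \<Rightarrow> (real^'n \<Rightarrow> real) \<Rightarrow> real^'n \<Rightarrow> real" where
  "dec i h f t = f t - f (t + h *\<^sub>R axis i 1)"

definition decs :: "('n::finite \<times> real) list \<Rightarrow> (real^'n \<Rightarrow> real) \<Rightarrow> real^'n \<Rightarrow> real" where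
  "decs L f = foldr (\<lambda>(i, h). dec i h) L f"

text \<open>The first part \<open>L\<close> of the list takes one difference in each coordinate, as the derivative
  \<open>\<partial>\<^sub>1\<dots>\<partial>\<^sub>n\<close> does; the second part expresses that the result is completely monotone.\<close>

definition alternating_differences :: "(real^'n::finite \<Rightarrow> real) \<Rightarrow> bool" where
  "alternating_differences f \<longleftrightarrow>
     (\<forall>L L'. distinct (map fst L) \<and> set (map fst L) = UNIV \<and> (\<forall>(i, h)\<in>set (L @ L'). 0 < h) \<longrightarrow>
        (\<forall>t\<in>closed_orthant. 0 \<le> decs (L @ L') f t))"

lemma decs_Nil [simp]: "decs [] f = f" by (simp add: decs_def)

lemma decs_Cons: "decs ((i, h) # L) f = dec i h (decs L f)" by (simp add: decs_def)

lemma decs_snoc: "decs (L @ [(i, h)]) f = decs L (dec i h f)" by (simp add: decs_def)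

section \<open>Energies of product measures\<close>

lemma sum_PiE_split:
  fixes h :: "('n::finite \<Rightarrow> 'a) \<Rightarrow> real"
  shows "(\<Sum>p\<in>(\<Pi>\<^sub>E j\<in>UNIV. A j). h p) = (\<Sum>q\<in>(\<Pi>\<^sub>E j\<in>UNIV-{i}. A j). \<Sum>x\<in>A i. h (q(i := x)))"
proof -
  have "(\<Pi>\<^sub>E j\<in>UNIV. A j) = (\<Pi>\<^sub>E j\<in>insert i (UNIV-{i}). A j)" by (simp add: insert_UNIV)
  also have "\<dots> = (\<lambda>(x, q). q(i := x)) ` (A i \<times> (\<Pi>\<^sub>E j\<in>UNIV-{i}. A j))"
    by (rule PiE_insert_eq)
  finally have eq: "(\<Pi>\<^sub>E j\<in>UNIV. A j) = (\<lambda>(x, q). q(i := x)) ` (A i \<times> (\<Pi>\<^sub>E j\<in>UNIV-{i}. A j))" .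
  have "(\<Sum>p\<in>(\<Pi>\<^sub>E j\<in>UNIV. A j). h p) = (\<Sum>(x, q)\<in>A i \<times> (\<Pi>\<^sub>E j\<in>UNIV-{i}. A j). h (q(i := x)))"
    unfolding eq by (subst sum.reindex) (auto simp: case_prod_beta comp_def intro!: inj_combinator)
  also have "\<dots> = (\<Sum>x\<in>A i. \<Sum>q\<in>(\<Pi>\<^sub>E j\<in>UNIV-{i}. A j). h (q(i := x)))"
    by (rule sum.cartesian_product[symmetric])
  also have "\<dots> = (\<Sum>q\<in>(\<Pi>\<^sub>E j\<in>UNIV-{i}. A j). \<Sum>x\<in>A i. h (q(i := x)))" by (rule sum.swap)
  finally show ?thesis .
qed

definition pair_energy :: "nat \<Rightarrow> (real^'n::finite \<Rightarrow> real) \<Rightarrow> ('n \<Rightarrow> (nat \<Rightarrow> real) \<Rightarrow> real) \<Rightarrow> real" where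
  "pair_energy d f \<mu> =
     dintegral (product_measure \<mu>) (\<lambda>v. dintegral (product_measure \<mu>) (\<lambda>u. f (sqdists d u v)))"

abbreviation (input) R_pow :: "nat \<Rightarrow> (nat \<Rightarrow> real) set" where
  "R_pow d \<equiv> topspace (Euclidean_space d)"

definition point_mass :: "(nat \<Rightarrow> real) \<Rightarrow> real" where
  "point_mass z = (if z = (\<lambda>_. 0) then 1 else 0)"

lemma point_mass_discrete: "discrete_measure_on (R_pow d) point_mass"
proof -
  have "{z. point_mass z \<noteq> 0} = {\<lambda>_. 0}" by (auto simp: point_mass_def)
  then show ?thesis by (simp add: discrete_measure_on_def topspace_Euclidean_space)
qed

lemma discrete_measure_on_mono: "discrete_measure_on X \<mu> \<Longrightarrow> X \<subseteq> Y \<Longrightarrow> discrete_measure_on Y \<mu>"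
  by (auto simp: discrete_measure_on_def)

lemma dintegral_swap:
  "dintegral \<mu> (\<lambda>w. dintegral \<nu> (\<lambda>u. F w u)) = dintegral \<nu> (\<lambda>u. dintegral \<mu> (\<lambda>w. F w u))"
  unfolding dintegral_def sum_distrib_left
  by (subst sum.swap) (simp only: mult.left_commute)

lemma dintegral_cong: "(\<And>x. \<mu> x \<noteq> 0 \<Longrightarrow> f x = g x) \<Longrightarrow> dintegral \<mu> f = dintegral \<mu> g"
  unfolding dintegral_def by (rule sum.cong[OF refl]) simp

lemma dintegral_sum: "dintegral \<mu> (\<lambda>x. \<Sum>l\<in>A. f l x) = (\<Sum>l\<in>A. dintegral \<mu> (f l))"
  unfolding dintegral_def sum_distrib_left by (rule sum.swap)

text \<open>Fubini for one coordinate; the point mass only fills the place of coordinate \<open>i\<close>.\<close>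

lemma dintegral_product_split:
  fixes \<mu> :: "'n::finite \<Rightarrow> (nat \<Rightarrow> real) \<Rightarrow> real"
  assumes fin: "\<And>j. finite {z. \<mu> j z \<noteq> 0}"
  shows "dintegral (product_measure \<mu>) \<phi> =
     dintegral (product_measure (\<mu>(i := point_mass))) (\<lambda>x. dintegral (\<mu> i) (\<lambda>z. \<phi> (x(i := z))))"
proof -
  define S where "S = insert (\<lambda>_. 0) (\<Union>j. {z. \<mu> j z \<noteq> 0})"
  have finS: "finite S" using fin by (simp add: S_def)
  let ?P = "\<Pi>\<^sub>E j\<in>(UNIV :: 'n set). S" and ?Q = "\<Pi>\<^sub>E j\<in>(UNIV - {i} :: 'n set). S"
  have finP: "finite ?P" using finS by (intro finite_PiE) auto
  have int: "dintegral (product_measure \<nu>) \<psi> = (\<Sum>q\<in>?Q. \<Sum>y\<in>S. \<nu> i y * (\<Prod>j\<in>UNIV-{i}. \<nu> j (q j)) * \<psi> (q(i := y)))"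
    if "\<And>j z. \<nu> j z \<noteq> 0 \<Longrightarrow> z \<in> S" for \<nu> :: "'n \<Rightarrow> (nat \<Rightarrow> real) \<Rightarrow> real" and \<psi>
  proof -
    have "{x. product_measure \<nu> x \<noteq> 0} \<subseteq> ?P" using that by (auto simp: product_measure_def PiE_UNIV_domain)
    then have "dintegral (product_measure \<nu>) \<psi> = (\<Sum>x\<in>?P. product_measure \<nu> x * \<psi> x)"
      by (rule dintegral_superset[OF finP])
    also have "\<dots> = (\<Sum>q\<in>?Q. \<Sum>y\<in>S. product_measure \<nu> (q(i := y)) * \<psi> (q(i := y)))"
      by (rule sum_PiE_split)
    also have "\<dots> = (\<Sum>q\<in>?Q. \<Sum>y\<in>S. \<nu> i y * (\<Prod>j\<in>UNIV-{i}. \<nu> j (q j)) * \<psi> (q(i := y)))"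
    proof (intro sum.cong refl)
      fix q y
      have "(\<Prod>j\<in>UNIV-{i}. \<nu> j ((q(i := y)) j)) = (\<Prod>j\<in>UNIV-{i}. \<nu> j (q j))"
        by (rule prod.cong[OF refl]) simp
      then have "product_measure \<nu> (q(i := y)) = \<nu> i y * (\<Prod>j\<in>UNIV-{i}. \<nu> j (q j))"
        unfolding product_measure_def
        by (subst prod.remove[OF finite_class.finite_UNIV UNIV_I, of _ i]) simp
      then show "product_measure \<nu> (q(i := y)) * \<psi> (q(i := y)) = \<nu> i y * (\<Prod>j\<in>UNIV-{i}. \<nu> j (q j)) * \<psi> (q(i := y))"
        by simp
    qed
    finally show ?thesis .
  qed
  have 1: "z \<in> S" if "\<mu> j z \<noteq> 0" for j z using that by (auto simp: S_def)
  have 2: "z \<in> S" if "(\<mu>(i := point_mass)) j z \<noteq> 0" for j z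
    using that by (cases "j = i") (auto simp: S_def point_mass_def split: if_splits)
  have one: "dintegral (\<mu> i) f = (\<Sum>z\<in>S. \<mu> i z * f z)" for f
    using 1 by (intro dintegral_superset[OF finS]) blast
  have "dintegral (product_measure (\<mu>(i := point_mass))) (\<lambda>x. dintegral (\<mu> i) (\<lambda>z. \<phi> (x(i := z))))
      = (\<Sum>q\<in>?Q. \<Sum>y\<in>S. point_mass y * (\<Prod>j\<in>UNIV-{i}. \<mu> j (q j)) * dintegral (\<mu> i) (\<lambda>z. \<phi> (q(i := z))))"
  proof -
    have "(\<Prod>j\<in>UNIV-{i}. (\<mu>(i := point_mass)) j (q j)) = (\<Prod>j\<in>UNIV-{i}. \<mu> j (q j))" for q
      by (rule prod.cong[OF refl]) simp
    then show ?thesis by (simp only: int[OF 2] fun_upd_same fun_upd_upd)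
  qed
  also have "\<dots> = (\<Sum>q\<in>?Q. (\<Prod>j\<in>UNIV-{i}. \<mu> j (q j)) * dintegral (\<mu> i) (\<lambda>z. \<phi> (q(i := z))))"
  proof (rule sum.cong[OF refl])
    fix q
    have "(\<Sum>y\<in>S. point_mass y * (\<Prod>j\<in>UNIV-{i}. \<mu> j (q j)) * dintegral (\<mu> i) (\<lambda>z. \<phi> (q(i := z))))
        = (\<Sum>y\<in>S. if y = (\<lambda>_. 0) then (\<Prod>j\<in>UNIV-{i}. \<mu> j (q j)) * dintegral (\<mu> i) (\<lambda>z. \<phi> (q(i := z))) else 0)"
      by (rule sum.cong[OF refl]) (simp add: point_mass_def)
    also have "\<dots> = (\<Prod>j\<in>UNIV-{i}. \<mu> j (q j)) * dintegral (\<mu> i) (\<lambda>z. \<phi> (q(i := z)))"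
      by (subst sum.delta[OF finS]) (simp add: S_def)
    finally show "(\<Sum>y\<in>S. point_mass y * (\<Prod>j\<in>UNIV-{i}. \<mu> j (q j)) * dintegral (\<mu> i) (\<lambda>z. \<phi> (q(i := z)))) = \<dots>" .
  qed
  also have "\<dots> = (\<Sum>q\<in>?Q. \<Sum>z\<in>S. \<mu> i z * (\<Prod>j\<in>UNIV-{i}. \<mu> j (q j)) * \<phi> (q(i := z)))"
    unfolding one sum_distrib_left by (simp only: mult_ac)
  also have "\<dots> = dintegral (product_measure \<mu>) \<phi>" by (rule int[OF 1, symmetric])
  finally show ?thesis by simp
qed

definition sqdist :: "nat \<Rightarrow> (nat \<Rightarrow> real) \<Rightarrow> (nat \<Rightarrow> real) \<Rightarrow> real" where
  "sqdist d z w = (\<Sum>k<d. (z k - w k)\<^sup>2)"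

lemma pair_energy_split:
  fixes f :: "real^'n::finite \<Rightarrow> real"
  assumes fin: "\<And>j. finite {z. \<mu> j z \<noteq> 0}"
  shows "pair_energy d f \<mu> =
    dintegral (product_measure (\<mu>(i := point_mass))) (\<lambda>v. dintegral (product_measure (\<mu>(i := point_mass))) (\<lambda>u.
      dintegral (\<mu> i) (\<lambda>w. dintegral (\<mu> i) (\<lambda>z.
        f (\<chi> j. if j = i then sqdist d z w else sqdist d (u j) (v j))))))"
proof -
  have eq: "sqdists d (u(i := z)) (v(i := w)) = (\<chi> j. if j = i then sqdist d z w else sqdist d (u j) (v j))" for u v z w
    by (simp add: vec_eq_iff sqdists_nth sqdist_def)
  let ?R = "product_measure (\<mu>(i := point_mass))"
  have "pair_energy d f \<mu> = dintegral ?R (\<lambda>v. dintegral (\<mu> i) (\<lambda>w. dintegral ?R (\<lambda>u. dintegral (\<mu> i) (\<lambda>z.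
      f (sqdists d (u(i := z)) (v(i := w)))))))"
    unfolding pair_energy_def
    by (subst dintegral_product_split[OF fin, where i = i], subst dintegral_product_split[OF fin, where i = i], rule refl)
  also have "\<dots> = dintegral ?R (\<lambda>v. dintegral ?R (\<lambda>u. dintegral (\<mu> i) (\<lambda>w. dintegral (\<mu> i) (\<lambda>z.
      f (sqdists d (u(i := z)) (v(i := w)))))))"
    by (rule arg_cong[where f = "dintegral ?R"], rule ext, rule dintegral_swap)
  finally show ?thesis unfolding eq .
qed

text \<open>Direction \<open>l\<close> is the fresh coordinate \<open>d + l\<close>, orthogonal to \<open>\<real>\<^sup>d\<close> and to the other directions,
  so that squared distances add up.\<close>

definition new_direction :: "nat \<Rightarrow> (nat \<Rightarrow> real) \<Rightarrow> nat \<Rightarrow> nat \<Rightarrow> real" where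
  "new_direction d \<alpha> l k = (if k = d + l then \<alpha> l else 0)"

definition mixture :: "nat \<Rightarrow> nat \<Rightarrow> (nat \<Rightarrow> real) \<Rightarrow> (nat \<Rightarrow> real) \<Rightarrow> ((nat \<Rightarrow> real) \<Rightarrow> real) \<Rightarrow> (nat \<Rightarrow> real) \<Rightarrow> real" where
  "mixture d K c \<alpha> \<mu> z = (\<Sum>l<K. c l * \<mu> (\<lambda>k. z k - new_direction d \<alpha> l k))"

lemma translate_support:
  "{z. \<mu> (\<lambda>k. z k - a k) \<noteq> 0} = (\<lambda>z k. z k + a k) ` {z. \<mu> z \<noteq> (0 :: real)}"
  for a :: "nat \<Rightarrow> real"
proof (intro equalityI subsetI)
  fix z assume "z \<in> {z. \<mu> (\<lambda>k. z k - a k) \<noteq> 0}"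
  then show "z \<in> (\<lambda>z k. z k + a k) ` {z. \<mu> z \<noteq> 0}"
    by (intro image_eqI[of _ _ "\<lambda>k. z k - a k"]) auto
qed auto

lemma mixture_support:
  "{z. mixture d K c \<alpha> \<mu> z \<noteq> 0} \<subseteq> (\<Union>l<K. (\<lambda>z k. z k + new_direction d \<alpha> l k) ` {z. \<mu> z \<noteq> 0})"
proof
  fix z assume "z \<in> {z. mixture d K c \<alpha> \<mu> z \<noteq> 0}"
  then obtain l where l: "l < K" "\<mu> (\<lambda>k. z k - new_direction d \<alpha> l k) \<noteq> 0"
    unfolding mixture_def by (auto elim!: sum.not_neutral_contains_not_neutral)
  then have "z \<in> {z. \<mu> (\<lambda>k. z k - new_direction d \<alpha> l k) \<noteq> 0}" by simp
  then show "z \<in> (\<Union>l<K. (\<lambda>z k. z k + new_direction d \<alpha> l k) ` {z. \<mu> z \<noteq> 0})"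
    unfolding translate_support using l(1) by blast
qed

lemma mixture_discrete:
  assumes "discrete_measure_on (R_pow d) \<mu>"
  shows "discrete_measure_on (R_pow (d + K)) (mixture d K c \<alpha> \<mu>)"
proof -
  have fin: "finite {z. \<mu> z \<noteq> 0}" and sub: "{z. \<mu> z \<noteq> 0} \<subseteq> R_pow d"
    using assms by (simp_all add: discrete_measure_on_def)
  have "(\<lambda>k. z k + new_direction d \<alpha> l k) \<in> R_pow (d + K)" if "z \<in> R_pow d" "l < K" for z l
    using that by (auto simp: topspace_Euclidean_space new_direction_def)
  then have "(\<Union>l<K. (\<lambda>z k. z k + new_direction d \<alpha> l k) ` {z. \<mu> z \<noteq> 0}) \<subseteq> R_pow (d + K)"
    using sub by blast
  moreover have "finite (\<Union>l<K. (\<lambda>z k. z k + new_direction d \<alpha> l k) ` {z. \<mu> z \<noteq> 0})" using fin by simp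
  ultimately show ?thesis
    unfolding discrete_measure_on_def using mixture_support by (meson finite_subset order_trans)
qed

lemma dintegral_mixture:
  assumes fin: "finite {z. \<mu> z \<noteq> 0}"
  shows "dintegral (mixture d K c \<alpha> \<mu>) \<phi> =
    (\<Sum>l<K. c l * dintegral \<mu> (\<lambda>z. \<phi> (\<lambda>k. z k + new_direction d \<alpha> l k)))"
proof -
  let ?t = "\<lambda>l z k. z k + new_direction d \<alpha> l k"
  let ?S = "\<Union>l<K. ?t l ` {z. \<mu> z \<noteq> 0}"
  have finS: "finite ?S" using fin by simp
  have "dintegral (mixture d K c \<alpha> \<mu>) \<phi> = (\<Sum>z\<in>?S. mixture d K c \<alpha> \<mu> z * \<phi> z)"
    by (rule dintegral_superset[OF finS mixture_support])
  also have "\<dots> = (\<Sum>z\<in>?S. \<Sum>l<K. c l * (\<mu> (\<lambda>k. z k - new_direction d \<alpha> l k) * \<phi> z))"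
    unfolding mixture_def sum_distrib_right mult.assoc ..
  also have "\<dots> = (\<Sum>l<K. \<Sum>z\<in>?S. c l * (\<mu> (\<lambda>k. z k - new_direction d \<alpha> l k) * \<phi> z))"
    by (rule sum.swap)
  also have "\<dots> = (\<Sum>l<K. c l * dintegral \<mu> (\<lambda>z. \<phi> (?t l z)))"
  proof (rule sum.cong[OF refl])
    fix l assume l: "l \<in> {..<K}"
    let ?m = "\<lambda>z. \<mu> (\<lambda>k. z k - new_direction d \<alpha> l k)"
    have "(\<Sum>z\<in>?S. ?m z * \<phi> z) = dintegral ?m \<phi>"
    proof (rule dintegral_superset[OF finS, symmetric])
      show "{z. ?m z \<noteq> 0} \<subseteq> ?S" unfolding translate_support using l by blast
    qed
    also have "\<dots> = (\<Sum>z\<in>?t l ` {z. \<mu> z \<noteq> 0}. ?m z * \<phi> z)"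
      unfolding dintegral_def translate_support ..
    also have "\<dots> = dintegral \<mu> (\<lambda>z. \<phi> (?t l z))"
    proof -
      have inj: "inj_on (?t l) {z. \<mu> z \<noteq> 0}" by (auto intro!: inj_onI simp: fun_eq_iff)
      show ?thesis unfolding dintegral_def sum.reindex[OF inj] by (simp add: comp_def)
    qed
    finally show "(\<Sum>z\<in>?S. c l * (?m z * \<phi> z)) = c l * dintegral \<mu> (\<lambda>z. \<phi> (?t l z))"
      by (simp only: sum_distrib_left[symmetric])
  qed
  finally show ?thesis .
qed

lemma dmeasure_mixture:
  assumes \<mu>: "discrete_measure_on (R_pow d) \<mu>"
  shows "dmeasure (mixture d K c \<alpha> \<mu>) UNIV = (\<Sum>l<K. c l) * dmeasure \<mu> UNIV"
proof -
  have f: "finite {z. \<mu> z \<noteq> 0}" "finite {z. mixture d K c \<alpha> \<mu> z \<noteq> 0}"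
    using \<mu> mixture_discrete[OF \<mu>, of K c \<alpha>] by (simp_all add: discrete_measure_on_def)
  show ?thesis
    unfolding dmeasure_eq_dintegral[OF f(1)] dmeasure_eq_dintegral[OF f(2)] dintegral_mixture[OF f(1)]
    by (simp add: sum_distrib_right)
qed

lemma sqdist_new_directions:
  assumes "z \<in> R_pow d" "w \<in> R_pow d" "l < K" "m < K"
  shows "sqdist (d + K) (\<lambda>k. z k + new_direction d \<alpha> l k) (\<lambda>k. w k + new_direction d \<alpha> m k)
    = sqdist d z w + (if l = m then 0 else (\<alpha> l)\<^sup>2 + (\<alpha> m)\<^sup>2)"
proof -
  define g where "g k = ((z k + new_direction d \<alpha> l k) - (w k + new_direction d \<alpha> m k))\<^sup>2" for k
  have "sqdist (d + K) (\<lambda>k. z k + new_direction d \<alpha> l k) (\<lambda>k. w k + new_direction d \<alpha> m k) = (\<Sum>k<d+K. g k)"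
    by (simp add: sqdist_def g_def)
  also have "\<dots> = (\<Sum>k<d. g k) + (\<Sum>j<K. g (d + j))"
    by (induction K) (simp_all add: add.assoc)
  also have "(\<Sum>k<d. g k) = sqdist d z w"
    unfolding sqdist_def by (rule sum.cong[OF refl]) (simp add: g_def new_direction_def)
  also have "(\<Sum>j<K. g (d + j)) = (\<Sum>j<K. ((if j = l then \<alpha> l else 0) - (if j = m then \<alpha> m else 0))\<^sup>2)"
    using assms(1,2) by (intro sum.cong refl) (simp add: g_def new_direction_def topspace_Euclidean_space)
  also have "\<dots> = (if l = m then 0 else (\<alpha> l)\<^sup>2 + (\<alpha> m)\<^sup>2)"
  proof (cases "l = m")
    case False
    have "(\<Sum>j<K. ((if j = l then \<alpha> l else 0) - (if j = m then \<alpha> m else 0))\<^sup>2)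
        = (\<Sum>j<K. (if j = l then (\<alpha> l)\<^sup>2 else 0) + (if j = m then (\<alpha> m)\<^sup>2 else 0))"
      using False by (intro sum.cong refl) auto
    also have "\<dots> = (\<alpha> l)\<^sup>2 + (\<alpha> m)\<^sup>2" using assms(3,4) by (simp add: sum.distrib)
    finally show ?thesis using False by simp
  next
    case True
    show ?thesis unfolding True by simp
  qed
  finally show ?thesis .
qed

lemma sqdist_extend:
  assumes "z \<in> R_pow d" "w \<in> R_pow d" shows "sqdist (d + K) z w = sqdist d z w"
  unfolding sqdist_def using assms
  by (intro sum.mono_neutral_right) (auto simp: topspace_Euclidean_space)

lemma pair_energy_mixture:
  fixes f :: "real^'n::finite \<Rightarrow> real"
  assumes \<mu>: "\<And>j. discrete_measure_on (R_pow d) (\<mu> j)"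
  shows "pair_energy (d + K) f (\<mu>(i := mixture d K c \<alpha> (\<mu> i))) =
    (\<Sum>m<K. \<Sum>l<K. c m * c l * pair_energy d (\<lambda>t. f (t + (if l = m then 0 else (\<alpha> l)\<^sup>2 + (\<alpha> m)\<^sup>2) *\<^sub>R axis i 1)) \<mu>)"
proof -
  have fin: "finite {z. \<mu> j z \<noteq> 0}" and sub: "\<mu> j z \<noteq> 0 \<Longrightarrow> z \<in> R_pow d" for j z
    using \<mu>[of j] by (auto simp: discrete_measure_on_def)
  let ?\<nu> = "\<mu>(i := mixture d K c \<alpha> (\<mu> i))"
  have fin\<nu>: "finite {z. ?\<nu> j z \<noteq> 0}" for j
    using fin mixture_discrete[OF \<mu>, of K c \<alpha> i] by (simp add: discrete_measure_on_def)
  let ?R = "product_measure (\<mu>(i := point_mass))"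
  have R: "u j \<in> R_pow d" if "?R u \<noteq> 0" for u j
  proof -
    have "(\<mu>(i := point_mass)) j (u j) \<noteq> 0"
      using that unfolding product_measure_def by (metis UNIV_I finite_class.finite_UNIV prod_zero)
    then show ?thesis using sub point_mass_discrete[of d]
      by (cases "j = i") (auto simp: discrete_measure_on_def)
  qed
  let ?e = "\<lambda>l m. if l = m then 0 else (\<alpha> l)\<^sup>2 + (\<alpha> m)\<^sup>2"
  have inner: "dintegral (mixture d K c \<alpha> (\<mu> i)) (\<lambda>w. dintegral (mixture d K c \<alpha> (\<mu> i)) (\<lambda>z.
        f (\<chi> j. if j = i then sqdist (d + K) z w else sqdist (d + K) (u j) (v j)))) =
      (\<Sum>m<K. \<Sum>l<K. c m * c l * dintegral (\<mu> i) (\<lambda>w. dintegral (\<mu> i) (\<lambda>z.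
        f ((\<chi> j. if j = i then sqdist d z w else sqdist d (u j) (v j)) + ?e l m *\<^sub>R axis i 1))))"
    if "?R u \<noteq> 0" "?R v \<noteq> 0" for u v
  proof -
    have "dintegral (\<mu> i) (\<lambda>w. dintegral (\<mu> i) (\<lambda>z.
        f (\<chi> j. if j = i then sqdist (d + K) (\<lambda>k. z k + new_direction d \<alpha> l k) (\<lambda>k. w k + new_direction d \<alpha> m k)
            else sqdist (d + K) (u j) (v j)))) =
      dintegral (\<mu> i) (\<lambda>w. dintegral (\<mu> i) (\<lambda>z.
        f ((\<chi> j. if j = i then sqdist d z w else sqdist d (u j) (v j)) + ?e l m *\<^sub>R axis i 1)))"
      if "l < K" "m < K" for l m
    proof (rule dintegral_cong, rule dintegral_cong, rule arg_cong[where f = f])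
      fix w z assume "\<mu> i w \<noteq> 0" "\<mu> i z \<noteq> 0"
      then have "z \<in> R_pow d" "w \<in> R_pow d" using sub by blast+
      note key = sqdist_new_directions[OF this that, of \<alpha>]
      show "(\<chi> j. if j = i then sqdist (d + K) (\<lambda>k. z k + new_direction d \<alpha> l k) (\<lambda>k. w k + new_direction d \<alpha> m k)
            else sqdist (d + K) (u j) (v j)) =
          (\<chi> j. if j = i then sqdist d z w else sqdist d (u j) (v j)) + ?e l m *\<^sub>R axis i 1"
      proof (rule vec_eq_iff[THEN iffD2], rule allI)
        fix j
        have ext: "sqdist (d + K) (u j) (v j) = sqdist d (u j) (v j)"
          by (rule sqdist_extend[OF R[OF \<open>?R u \<noteq> 0\<close>] R[OF \<open>?R v \<noteq> 0\<close>]])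
        show "(\<chi> j. if j = i then sqdist (d + K) (\<lambda>k. z k + new_direction d \<alpha> l k) (\<lambda>k. w k + new_direction d \<alpha> m k)
            else sqdist (d + K) (u j) (v j)) $ j =
          ((\<chi> j. if j = i then sqdist d z w else sqdist d (u j) (v j)) + ?e l m *\<^sub>R axis i 1) $ j"
        proof (cases "j = i")
          case True
          then show ?thesis
            by (simp only: key vec_lambda_beta vector_add_component vector_scaleR_component axis_nth simp_thms if_True real_scaleR_def mult_1_right)
        next
          case False
          then show ?thesis by (simp add: ext axis_def)
        qed
      qed
    qed
    note key = this
    let ?F = "\<lambda>z w. f (\<chi> j. if j = i then sqdist (d + K) z w else sqdist (d + K) (u j) (v j))"
    let ?t = "\<lambda>l (z :: nat \<Rightarrow> real) k. z k + new_direction d \<alpha> l k"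
    have "dintegral (mixture d K c \<alpha> (\<mu> i)) (\<lambda>w. dintegral (mixture d K c \<alpha> (\<mu> i)) (\<lambda>z. ?F z w))
        = (\<Sum>m<K. c m * dintegral (\<mu> i) (\<lambda>w. dintegral (mixture d K c \<alpha> (\<mu> i)) (\<lambda>z. ?F z (?t m w))))"
      by (rule dintegral_mixture[OF fin])
    also have "\<dots> = (\<Sum>m<K. c m * dintegral (\<mu> i) (\<lambda>w. \<Sum>l<K. c l * dintegral (\<mu> i) (\<lambda>z. ?F (?t l z) (?t m w))))"
      by (simp only: dintegral_mixture[OF fin])
    also have "\<dots> = (\<Sum>m<K. \<Sum>l<K. c m * c l * dintegral (\<mu> i) (\<lambda>w. dintegral (\<mu> i) (\<lambda>z. ?F (?t l z) (?t m w))))"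
      by (simp only: dintegral_sum dintegral_cmult sum_distrib_left mult.assoc)
    finally show ?thesis using key by simp
  qed
  have "pair_energy (d + K) f ?\<nu> = dintegral ?R (\<lambda>v. dintegral ?R (\<lambda>u.
      dintegral (mixture d K c \<alpha> (\<mu> i)) (\<lambda>w. dintegral (mixture d K c \<alpha> (\<mu> i)) (\<lambda>z.
        f (\<chi> j. if j = i then sqdist (d + K) z w else sqdist (d + K) (u j) (v j))))))"
    unfolding pair_energy_split[OF fin\<nu>, where i = i] fun_upd_same fun_upd_upd ..
  also have "\<dots> = dintegral ?R (\<lambda>v. dintegral ?R (\<lambda>u. \<Sum>m<K. \<Sum>l<K. c m * c l * dintegral (\<mu> i) (\<lambda>w. dintegral (\<mu> i) (\<lambda>z.
        f ((\<chi> j. if j = i then sqdist d z w else sqdist d (u j) (v j)) + ?e l m *\<^sub>R axis i 1)))))"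
    by (rule dintegral_cong, rule dintegral_cong, rule inner)
  also have "\<dots> = (\<Sum>m<K. \<Sum>l<K. c m * c l * pair_energy d (\<lambda>t. f (t + ?e l m *\<^sub>R axis i 1)) \<mu>)"
    unfolding pair_energy_split[OF fin, where i = i] dintegral_sum dintegral_cmult ..
  finally show ?thesis .
qed

section \<open>Consuming the coordinates one by one\<close>

text \<open>The set \<open>J\<close> collects the coordinates that have not been consumed by a difference, where the
  measure still has to have mass \<open>0\<close>.\<close>

definition PD_products :: "'n::finite set \<Rightarrow> (real^'n \<Rightarrow> real) \<Rightarrow> bool" where
  "PD_products J f \<longleftrightarrow> (\<forall>d\<ge>1. \<forall>\<mu>. (\<forall>i. discrete_measure_on (R_pow d) (\<mu> i)) \<and> (\<forall>i\<in>J. dmeasure (\<mu> i) UNIV = 0)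
     \<longrightarrow> 0 \<le> pair_energy d f \<mu>)"

lemma pair_energy_linear:
  "pair_energy d (\<lambda>t. a * f t + b * f' t) \<mu> = a * pair_energy d f \<mu> + b * pair_energy d f' \<mu>"
  unfolding pair_energy_def dintegral_def
  by (simp add: sum_distrib_left sum.distrib[symmetric] algebra_simps)

text \<open>With the weights \<open>1, -1\<close> at distance \<open>\<surd>h\<close>, a difference with step \<open>h\<close> replaces the
  requirement of mass \<open>0\<close> in coordinate \<open>i\<close>.\<close>

lemma PD_products_dec:
  fixes f :: "real^'n::finite \<Rightarrow> real"
  assumes f: "PD_products J f" and h: "0 < h"
  shows "PD_products (J - {i}) (dec i h f)"
  unfolding PD_products_def
proof (intro allI impI)
  fix d :: nat and \<mu> :: "'n \<Rightarrow> (nat \<Rightarrow> real) \<Rightarrow> real"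
  assume d: "1 \<le> d" and \<mu>: "(\<forall>i. discrete_measure_on (R_pow d) (\<mu> i)) \<and> (\<forall>i\<in>J - {i}. dmeasure (\<mu> i) UNIV = 0)"
  define c where "c l = (if l = 0 then 1 else -1 :: real)" for l :: nat
  define \<alpha> where "\<alpha> l = (if l = 0 then 0 else sqrt h)" for l :: nat
  have \<mu>d: "discrete_measure_on (R_pow d) (\<mu> j)" for j using \<mu> by blast
  let ?\<nu> = "\<mu>(i := mixture d 2 c \<alpha> (\<mu> i))"
  have "0 \<le> pair_energy (d + 2) f ?\<nu>"
  proof -
    have dm: "discrete_measure_on (R_pow (d + 2)) (?\<nu> j)" for j
    proof (cases "j = i")
      case False
      have "R_pow d \<subseteq> R_pow (d + 2)" by (auto simp: topspace_Euclidean_space)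
      from discrete_measure_on_mono[OF \<mu>d this] show ?thesis using False by simp
    next
      case True
      from mixture_discrete[OF \<mu>d, of 2 c \<alpha> i] show ?thesis using True by simp
    qed
    have mass: "dmeasure (?\<nu> j) UNIV = 0" if "j \<in> J" for j
    proof (cases "j = i")
      case True
      have "(\<Sum>l<2. c l) = 0" by (simp add: c_def numeral_2_eq_2)
      then show ?thesis using True by (simp add: dmeasure_mixture[OF \<mu>d])
    qed (use \<mu> that in simp)
    have "1 \<le> d + 2" by simp
    from f[unfolded PD_products_def, rule_format, OF this] show ?thesis using dm mass by blast
  qed
  also have "pair_energy (d + 2) f ?\<nu> = (\<Sum>m<2. \<Sum>l<2. c m * c l *
      pair_energy d (\<lambda>t. f (t + (if l = m then 0 else (\<alpha> l)\<^sup>2 + (\<alpha> m)\<^sup>2) *\<^sub>R axis i 1)) \<mu>)"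
    by (rule pair_energy_mixture[OF \<mu>d])
  also have "\<dots> = 2 * pair_energy d (\<lambda>t. 1 * f t + (-1) * f (t + h *\<^sub>R axis i 1)) \<mu>"
    unfolding pair_energy_linear using h by (simp add: numeral_2_eq_2 c_def \<alpha>_def)
  finally show "0 \<le> pair_energy d (dec i h f) \<mu>" by (simp add: dec_def[abs_def])
qed

text \<open>The uniform mixture of \<open>N\<close> translates at mutual distance \<open>\<surd>t\<close> shifts the argument by \<open>t\<close>,
  up to an error of order \<open>1/N\<close> from the diagonal.\<close>

lemma PD_products_shift:
  fixes f :: "real^'n::finite \<Rightarrow> real"
  assumes f: "PD_products J f" and t: "0 \<le> t"
  shows "PD_products J (\<lambda>x. f (x + t *\<^sub>R axis i 1))"
  unfolding PD_products_def
proof (intro allI impI)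
  fix d :: nat and \<mu> :: "'n \<Rightarrow> (nat \<Rightarrow> real) \<Rightarrow> real"
  assume d: "1 \<le> d" and \<mu>: "(\<forall>i. discrete_measure_on (R_pow d) (\<mu> i)) \<and> (\<forall>i\<in>J. dmeasure (\<mu> i) UNIV = 0)"
  have \<mu>d: "discrete_measure_on (R_pow d) (\<mu> j)" for j using \<mu> by blast
  let ?A = "pair_energy d f \<mu>" and ?B = "pair_energy d (\<lambda>x. f (x + t *\<^sub>R axis i 1)) \<mu>"
  have "0 \<le> ?B + (1 / real (Suc N)) * (?A - ?B)" for N
  proof -
    define K where "K = Suc N"
    have K: "real K \<noteq> 0" by (simp add: K_def)
    define c where "c l = 1 / real K" for l :: nat
    define \<alpha> where "\<alpha> l = sqrt (t / 2)" for l :: nat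
    let ?\<nu> = "\<mu>(i := mixture d K c \<alpha> (\<mu> i))"
    have "0 \<le> pair_energy (d + K) f ?\<nu>"
    proof -
      have dm: "discrete_measure_on (R_pow (d + K)) (?\<nu> j)" for j
      proof (cases "j = i")
        case False
        have "R_pow d \<subseteq> R_pow (d + K)" by (auto simp: topspace_Euclidean_space)
        from discrete_measure_on_mono[OF \<mu>d this] show ?thesis using False by simp
      qed (simp add: mixture_discrete[OF \<mu>d])
      have mass: "dmeasure (?\<nu> j) UNIV = 0" if "j \<in> J" for j
        using \<mu> that by (cases "j = i") (simp_all add: dmeasure_mixture[OF \<mu>d])
      have "1 \<le> d + K" using d by simp
      from f[unfolded PD_products_def, rule_format, OF this] show ?thesis using dm mass by blast
    qed
    also have "pair_energy (d + K) f ?\<nu> = (\<Sum>m<K. \<Sum>l<K. c m * c l *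
        pair_energy d (\<lambda>t. f (t + (if l = m then 0 else (\<alpha> l)\<^sup>2 + (\<alpha> m)\<^sup>2) *\<^sub>R axis i 1)) \<mu>)"
      by (rule pair_energy_mixture[OF \<mu>d])
    also have "\<dots> = (\<Sum>m<K. \<Sum>l<K. c m * c l * (if l = m then ?A else ?B))"
    proof (rule sum.cong[OF refl], rule sum.cong[OF refl])
      fix m l
      show "c m * c l * pair_energy d (\<lambda>t. f (t + (if l = m then 0 else (\<alpha> l)\<^sup>2 + (\<alpha> m)\<^sup>2) *\<^sub>R axis i 1)) \<mu>
          = c m * c l * (if l = m then ?A else ?B)"
        using t by (simp add: \<alpha>_def)
    qed
    also have "\<dots> = (\<Sum>m<K. \<Sum>l<K. (1 / real K)\<^sup>2 * (?B + (if l = m then ?A - ?B else 0)))"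
      by (intro sum.cong refl) (simp add: c_def power2_eq_square)
    also have "\<dots> = (\<Sum>m<K. (1 / real K)\<^sup>2 * (real K * ?B + (?A - ?B)))"
      by (intro sum.cong refl) (simp add: sum_distrib_left[symmetric] sum.distrib)
    also have "\<dots> = real K * ((1 / real K)\<^sup>2 * (real K * ?B + (?A - ?B)))" by simp
    also have "\<dots> = ?B + (1 / real K) * (?A - ?B)"
      using K by (simp add: power2_eq_square field_simps)
    finally show ?thesis by (simp only: K_def)
  qed
  moreover have "(\<lambda>N. ?B + (1 / real (Suc N)) * (?A - ?B)) \<longlonglongrightarrow> ?B + 0 * (?A - ?B)"
  proof -
    have "(\<lambda>k. 1 / real (Suc k)) \<longlonglongrightarrow> 0"
      using LIMSEQ_inverse_real_of_nat by (simp add: inverse_eq_divide)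
    then show ?thesis by (rule tendsto_add[OF tendsto_const tendsto_mult[OF _ tendsto_const]])
  qed
  ultimately have "0 \<le> ?B + 0 * (?A - ?B)" by (intro LIMSEQ_le_const) blast+
  then show "0 \<le> ?B" by simp
qed

text \<open>After shifting every coordinate, the energy of point masses is the value of \<open>f\<close> at \<open>t\<close>.\<close>

lemma PD_products_nonneg:
  fixes f :: "real^'n::finite \<Rightarrow> real"
  assumes f: "PD_products {} f" and t: "t \<in> closed_orthant"
  shows "0 \<le> f t"
proof -
  have "PD_products {} (\<lambda>x. f (x + (\<Sum>i\<in>A. (t $ i) *\<^sub>R axis i 1)))" if "finite A" for A
    using that
  proof (induction A)
    case (insert i A)
    have "0 \<le> t $ i" using t by (simp add: closed_orthant_def)
    from PD_products_shift[OF insert.IH this, of i] show ?case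
      using insert.hyps by (simp add: add.assoc)
  qed (simp add: f)
  from this[OF finite_class.finite_UNIV]
  have PD: "PD_products {} (\<lambda>x. f (x + (\<Sum>i\<in>UNIV. (t $ i) *\<^sub>R axis i 1)))" .
  have t_eq: "(\<Sum>i\<in>UNIV. (t $ i) *\<^sub>R axis i 1) = t"
    by (simp add: vec_eq_iff axis_def if_distrib sum.delta cong: if_cong)
  have pm: "product_measure (\<lambda>_. point_mass) x = (if x = (\<lambda>_ _. 0) then 1 else 0)" for x :: "'n \<Rightarrow> nat \<Rightarrow> real"
  proof (cases "x = (\<lambda>_ _. 0)")
    case False
    then obtain i where "x i \<noteq> (\<lambda>_. 0)" by (auto simp: fun_eq_iff)
    then have "product_measure (\<lambda>_. point_mass) x = 0"
      unfolding product_measure_def by (intro prod_zero bexI[of _ i]) (auto simp: point_mass_def)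
    then show ?thesis using False by simp
  qed (simp add: product_measure_def point_mass_def)
  have "{x. product_measure (\<lambda>_. point_mass) x \<noteq> 0} = {\<lambda>(_ :: 'n) _. 0}" by (auto simp: pm)
  then have int: "dintegral (product_measure (\<lambda>_. point_mass)) \<phi> = \<phi> (\<lambda>_ _. 0)" for \<phi> :: "('n \<Rightarrow> nat \<Rightarrow> real) \<Rightarrow> real"
    by (simp add: dintegral_def pm)
  have "sqdists 1 (\<lambda>_ _. 0) (\<lambda>_ _. 0) = (0 :: real^'n)" by (simp add: vec_eq_iff sqdists_nth)
  then have "pair_energy 1 (\<lambda>x. f (x + t)) (\<lambda>_. point_mass) = f t"
    by (simp add: pair_energy_def int)
  moreover have "0 \<le> pair_energy 1 (\<lambda>x. f (x + t)) (\<lambda>_. point_mass)"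
    using PD[unfolded t_eq PD_products_def, rule_format, of 1 "\<lambda>_. point_mass"] point_mass_discrete by simp
  ultimately show ?thesis by simp
qed

lemma PD_products_decs:
  assumes "PD_products J f" "\<forall>(i, h)\<in>set L. 0 < h"
  shows "PD_products (J - fst ` set L) (decs L f)"
  using assms(2)
proof (induction L)
  case (Cons a L)
  obtain i h where a: "a = (i, h)" by (cases a)
  have "PD_products (J - fst ` set L - {i}) (dec i h (decs L f))"
    using Cons by (intro PD_products_dec) (auto simp: a)
  moreover have "J - fst ` set L - {i} = J - fst ` set (a # L)" by (auto simp: a)
  ultimately show ?case by (simp add: a decs_Cons)
qed (simp add: assms(1))

theorem alternating_if_product_energies:
  fixes g :: "real^'n::finite \<Rightarrow> real"
  assumes "\<And>d \<mu>. 1 \<le> d \<Longrightarrow> (\<And>i. discrete_measure_on (R_pow d) (\<mu> i)) \<Longrightarrow> (\<And>i. dmeasure (\<mu> i) UNIV = 0)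
     \<Longrightarrow> 0 \<le> energy d g (product_measure \<mu>)"
  shows "alternating_differences (\<lambda>t. (-1) ^ CARD('n) * g t)"
  unfolding alternating_differences_def
proof (intro allI impI ballI)
  fix L L' :: "('n \<times> real) list" and t :: "real^'n"
  assume L: "distinct (map fst L) \<and> set (map fst L) = UNIV \<and> (\<forall>(i, h)\<in>set (L @ L'). 0 < h)"
    and t: "t \<in> closed_orthant"
  have "PD_products UNIV (\<lambda>t. (-1) ^ CARD('n) * g t)"
    unfolding PD_products_def
  proof (intro allI impI)
    fix d :: nat and \<mu> :: "'n \<Rightarrow> (nat \<Rightarrow> real) \<Rightarrow> real"
    assume d: "1 \<le> d" and \<mu>: "(\<forall>i. discrete_measure_on (R_pow d) (\<mu> i)) \<and> (\<forall>i\<in>UNIV. dmeasure (\<mu> i) UNIV = 0)"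
    have "0 \<le> energy d g (product_measure \<mu>)" by (rule assms[OF d]) (use \<mu> in blast)+
    then show "0 \<le> pair_energy d (\<lambda>t. (-1) ^ CARD('n) * g t) \<mu>" by (simp only: energy_def pair_energy_def)
  qed
  then have "PD_products (UNIV - fst ` set (L @ L')) (decs (L @ L') (\<lambda>t. (-1) ^ CARD('n) * g t))"
    using L by (intro PD_products_decs) blast+
  moreover have "UNIV - fst ` set (L @ L') = {}"
  proof -
    have "UNIV = fst ` set L" using L by simp
    then show ?thesis by auto
  qed
  ultimately have "PD_products {} (decs (L @ L') (\<lambda>t. (-1) ^ CARD('n) * g t))" by (simp only:)
  then show "0 \<le> decs (L @ L') (\<lambda>t. (-1) ^ CARD('n) * g t) t" by (rule PD_products_nonneg[OF _ t])
qed

section \<open>Bernstein functions have alternating differences\<close>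

lemma partial_derivs_Nil [simp]: "partial_derivs [] f = f" by (simp add: partial_derivs_def)

lemma partial_derivs_Cons: "partial_derivs (i # is) f = partial_deriv i (partial_derivs is f)"
  by (simp add: partial_derivs_def)

lemma partial_derivs_append: "partial_derivs (is @ js) f = partial_derivs is (partial_derivs js f)"
  by (simp add: partial_derivs_def)

lemma open_orthant_shift:
  "x \<in> open_orthant \<Longrightarrow> 0 \<le> s \<Longrightarrow> x + s *\<^sub>R axis i 1 \<in> (open_orthant :: (real^'n::finite) set)"
  by (auto simp: open_orthant_def axis_def intro: add_pos_nonneg)

lemma open_orthant_nearby:
  fixes x :: "real^'n::finite"
  assumes "x \<in> open_orthant" "\<bar>s\<bar> < x $ i"
  shows "x + s *\<^sub>R axis i 1 \<in> open_orthant"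
proof -
  have "0 < (x + s *\<^sub>R axis i 1) $ j" for j
    using assms by (cases "j = i") (auto simp: open_orthant_def axis_def)
  then show ?thesis by (simp add: open_orthant_def)
qed

text \<open>A short segment in direction \<open>i\<close> around a point of the open orthant stays inside, so that values
  outside have no influence.\<close>

lemma partial_deriv_eqI:
  fixes x :: "real^'n::finite"
  assumes eq: "\<And>y. y \<in> open_orthant \<Longrightarrow> f y = F y" and x: "x \<in> open_orthant"
    and D: "((\<lambda>s. F (x + s *\<^sub>R axis i 1)) has_real_derivative D) (at 0)"
  shows "((\<lambda>s. f (x + s *\<^sub>R axis i 1)) has_real_derivative D) (at 0)" "partial_deriv i f x = D"
proof -
  have xi: "0 < x $ i" using x by (simp add: open_orthant_def)
  show 1: "((\<lambda>s. f (x + s *\<^sub>R axis i 1)) has_real_derivative D) (at 0)"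
  proof (rule has_field_derivative_transform_within[OF D xi])
    fix s :: real assume "dist s 0 < x $ i"
    then show "F (x + s *\<^sub>R axis i 1) = f (x + s *\<^sub>R axis i 1)"
      by (intro eq[symmetric] open_orthant_nearby x) simp
  qed simp
  then show "partial_deriv i f x = D" unfolding partial_deriv_def by (rule DERIV_imp_deriv)
qed

text \<open>The part of \<open>C_infinity_on\<close> that passes to differences by one application of the sum rule.\<close>

definition smooth :: "(real^'n::finite \<Rightarrow> real) \<Rightarrow> bool" where
  "smooth f \<longleftrightarrow> (\<forall>is. \<forall>x\<in>open_orthant. \<forall>i.
     ((\<lambda>s. partial_derivs is f (x + s *\<^sub>R axis i 1)) has_real_derivative partial_derivs (i # is) f x) (at 0))"

lemma smooth_if_C_infinity:
  assumes "C_infinity_on open_orthant f" shows "smooth f"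
  unfolding smooth_def
proof (intro allI ballI)
  fix "is" i and x :: "real^'a" assume x: "x \<in> open_orthant"
  have "(\<lambda>s::real. partial_derivs is f (x + s *\<^sub>R axis i 1)) differentiable (at 0)"
    using assms x by (simp add: C_infinity_on_def)
  then show "((\<lambda>s. partial_derivs is f (x + s *\<^sub>R axis i 1)) has_real_derivative partial_derivs (i # is) f x) (at 0)"
    unfolding partial_derivs_Cons partial_deriv_def
    by (simp add: DERIV_deriv_iff_real_differentiable)
qed

lemma smooth_dec:
  fixes f :: "real^'n::finite \<Rightarrow> real"
  assumes f: "smooth f" and h: "0 < h"
  shows "x \<in> open_orthant \<Longrightarrow> partial_derivs is (dec i h f) x = dec i h (partial_derivs is f) x"
    and "smooth (dec i h f)"
proof -
  have main: "((\<lambda>s. partial_derivs is (dec i h f) (x + s *\<^sub>R axis j 1)) has_real_derivative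
       dec i h (partial_derivs (j # is) f) x) (at 0) \<and> partial_derivs (j # is) (dec i h f) x = dec i h (partial_derivs (j # is) f) x"
    if eq: "\<And>y. y \<in> open_orthant \<Longrightarrow> partial_derivs is (dec i h f) y = dec i h (partial_derivs is f) y"
      and x: "x \<in> open_orthant" for "is" j x
  proof -
    have x': "x + h *\<^sub>R axis i 1 \<in> open_orthant" using x h by (intro open_orthant_shift) auto
    have "((\<lambda>s. partial_derivs is f (x + s *\<^sub>R axis j 1)) has_real_derivative partial_derivs (j # is) f x) (at 0)"
      "((\<lambda>s. partial_derivs is f ((x + h *\<^sub>R axis i 1) + s *\<^sub>R axis j 1)) has_real_derivative partial_derivs (j # is) f (x + h *\<^sub>R axis i 1)) (at 0)"
      using f x x' by (simp_all add: smooth_def)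
    from DERIV_diff[OF this]
    have "((\<lambda>s. dec i h (partial_derivs is f) (x + s *\<^sub>R axis j 1)) has_real_derivative dec i h (partial_derivs (j # is) f) x) (at 0)"
      unfolding dec_def by (simp only: ac_simps)
    from partial_deriv_eqI[OF eq x this] show ?thesis by (simp add: partial_derivs_Cons)
  qed
  have eq: "\<forall>x\<in>open_orthant. partial_derivs is (dec i h f) x = dec i h (partial_derivs is f) x" for "is"
  proof (induction "is")
    case (Cons j "is")
    then show ?case using main[of "is"] by blast
  qed simp
  then show "x \<in> open_orthant \<Longrightarrow> partial_derivs is (dec i h f) x = dec i h (partial_derivs is f) x" by blast
  show "smooth (dec i h f)"
    unfolding smooth_def using main eq by (metis (no_types, lifting))
qed

text \<open>By the mean value theorem a difference is a derivative at an intermediate point.  The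
  outermost derivative commutes with the differences taken before, so that it is consumed by the
  innermost difference, whence the reversal of the list.\<close>

lemma decs_nonneg_if_derivs:
  fixes f :: "real^'n::finite \<Rightarrow> real"
  assumes "smooth f" "\<forall>(i, h)\<in>set L. 0 < h"
    and "\<And>x. x \<in> open_orthant \<Longrightarrow> 0 \<le> (-1) ^ length L * partial_derivs (rev (map fst L)) f x"
    and "x \<in> open_orthant"
  shows "0 \<le> decs L f x"
  using assms
proof (induction L arbitrary: f x rule: rev_induct)
  case Nil
  then show ?case using Nil(3)[of x] by simp
next
  case (snoc a L)
  obtain i h where a: "a = (i, h)" by (cases a)
  have h: "0 < h" using snoc.prems(2) by (simp add: a)
  let ?F = "partial_derivs (rev (map fst L)) f"
  have D: "((\<lambda>s. ?F (y + s *\<^sub>R axis i 1)) has_real_derivative partial_derivs (i # rev (map fst L)) f y) (at 0)"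
    if "y \<in> open_orthant" for y
    using snoc.prems(1) that by (simp add: smooth_def)
  have "0 \<le> decs L (dec i h f) x"
  proof (rule snoc.IH)
    show "smooth (dec i h f)" by (rule smooth_dec(2)[OF snoc.prems(1) h])
    show "\<forall>(i, h)\<in>set L. 0 < h" using snoc.prems(2) by simp
    show "x \<in> open_orthant" by (rule snoc.prems(4))
    fix y :: "real^'n" assume y: "y \<in> open_orthant"
    let ?\<phi> = "\<lambda>s. ?F (y + s *\<^sub>R axis i 1)"
    have D': "(?\<phi> has_real_derivative partial_derivs (i # rev (map fst L)) f (y + s *\<^sub>R axis i 1)) (at s)"
      if "0 \<le> s" for s
    proof -
      have "((\<lambda>u. ?F ((y + s *\<^sub>R axis i 1) + u *\<^sub>R axis i 1)) has_real_derivative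
          partial_derivs (i # rev (map fst L)) f (y + s *\<^sub>R axis i 1)) (at 0)"
        by (rule D[OF open_orthant_shift[OF y that]])
      then have "((\<lambda>u. ?\<phi> (u + s)) has_real_derivative
          partial_derivs (i # rev (map fst L)) f (y + s *\<^sub>R axis i 1)) (at 0)"
        by (simp add: scaleR_left_distrib ac_simps)
      then show ?thesis using DERIV_shift[of ?\<phi> _ 0 s] by simp
    qed
    obtain \<xi> where \<xi>: "0 < \<xi>" "\<xi> < h"
      "?\<phi> h - ?\<phi> 0 = (h - 0) * partial_derivs (i # rev (map fst L)) f (y + \<xi> *\<^sub>R axis i 1)"
      using MVT2[OF h, of ?\<phi> "\<lambda>s. partial_derivs (i # rev (map fst L)) f (y + s *\<^sub>R axis i 1)"] D' by blast
    let ?z = "y + \<xi> *\<^sub>R axis i 1"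
    have z: "?z \<in> open_orthant" using \<xi>(1) by (intro open_orthant_shift[OF y]) simp
    have "partial_derivs (rev (map fst L)) (dec i h f) y = ?F y - ?F (y + h *\<^sub>R axis i 1)"
      using smooth_dec(1)[OF snoc.prems(1) h y] by (simp add: dec_def)
    also have "\<dots> = - h * partial_derivs (i # rev (map fst L)) f ?z" using \<xi>(3) by simp
    finally have "(-1) ^ length L * partial_derivs (rev (map fst L)) (dec i h f) y
        = h * ((-1) ^ length (L @ [a]) * partial_derivs (rev (map fst (L @ [a]))) f ?z)"
      by (simp add: a)
    also have "\<dots> \<ge> 0" by (rule mult_nonneg_nonneg[OF less_imp_le[OF h] snoc.prems(3)[OF z]])
    finally show "0 \<le> (-1) ^ length L * partial_derivs (rev (map fst L)) (dec i h f) y" .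
  qed
  then show ?case by (simp add: a decs_snoc)
qed

lemma continuous_on_decs:
  assumes "continuous_on closed_orthant f" "\<forall>(i, h)\<in>set L. 0 < h"
  shows "continuous_on closed_orthant (decs L f)"
  using assms(2)
proof (induction L)
  case (Cons a L)
  obtain i h where a: "a = (i, h)" by (cases a)
  have c: "continuous_on closed_orthant (decs L f)" using Cons by simp
  have "t + h *\<^sub>R axis i 1 \<in> closed_orthant" if "t \<in> closed_orthant" for t
    using that Cons.prems by (auto simp: a closed_orthant_def axis_def)
  then have "continuous_on closed_orthant (\<lambda>t. decs L f (t + h *\<^sub>R axis i 1))"
    by (intro continuous_on_compose2[OF c] continuous_intros) auto
  then show ?case unfolding a decs_Cons dec_def by (intro continuous_on_diff c)
qed (simp add: assms(1))

lemma nonneg_on_closed_orthant: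
  fixes f :: "real^'n::finite \<Rightarrow> real"
  assumes c: "continuous_on closed_orthant f" and pos: "\<And>x. x \<in> open_orthant \<Longrightarrow> 0 \<le> f x"
    and t: "t \<in> closed_orthant"
  shows "0 \<le> f t"
proof -
  define u where "u k = (\<chi> i. t $ i + 1 / real (Suc k))" for k
  have "u k $ i > 0" for k i
  proof -
    have "0 \<le> t $ i" using t by (simp add: closed_orthant_def)
    moreover have "0 < 1 / real (Suc k)" by simp
    ultimately show ?thesis unfolding u_def vec_lambda_beta by linarith
  qed
  then have u: "u k \<in> open_orthant" for k by (simp add: open_orthant_def)
  then have uc: "u k \<in> closed_orthant" for k by (auto simp: open_orthant_def closed_orthant_def less_imp_le)
  have "(\<lambda>k. 1 / real (Suc k)) \<longlonglongrightarrow> 0"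
    using LIMSEQ_inverse_real_of_nat by (simp add: inverse_eq_divide)
  from tendsto_add[OF tendsto_const this] have "(\<lambda>k. u k $ i) \<longlonglongrightarrow> t $ i" for i
    by (simp add: u_def)
  then have "u \<longlonglongrightarrow> t" by (rule vec_tendstoI)
  then have "(\<lambda>k. f (u k)) \<longlonglongrightarrow> f t"
    by (rule continuous_on_tendsto_compose[OF c _ t]) (rule always_eventually[OF allI], rule uc)
  then show ?thesis by (rule LIMSEQ_le_const) (use pos[OF u] in blast)
qed

theorem alternating_if_bernstein:
  fixes g :: "real^'n::finite \<Rightarrow> real"
  assumes cont: "continuous_on closed_orthant g" and B: "bernstein_order_n g"
  shows "alternating_differences (\<lambda>t. (-1) ^ CARD('n) * g t)"
  unfolding alternating_differences_def
proof (intro allI impI ballI)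
  fix L L' :: "('n \<times> real) list" and t :: "real^'n"
  assume LL: "distinct (map fst L) \<and> set (map fst L) = UNIV \<and> (\<forall>(i, h)\<in>set (L @ L'). 0 < h)"
    and t: "t \<in> closed_orthant"
  let ?s = "(-1 :: real) ^ CARD('n)"
  have pos: "\<forall>(i, h)\<in>set (L @ L'). 0 < h" using LL by blast
  have len: "length L = CARD('n)" using LL distinct_card[of "map fst L"] by simp
  have cm: "completely_monotone (partial_derivs (rev (map fst L)) g)"
    using B LL by (simp add: bernstein_order_n_def)
  have g: "smooth g" using B by (intro smooth_if_C_infinity) (simp add: bernstein_order_n_def)
  have derivs: "0 \<le> ?s * ((-1) ^ length (L @ L') * partial_derivs (rev (map fst (L @ L'))) g x)" if "x \<in> open_orthant" for x
  proof -
    have "0 \<le> (-1) ^ length (rev (map fst L')) * partial_derivs (rev (map fst L')) (partial_derivs (rev (map fst L)) g) x"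
      using cm that unfolding completely_monotone_def by blast
    moreover have "?s * (-1) ^ length L = 1" unfolding len by (simp add: power_mult_distrib[symmetric])
    ultimately show ?thesis by (simp add: partial_derivs_append power_add mult.assoc[symmetric])
  qed
  have sg: "smooth (\<lambda>t. ?s * g t) \<and> (\<forall>is. \<forall>x\<in>open_orthant. partial_derivs is (\<lambda>t. ?s * g t) x = ?s * partial_derivs is g x)"
  proof -
    have step: "((\<lambda>s. partial_derivs is (\<lambda>t. ?s * g t) (x + s *\<^sub>R axis j 1)) has_real_derivative ?s * partial_derivs (j # is) g x) (at 0)
        \<and> partial_derivs (j # is) (\<lambda>t. ?s * g t) x = ?s * partial_derivs (j # is) g x"
      if eq: "\<forall>x\<in>open_orthant. partial_derivs is (\<lambda>t. ?s * g t) x = ?s * partial_derivs is g x" and x: "x \<in> open_orthant" for "is" j x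
    proof -
      have "((\<lambda>s. ?s * partial_derivs is g (x + s *\<^sub>R axis j 1)) has_real_derivative ?s * partial_derivs (j # is) g x) (at 0)"
        using g x by (intro DERIV_cmult) (simp add: smooth_def)
      from partial_deriv_eqI[OF eq[rule_format] x this] show ?thesis by (simp add: partial_derivs_Cons)
    qed
    have eq: "\<forall>x\<in>open_orthant. partial_derivs is (\<lambda>t. ?s * g t) x = ?s * partial_derivs is g x" for "is"
    proof (induction "is")
      case (Cons j "is")
      then show ?case using step[of "is"] by blast
    qed simp
    then show ?thesis unfolding smooth_def using step by (metis (no_types, lifting))
  qed
  show "0 \<le> decs (L @ L') (\<lambda>t. ?s * g t) t"
  proof (rule nonneg_on_closed_orthant[OF _ _ t])
    show "continuous_on closed_orthant (decs (L @ L') (\<lambda>t. ?s * g t))"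
      by (intro continuous_on_decs pos continuous_on_mult continuous_on_const cont)
    fix x :: "real^'n" assume x: "x \<in> open_orthant"
    show "0 \<le> decs (L @ L') (\<lambda>t. ?s * g t) x"
    proof (rule decs_nonneg_if_derivs[OF conjunct1[OF sg] pos _ x])
      fix x :: "real^'n" assume x: "x \<in> open_orthant"
      have "partial_derivs (rev (map fst (L @ L'))) (\<lambda>t. ?s * g t) x = ?s * partial_derivs (rev (map fst (L @ L'))) g x"
        using sg x by blast
      then show "0 \<le> (-1) ^ length (L @ L') * partial_derivs (rev (map fst (L @ L'))) (\<lambda>t. ?s * g t) x"
        using derivs[OF x] by (simp only: mult.left_commute)
    qed
  qed
qed

section \<open>Differentiation of the integral representation\<close>

lemma has_derivative_integral_bounded:
  fixes f :: "'a \<Rightarrow> real \<Rightarrow> real"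
  assumes fin: "finite_measure M" and \<delta>: "0 < \<delta>"
    and int: "\<And>s. \<bar>s\<bar> < \<delta> \<Longrightarrow> integrable M (\<lambda>x. f x s)"
    and D: "\<And>x s. x \<in> space M \<Longrightarrow> \<bar>s\<bar> < \<delta> \<Longrightarrow> (f x has_real_derivative f' x s) (at s)"
    and B: "\<And>x s. x \<in> space M \<Longrightarrow> \<bar>s\<bar> < \<delta> \<Longrightarrow> \<bar>f' x s\<bar> \<le> B"
    and meas: "(\<lambda>x. f' x 0) \<in> borel_measurable M"
  shows "((\<lambda>s. \<integral>x. f x s \<partial>M) has_real_derivative (\<integral>x. f' x 0 \<partial>M)) (at 0)"
proof -
  interpret finite_measure M by fact
  have "((\<lambda>s. ((\<integral>x. f x s \<partial>M) - (\<integral>x. f x 0 \<partial>M)) / s) \<longlongrightarrow> (\<integral>x. f' x 0 \<partial>M)) (at 0)"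
    unfolding tendsto_at_iff_sequentially comp_def
  proof (intro allI impI)
    fix X :: "nat \<Rightarrow> real" assume X: "\<forall>k. X k \<in> UNIV - {0}" "X \<longlonglongrightarrow> 0"
    have "eventually (\<lambda>k. \<bar>X k\<bar> < \<delta>) sequentially"
      using tendstoD[OF X(2) \<delta>] by (simp add: dist_real_def)
    then obtain K where K: "\<And>k. k \<ge> K \<Longrightarrow> \<bar>X k\<bar> < \<delta>" unfolding eventually_sequentially by blast
    define Y where "Y k = X (k + K)" for k
    have Y: "\<bar>Y k\<bar> < \<delta>" "Y k \<noteq> 0" for k
      using K[of "k + K"] X(1)[rule_format, of "k + K"] unfolding Y_def by simp_all
    have Y0: "Y \<longlonglongrightarrow> 0" unfolding Y_def using X(2) by (rule LIMSEQ_ignore_initial_segment)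
    have "(\<lambda>k. \<integral>x. (f x (Y k) - f x 0) / Y k \<partial>M) \<longlonglongrightarrow> (\<integral>x. f' x 0 \<partial>M)"
    proof (rule integral_dominated_convergence[where w = "\<lambda>_. B"])
      show "(\<lambda>x. (f x (Y k) - f x 0) / Y k) \<in> borel_measurable M" for k
      proof -
        have "\<bar>0\<bar> < \<delta>" using \<delta> by simp
        then show ?thesis
          by (intro borel_measurable_divide borel_measurable_diff borel_measurable_const
              borel_measurable_integrable[OF int[OF Y(1)]] borel_measurable_integrable[OF int])
      qed
      show "AE x in M. (\<lambda>k. (f x (Y k) - f x 0) / Y k) \<longlonglongrightarrow> f' x 0"
      proof (rule AE_I2)
        fix x assume "x \<in> space M"
        then have "(f x has_real_derivative f' x 0) (at 0)" using D \<delta> by simp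
        then have "((\<lambda>s. (f x s - f x 0) / (s - 0)) \<longlongrightarrow> f' x 0) (at 0)"
          by (simp add: has_field_derivative_iff)
        then have "((\<lambda>s. (f x s - f x 0) / s) \<longlongrightarrow> f' x 0) (at 0)" by simp
        then show "(\<lambda>k. (f x (Y k) - f x 0) / Y k) \<longlonglongrightarrow> f' x 0"
          using Y(2) by (intro filterlim_compose[OF _ filterlim_atI[OF Y0]] always_eventually allI)
      qed
      show "AE x in M. norm ((f x (Y k) - f x 0) / Y k) \<le> B" for k
      proof (rule AE_I2)
        fix x assume x: "x \<in> space M"
        have "norm (f x (Y k) - f x 0) \<le> B * norm (Y k - 0)"
        proof (rule field_differentiable_bound[where S = "{-\<delta><..<\<delta>}"])
          show "(f x has_field_derivative f' x s) (at s within {-\<delta><..<\<delta>})" if "s \<in> {-\<delta><..<\<delta>}" for s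
            using that by (intro has_field_derivative_at_within[OF D[OF x]]) auto
          show "norm (f' x s) \<le> B" if "s \<in> {-\<delta><..<\<delta>}" for s
            using that B[OF x, of s] by auto
        qed (use Y(1)[of k] \<delta> in auto)
        then show "norm ((f x (Y k) - f x 0) / Y k) \<le> B"
          using Y(2)[of k] by (simp add: divide_le_eq)
      qed
    qed (use meas in auto)
    moreover have "(\<integral>x. (f x (Y k) - f x 0) / Y k \<partial>M) = ((\<integral>x. f x (Y k) \<partial>M) - (\<integral>x. f x 0 \<partial>M)) / Y k" for k
    proof -
      have i: "integrable M (\<lambda>x. f x (Y k))" "integrable M (\<lambda>x. f x 0)"
        using int[OF Y(1), of k] int[of 0] \<delta> by simp_all
      show ?thesis by (simp only: integral_divide_zero Bochner_Integration.integral_diff[OF i])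
    qed
    ultimately have "(\<lambda>k. ((\<integral>x. f x (Y k) \<partial>M) - (\<integral>x. f x 0 \<partial>M)) / Y k) \<longlonglongrightarrow> (\<integral>x. f' x 0 \<partial>M)"
      by (simp only:)
    then show "(\<lambda>k. ((\<integral>x. f x (X k) \<partial>M) - (\<integral>x. f x 0 \<partial>M)) / X k) \<longlonglongrightarrow> (\<integral>x. f' x 0 \<partial>M)"
      unfolding Y_def by (rule LIMSEQ_offset)
  qed
  then show ?thesis by (simp add: has_field_derivative_iff)
qed

text \<open>The \<open>k\<close>-th derivative in \<open>t\<close> of the factor of the kernel.\<close>

definition factor_deriv :: "nat \<Rightarrow> real \<Rightarrow> real \<Rightarrow> real" where
  "factor_deriv k r t = (if k = 0 then bernstein_factor r t else (1 + r) * (- r) ^ (k - 1) * exp (- r * t))"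

lemma factor_deriv_has_derivative:
  "((\<lambda>t. factor_deriv k r t) has_real_derivative factor_deriv (Suc k) r t) (at t)"
proof (cases k)
  case 0
  show ?thesis
  proof (cases "r = 0")
    case True
    then show ?thesis using 0 by (simp add: factor_deriv_def bernstein_factor_def)
  next
    case False
    have "((\<lambda>t. (1 - exp (- r * t)) * ((1 + r) / r)) has_real_derivative (1 + r) * exp (- r * t)) (at t)"
      using False by (auto intro!: derivative_eq_intros)
    then show ?thesis using 0 False by (simp add: factor_deriv_def bernstein_factor_def)
  qed
next
  case (Suc j)
  have "((\<lambda>t. (1 + r) * (- r) ^ j * exp (- r * t)) has_real_derivative (1 + r) * (- r) ^ Suc j * exp (- r * t)) (at t)"
    by (auto intro!: derivative_eq_intros)
  then show ?thesis using Suc by (simp add: factor_deriv_def)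
qed

text \<open>For \<open>t \<ge> a\<close> the growth of \<open>r\<^sup>j\<close> is compensated by \<open>e\<^bsup>-ra\<^esup> \<le> j! / (ra)\<^sup>j\<close>, which makes all derivatives bounded
  in \<open>r\<close>, locally uniformly in \<open>t\<close>.\<close>

definition factor_bound :: "nat \<Rightarrow> real \<Rightarrow> real \<Rightarrow> real" where
  "factor_bound k a b = 1 + b + fact (k - 1) / a ^ (k - 1) + fact k / a ^ k"

lemma power_exp_le:
  fixes r a :: real assumes "0 \<le> r" "0 < a" shows "r ^ j * exp (- r * a) \<le> fact j / a ^ j"
proof -
  have "(r * a) ^ j / fact j \<le> exp (r * a)"
  proof -
    have "(r * a) ^ j / fact j = (\<Sum>k\<in>{j}. (r * a) ^ k /\<^sub>R fact k)" by (simp add: divide_inverse mult.commute)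
    also have "\<dots> \<le> (\<Sum>k. (r * a) ^ k /\<^sub>R fact k)"
      using assms by (intro sum_le_suminf summable_exp_generic) auto
    finally show ?thesis by (simp add: exp_def)
  qed
  then have "r ^ j * a ^ j * exp (- (r * a)) \<le> fact j"
    by (simp add: exp_minus power_mult_distrib divide_le_eq field_simps)
  then show ?thesis using assms(2) by (simp add: le_divide_eq mult_ac)
qed

lemma factor_deriv_bound:
  assumes r: "0 \<le> r" and t: "0 < a" "a \<le> t" "t \<le> b"
  shows "\<bar>factor_deriv k r t\<bar> \<le> factor_bound k a b"
proof (cases k)
  case 0
  have "\<bar>factor_deriv k r t\<bar> \<le> 1 + t"
    using bernstein_factor_bounds[of r t] r t 0 by (simp add: factor_deriv_def)
  also have "\<dots> \<le> factor_bound k a b" using t by (simp add: factor_bound_def 0)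
  finally show ?thesis .
next
  case (Suc j)
  have "r * a \<le> r * t" using r t by (intro mult_left_mono)
  then have e: "exp (- r * t) \<le> exp (- r * a)" by simp
  have "\<bar>factor_deriv k r t\<bar> = (1 + r) * r ^ j * exp (- r * t)"
    using r by (simp add: factor_deriv_def Suc abs_mult power_abs)
  also have "\<dots> = (r ^ j + r ^ Suc j) * exp (- r * t)" by (simp add: algebra_simps)
  also have "\<dots> \<le> (r ^ j + r ^ Suc j) * exp (- r * a)" using r e by (intro mult_left_mono) auto
  also have "\<dots> = r ^ j * exp (- r * a) + r ^ Suc j * exp (- r * a)" by (rule distrib_right)
  also have "\<dots> \<le> fact j / a ^ j + fact (Suc j) / a ^ Suc j"
    by (intro add_mono power_exp_le r t)
  also have "\<dots> \<le> factor_bound k a b" using t by (simp add: factor_bound_def Suc)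
  finally show ?thesis .
qed

lemma factor_deriv_measurable: "(\<lambda>r. factor_deriv k r t) \<in> borel_measurable borel"
  unfolding factor_deriv_def bernstein_factor_def by measurable

definition derivative_kernel :: "('n::finite \<Rightarrow> nat) \<Rightarrow> real^'n \<Rightarrow> real^'n \<Rightarrow> real" where
  "derivative_kernel \<alpha> t r = (\<Prod>i\<in>UNIV. factor_deriv (\<alpha> i) (r $ i) (t $ i))"

lemma derivative_kernel_measurable: "derivative_kernel \<alpha> t \<in> borel_measurable borel"
  unfolding derivative_kernel_def
  by (intro borel_measurable_prod measurable_compose[OF _ factor_deriv_measurable]) measurable

lemma derivative_kernel_bound:
  assumes "r \<in> closed_orthant" "\<And>i. 0 < a i" "\<And>i. a i \<le> t $ i" "\<And>i. t $ i \<le> b i"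
  shows "\<bar>derivative_kernel \<alpha> t r\<bar> \<le> (\<Prod>i\<in>UNIV. factor_bound (\<alpha> i) (a i) (b i))"
  unfolding derivative_kernel_def abs_prod
proof (rule prod_mono)
  fix i
  have "0 \<le> r $ i" using assms(1) by (simp add: closed_orthant_def)
  then have "\<bar>factor_deriv (\<alpha> i) (r $ i) (t $ i)\<bar> \<le> factor_bound (\<alpha> i) (a i) (b i)"
    by (intro factor_deriv_bound assms)
  then show "0 \<le> \<bar>factor_deriv (\<alpha> i) (r $ i) (t $ i)\<bar> \<and> \<bar>factor_deriv (\<alpha> i) (r $ i) (t $ i)\<bar> \<le> factor_bound (\<alpha> i) (a i) (b i)"
    by simp
qed

lemma derivative_kernel_integrable:
  fixes \<eta> :: "(real^'n::finite) measure"
  assumes rep: "represents \<eta> g" and t: "t \<in> open_orthant"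
  shows "integrable \<eta> (derivative_kernel \<alpha> t)"
proof (rule finite_measure.integrable_const_bound[of _ _ "\<Prod>i\<in>UNIV. factor_bound (\<alpha> i) (t $ i) (t $ i)"])
  show "finite_measure \<eta>" using rep by (simp add: represents_def)
  show "derivative_kernel \<alpha> t \<in> borel_measurable \<eta>"
    by (rule represents_measurable[OF rep derivative_kernel_measurable])
  show "AE r in \<eta>. norm (derivative_kernel \<alpha> t r) \<le> (\<Prod>i\<in>UNIV. factor_bound (\<alpha> i) (t $ i) (t $ i))"
  proof (rule AE_I2)
    fix r assume "r \<in> space \<eta>"
    then have "r \<in> closed_orthant" using represents_space[OF rep] by simp
    then show "norm (derivative_kernel \<alpha> t r) \<le> (\<Prod>i\<in>UNIV. factor_bound (\<alpha> i) (t $ i) (t $ i))"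
      unfolding real_norm_def using t by (intro derivative_kernel_bound) (auto simp: open_orthant_def)
  qed
qed

lemma derivative_kernel_has_derivative:
  "((\<lambda>s. derivative_kernel \<alpha> (t + s *\<^sub>R axis i 1) r) has_real_derivative
     derivative_kernel (\<alpha>(i := Suc (\<alpha> i))) (t + s *\<^sub>R axis i 1) r) (at s)"
proof -
  let ?R = "\<Prod>j\<in>UNIV-{i}. factor_deriv (\<alpha> j) (r $ j) (t $ j)"
  have split: "derivative_kernel \<beta> (t + s *\<^sub>R axis i 1) r = factor_deriv (\<beta> i) (r $ i) (t $ i + s) * ?R"
    if "\<And>j. j \<noteq> i \<Longrightarrow> \<beta> j = \<alpha> j" for \<beta> s
  proof -
    have "(\<Prod>j\<in>UNIV-{i}. factor_deriv (\<beta> j) (r $ j) ((t + s *\<^sub>R axis i 1) $ j)) = ?R"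
      using that by (intro prod.cong refl) (simp add: axis_def)
    then show ?thesis
      unfolding derivative_kernel_def
      by (subst prod.remove[OF finite_class.finite_UNIV UNIV_I, of _ i]) (simp add: axis_def)
  qed
  have "((\<lambda>s. factor_deriv (\<alpha> i) (r $ i) (t $ i + s)) has_real_derivative factor_deriv (Suc (\<alpha> i)) (r $ i) (t $ i + s)) (at s)"
    using factor_deriv_has_derivative[of "\<alpha> i" "r $ i" "s + t $ i"]
    unfolding add.commute[of "t $ i"] DERIV_shift[symmetric] .
  then have "((\<lambda>s. factor_deriv (\<alpha> i) (r $ i) (t $ i + s) * ?R) has_real_derivative
      factor_deriv (Suc (\<alpha> i)) (r $ i) (t $ i + s) * ?R) (at s)"
    by (rule DERIV_cmult_right)
  then show ?thesis by (simp add: split)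
qed

lemma integral_kernel_has_derivative:
  fixes \<eta> :: "(real^'n::finite) measure"
  assumes rep: "represents \<eta> g" and t: "t \<in> open_orthant"
  shows "((\<lambda>s. \<integral>r. derivative_kernel \<alpha> (t + s *\<^sub>R axis i 1) r \<partial>\<eta>) has_real_derivative
     (\<integral>r. derivative_kernel (\<alpha>(i := Suc (\<alpha> i))) t r \<partial>\<eta>)) (at 0)"
proof -
  let ?a = "\<lambda>j. t $ j / 2" and ?b = "\<lambda>j. 2 * t $ j"
  let ?\<alpha> = "\<alpha>(i := Suc (\<alpha> i))"
  have tpos: "0 < t $ j" for j using t by (simp add: open_orthant_def)
  have near: "?a j \<le> (t + s *\<^sub>R axis i 1) $ j" "(t + s *\<^sub>R axis i 1) $ j \<le> ?b j" if "\<bar>s\<bar> < t $ i / 2" for s j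
    using that tpos[of j] by (cases "j = i"; simp add: axis_def)+
  have "((\<lambda>s. \<integral>r. derivative_kernel \<alpha> (t + s *\<^sub>R axis i 1) r \<partial>\<eta>) has_real_derivative
     (\<integral>r. derivative_kernel ?\<alpha> (t + 0 *\<^sub>R axis i 1) r \<partial>\<eta>)) (at 0)"
  proof (rule has_derivative_integral_bounded[where \<delta> = "t $ i / 2"
        and B = "\<Prod>j\<in>UNIV. factor_bound (?\<alpha> j) (?a j) (?b j)"])
    show "finite_measure \<eta>" using rep by (simp add: represents_def)
    show "0 < t $ i / 2" using tpos by simp
    show "integrable \<eta> (derivative_kernel \<alpha> (t + s *\<^sub>R axis i 1))" if "\<bar>s\<bar> < t $ i / 2" for s
    proof (rule derivative_kernel_integrable[OF rep])
      show "t + s *\<^sub>R axis i 1 \<in> open_orthant" using that tpos[of i] by (intro open_orthant_nearby t) linarith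
    qed
    show "((\<lambda>s. derivative_kernel \<alpha> (t + s *\<^sub>R axis i 1) r) has_real_derivative derivative_kernel ?\<alpha> (t + s *\<^sub>R axis i 1) r) (at s)" for r s
      by (rule derivative_kernel_has_derivative)
    show "\<bar>derivative_kernel ?\<alpha> (t + s *\<^sub>R axis i 1) r\<bar> \<le> (\<Prod>j\<in>UNIV. factor_bound (?\<alpha> j) (?a j) (?b j))"
      if "r \<in> space \<eta>" "\<bar>s\<bar> < t $ i / 2" for r s
    proof (rule derivative_kernel_bound)
      show "r \<in> closed_orthant" using that(1) represents_space[OF rep] by simp
      show "0 < ?a j" for j using tpos by simp
    qed (rule near[OF that(2)])+
    show "derivative_kernel ?\<alpha> (t + 0 *\<^sub>R axis i 1) \<in> borel_measurable \<eta>"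
      by (rule represents_measurable[OF rep derivative_kernel_measurable])
  qed
  then show ?thesis by simp
qed

lemma integral_kernel_continuous:
  fixes \<eta> :: "(real^'n::finite) measure"
  assumes rep: "represents \<eta> g"
  shows "continuous_on open_orthant (\<lambda>t. \<integral>r. derivative_kernel \<alpha> t r \<partial>\<eta>)"
  unfolding continuous_on_sequentially comp_def
proof (intro allI ballI impI)
  fix X and t :: "real^'n" assume t: "t \<in> open_orthant" and X: "(\<forall>k. X k \<in> open_orthant) \<and> X \<longlonglongrightarrow> t"
  have fin: "finite_measure \<eta>" using rep by (simp add: represents_def)
  interpret finite_measure \<eta> by fact
  let ?a = "\<lambda>j. t $ j / 2" and ?b = "\<lambda>j. 2 * t $ j"
  have tpos: "0 < t $ j" for j using t by (simp add: open_orthant_def)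
  have comp: "(\<lambda>k. X k $ j) \<longlonglongrightarrow> t $ j" for j using X by (intro tendsto_vec_nth) simp
  have "eventually (\<lambda>k. \<forall>j. ?a j < X k $ j \<and> X k $ j < ?b j) sequentially"
  proof (intro eventually_all_finite eventually_conj)
    show "eventually (\<lambda>k. ?a j < X k $ j) sequentially" for j
      using tpos[of j] by (intro order_tendstoD(1)[OF comp]) simp
    show "eventually (\<lambda>k. X k $ j < ?b j) sequentially" for j
      using tpos[of j] by (intro order_tendstoD(2)[OF comp]) simp
  qed
  then obtain K where K: "\<And>k j. k \<ge> K \<Longrightarrow> ?a j < X k $ j \<and> X k $ j < ?b j"
    unfolding eventually_sequentially by blast
  have "(\<lambda>k. \<integral>r. derivative_kernel \<alpha> (X (k + K)) r \<partial>\<eta>) \<longlonglongrightarrow> (\<integral>r. derivative_kernel \<alpha> t r \<partial>\<eta>)"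
  proof (rule integral_dominated_convergence[where w = "\<lambda>_. \<Prod>j\<in>UNIV. factor_bound (\<alpha> j) (?a j) (?b j)"])
    show "derivative_kernel \<alpha> t \<in> borel_measurable \<eta>"
      by (rule represents_measurable[OF rep derivative_kernel_measurable])
    show "derivative_kernel \<alpha> (X (k + K)) \<in> borel_measurable \<eta>" for k
      by (rule represents_measurable[OF rep derivative_kernel_measurable])
    show "AE r in \<eta>. norm (derivative_kernel \<alpha> (X (k + K)) r) \<le> (\<Prod>j\<in>UNIV. factor_bound (\<alpha> j) (?a j) (?b j))" for k
    proof (rule AE_I2)
      fix r assume "r \<in> space \<eta>"
      then have r: "r \<in> closed_orthant" using represents_space[OF rep] by simp
      have kj: "?a j \<le> X (k + K) $ j" "X (k + K) $ j \<le> ?b j" for j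
        using K[of "k + K" j] by auto
      show "norm (derivative_kernel \<alpha> (X (k + K)) r) \<le> (\<Prod>j\<in>UNIV. factor_bound (\<alpha> j) (?a j) (?b j))"
        unfolding real_norm_def by (rule derivative_kernel_bound[OF r _ kj]) (use tpos in simp)
    qed
    show "AE r in \<eta>. (\<lambda>k. derivative_kernel \<alpha> (X (k + K)) r) \<longlonglongrightarrow> derivative_kernel \<alpha> t r"
    proof (rule AE_I2)
      fix r
      have "(\<lambda>k. factor_deriv (\<alpha> j) (r $ j) (X (k + K) $ j)) \<longlonglongrightarrow> factor_deriv (\<alpha> j) (r $ j) (t $ j)" for j
      proof (rule isCont_tendsto_compose[where g = "factor_deriv (\<alpha> j) (r $ j)"])
        show "isCont (factor_deriv (\<alpha> j) (r $ j)) (t $ j)"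
          by (rule DERIV_isCont[OF factor_deriv_has_derivative])
        show "(\<lambda>k. X (k + K) $ j) \<longlonglongrightarrow> t $ j" by (rule LIMSEQ_ignore_initial_segment[OF comp])
      qed
      then show "(\<lambda>k. derivative_kernel \<alpha> (X (k + K)) r) \<longlonglongrightarrow> derivative_kernel \<alpha> t r"
        unfolding derivative_kernel_def by (intro tendsto_prod)
    qed
  qed simp
  then show "(\<lambda>k. \<integral>r. derivative_kernel \<alpha> (X k) r \<partial>\<eta>) \<longlonglongrightarrow> (\<integral>r. derivative_kernel \<alpha> t r \<partial>\<eta>)"
    by (rule LIMSEQ_offset)
qed

lemma partial_derivs_represented:
  fixes g :: "real^'n::finite \<Rightarrow> real"
  assumes rep: "represents \<eta> g" and "t \<in> open_orthant"
  shows "partial_derivs ks g t = (\<integral>r. derivative_kernel (count_list ks) t r \<partial>\<eta>)"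
  using assms(2)
proof (induction ks arbitrary: t)
  case Nil
  then have "t \<in> closed_orthant" by (auto simp: open_orthant_def closed_orthant_def less_imp_le)
  then show ?case using rep by (simp add: represents_def derivative_kernel_def factor_deriv_def)
next
  case (Cons i ks)
  have eq: "count_list (i # ks) = (count_list ks)(i := Suc (count_list ks i))" by (rule ext) simp
  have "partial_deriv i (partial_derivs ks g) t = (\<integral>r. derivative_kernel (count_list (i # ks)) t r \<partial>\<eta>)"
    unfolding eq
    by (rule partial_deriv_eqI(2)[OF Cons.IH Cons.prems integral_kernel_has_derivative[OF rep Cons.prems]])
  then show ?case by (simp only: partial_derivs_Cons)
qed

lemma C_infinity_represented:
  fixes g :: "real^'n::finite \<Rightarrow> real"
  assumes rep: "represents \<eta> g"
  shows "C_infinity_on open_orthant (partial_derivs js g)"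
  unfolding C_infinity_on_def partial_derivs_append[symmetric]
proof (intro allI conjI ballI)
  fix "is"
  have "continuous_on open_orthant (\<lambda>t. \<integral>r. derivative_kernel (count_list (is @ js)) t r \<partial>\<eta>)"
    by (rule integral_kernel_continuous[OF rep])
  then show "continuous_on open_orthant (partial_derivs (is @ js) g)"
    by (rule continuous_on_eq) (rule partial_derivs_represented[OF rep, symmetric])
  fix x :: "real^'n" and i assume x: "x \<in> open_orthant"
  have "((\<lambda>s. partial_derivs (is @ js) g (x + s *\<^sub>R axis i 1)) has_real_derivative
     (\<integral>r. derivative_kernel ((count_list (is @ js))(i := Suc (count_list (is @ js) i))) x r \<partial>\<eta>)) (at 0)"
    by (rule partial_deriv_eqI(1)[where F = "\<lambda>t. \<integral>r. derivative_kernel (count_list (is @ js)) t r \<partial>\<eta>",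
          OF partial_derivs_represented[OF rep] x integral_kernel_has_derivative[OF rep x]])
  then show "(\<lambda>s. partial_derivs (is @ js) g (x + s *\<^sub>R axis i 1)) differentiable (at 0)"
    unfolding real_differentiable_def by (rule exI)
qed

lemma count_list_distinct: "distinct xs \<Longrightarrow> x \<in> set xs \<Longrightarrow> count_list xs x = 1"
  by (induction xs) auto

lemma prod_count_list_sign:
  fixes js :: "'n::finite list"
  shows "(\<Prod>i\<in>UNIV. (-1 :: real) ^ count_list js i) = (-1) ^ length js"
proof (induction js)
  case (Cons j js)
  have eq: "(-1 :: real) ^ count_list (j # js) i = (if i = j then -1 else 1) * (-1) ^ count_list js i" for i
    by auto
  show ?case unfolding eq prod.distrib Cons.IH by (simp add: prod.delta)
qed simp

text \<open>Once every coordinate has been differentiated, each factor of the kernel is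
  \<open>(1 + r) (-r)\<^sup>j e\<^bsup>-rt\<^esup>\<close>, whose sign is the one that complete monotonicity asks for.\<close>

theorem bernstein_if_represents:
  fixes g :: "real^'n::finite \<Rightarrow> real"
  assumes rep: "represents \<eta> g" shows "bernstein_order_n g"
  unfolding bernstein_order_n_def completely_monotone_def
proof (intro conjI allI impI ballI)
  show "C_infinity_on open_orthant g" using C_infinity_represented[OF rep, of "[]"] by simp
  fix "is" :: "'n list" assume "is": "distinct is \<and> set is = UNIV"
  show "C_infinity_on open_orthant (partial_derivs is g)" by (rule C_infinity_represented[OF rep])
  fix js and x :: "real^'n" assume x: "x \<in> open_orthant"
  have cnt: "count_list (js @ is) i = Suc (count_list js i)" for i
    using "is" by (simp add: count_list_distinct)
  have "(-1) ^ length js * partial_derivs js (partial_derivs is g) x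
      = (\<integral>r. (-1) ^ length js * derivative_kernel (count_list (js @ is)) x r \<partial>\<eta>)"
    using partial_derivs_represented[OF rep x, of "js @ is"]
    by (simp add: partial_derivs_append)
  also have "\<dots> \<ge> 0"
  proof (rule integral_nonneg_AE, rule AE_I2)
    fix r assume "r \<in> space \<eta>"
    then have r: "0 \<le> r $ i" for i using represents_space[OF rep] by (simp add: closed_orthant_def)
    have "(-1) ^ length js * derivative_kernel (count_list (js @ is)) x r
      = (\<Prod>i\<in>UNIV. (-1) ^ count_list js i * factor_deriv (Suc (count_list js i)) (r $ i) (x $ i))"
      unfolding derivative_kernel_def cnt prod.distrib prod_count_list_sign ..
    also have "\<dots> = (\<Prod>i\<in>UNIV. (1 + r $ i) * (r $ i) ^ count_list js i * exp (- (r $ i) * x $ i))"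
    proof (rule prod.cong[OF refl])
      fix i
      have "(-1) ^ count_list js i * (- (r $ i)) ^ count_list js i = (r $ i) ^ count_list js i"
        by (simp add: power_mult_distrib[symmetric])
      then show "(-1) ^ count_list js i * factor_deriv (Suc (count_list js i)) (r $ i) (x $ i)
          = (1 + r $ i) * (r $ i) ^ count_list js i * exp (- (r $ i) * x $ i)"
        by (simp add: factor_deriv_def mult_ac)
    qed
    also have "\<dots> \<ge> 0" using r by (intro prod_nonneg mult_nonneg_nonneg zero_le_power) (auto intro: add_nonneg_nonneg)
    finally show "0 \<le> (-1) ^ length js * derivative_kernel (count_list (js @ is)) x r" .
  qed
  finally show "0 \<le> (-1) ^ length js * partial_derivs js (partial_derivs is g) x" .
qed

section \<open>A space-filling curve\<close>

lemma binary_expansion: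
  fixes s :: real
  assumes "0 \<le> s" "s \<le> 1"
  obtains b :: "nat \<Rightarrow> real" where "\<And>k. b k \<in> {0, 1}" "(\<lambda>k. b k / 2 ^ Suc k) sums s"
proof -
  define r where "r = rec_nat s (\<lambda>_ y. if y \<ge> 1/2 then 2 * y - 1 else 2 * y)"
  have r0: "r 0 = s" and rSuc: "r (Suc k) = (if r k \<ge> 1/2 then 2 * r k - 1 else 2 * r k)" for k
    by (simp_all add: r_def)
  define b where "b k = (if r k \<ge> 1/2 then 1 else 0 :: real)" for k
  have rb: "r (Suc k) = 2 * r k - b k" for k by (simp add: rSuc b_def)
  have r01: "0 \<le> r k \<and> r k \<le> 1" for k
    by (induction k) (use assms in \<open>auto simp: r0 rSuc\<close>)
  have part: "(\<Sum>k<K. b k / 2 ^ Suc k) = s - r K / 2 ^ K" for K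
    by (induction K) (simp_all add: r0 rb field_simps)
  have "(\<lambda>K. r K / 2 ^ K) \<longlonglongrightarrow> 0"
  proof (rule tendsto_sandwich[of "\<lambda>_. 0" _ _ "\<lambda>K. (1/2) ^ K"])
    show "\<forall>\<^sub>F K in sequentially. r K / 2 ^ K \<le> (1/2) ^ K"
      using r01 by (auto simp: field_simps)
  qed (use r01 in \<open>auto intro!: LIMSEQ_realpow_zero\<close>)
  then have "(\<lambda>K. s - r K / 2 ^ K) \<longlonglongrightarrow> s - 0" by (intro tendsto_intros)
  then have "(\<lambda>k. b k / 2 ^ Suc k) sums s" unfolding sums_def part by simp
  moreover have "b k \<in> {0, 1}" for k by (simp add: b_def)
  ultimately show ?thesis using that by blast
qed

lemma ternary_twos_sum: "(\<lambda>j. 2 / 3 ^ Suc j) sums (1 :: real)"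
proof -
  have "(\<lambda>j. (2/3) * (1/3) ^ j) sums ((2/3) * (1 / (1 - 1/3 :: real)))"
    by (intro sums_mult geometric_sums) simp
  then show ?thesis by (simp add: power_divide mult.commute)
qed

definition schoenberg_hat :: "real \<Rightarrow> real" where
  "schoenberg_hat x = max 0 (min 1 (1/2 - cos (pi * x)))"

text \<open>The hat is constant on the outer thirds of a period, where it reads off the leading ternary
  digit; multiplying by \<open>3\<^sup>m\<close> reads off the digit at position \<open>m\<close>.\<close>

lemma schoenberg_hat_ternary:
  fixes a :: "nat \<Rightarrow> real"
  assumes a: "\<And>m. a m \<in> {0, 1}"
  shows "schoenberg_hat (3 ^ m * (\<Sum>j. 2 * a j / 3 ^ Suc j)) = a m"
proof -
  define y where "y m = (\<Sum>j. 2 * a (m + j) / 3 ^ Suc j)" for m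
  note geo = ternary_twos_sum
  have a01: "0 \<le> a m" "a m \<le> 1" for m using a[of m] by auto
  have smm: "summable (\<lambda>j. 2 * a (m + j) / 3 ^ Suc j)" for m
  proof (rule summable_comparison_test')
    show "summable (\<lambda>j. 2 / 3 ^ Suc j :: real)" using geo by (rule sums_summable)
    show "norm (2 * a (m + j) / 3 ^ Suc j) \<le> 2 / 3 ^ Suc j" for j
      using a01[of "m + j"] by (simp add: field_simps)
  qed
  have y01: "0 \<le> y m" "y m \<le> 1" for m
  proof -
    show "0 \<le> y m" unfolding y_def by (intro suminf_nonneg smm) (simp add: a01)
    have "y m \<le> (\<Sum>j. 2 / 3 ^ Suc j)"
      unfolding y_def
    proof (intro suminf_le smm)
      show "summable (\<lambda>j. 2 / 3 ^ Suc j :: real)" using geo by (rule sums_summable)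
      show "2 * a (m + j) / 3 ^ Suc j \<le> 2 / 3 ^ Suc j" for j
        using a01[of "m + j"] by (simp add: field_simps)
    qed
    then show "y m \<le> 1" using geo by (simp add: sums_iff)
  qed
  have ystep: "3 * y m = 2 * a m + y (Suc m)" for m
  proof -
    have "y m = 2 * a m / 3 + (\<Sum>j. 2 * a (m + Suc j) / 3 ^ Suc (Suc j))"
      unfolding y_def using suminf_split_head[OF smm[of m]] by simp
    also have "(\<Sum>j. 2 * a (m + Suc j) / 3 ^ Suc (Suc j)) = (\<Sum>j. (1/3) * (2 * a (Suc m + j) / 3 ^ Suc j))"
      by simp
    also have "\<dots> = (1/3) * y (Suc m)" unfolding y_def by (rule suminf_mult[OF smm])
    finally show ?thesis by simp
  qed
  have "\<exists>A::int. 3 ^ m * y 0 = 2 * real_of_int A + y m"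
  proof (induction m)
    case (Suc m)
    then obtain A :: int where "3 ^ m * y 0 = 2 * real_of_int A + y m" by blast
    then have "3 ^ Suc m * y 0 = 6 * A + 3 * y m" by simp
    also have "\<dots> = 6 * A + 2 * a m + y (Suc m)" by (simp add: ystep)
    also have "\<dots> = 2 * real_of_int (3 * A + (if a m = 0 then 0 else 1)) + y (Suc m)" using a[of m] by auto
    finally show ?case by blast
  qed (auto intro: exI[of _ 0])
  then obtain A :: int where A: "3 ^ m * y 0 = 2 * real_of_int A + y m" by blast
  have "cos (pi * (2 * A + y m)) = cos (pi * y m)"
    using cos_int_2pin[of A] sin_int_2pin[of A] by (simp add: algebra_simps cos_add)
  then have *: "schoenberg_hat (3 ^ m * (\<Sum>j. 2 * a j / 3 ^ Suc j)) = schoenberg_hat (y m)"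
    using A by (simp add: y_def schoenberg_hat_def)
  show ?thesis
  proof (cases "a m = 0")
    case True
    then have "y m \<le> 1/3" using ystep[of m] y01[of "Suc m"] by simp
    then have "cos (pi * (1/3)) \<le> cos (pi * y m)"
      using y01[of m] by (intro cos_monotone_0_pi_le) auto
    then have "1/2 \<le> cos (pi * y m)" by (simp add: cos_60)
    then show ?thesis using * True by (simp add: schoenberg_hat_def)
  next
    case False
    then have am: "a m = 1" using a[of m] by auto
    then have "2/3 \<le> y m" using ystep[of m] y01[of "Suc m"] by simp
    then have "cos (pi * y m) \<le> cos (pi * (2/3))"
      using y01[of m] by (intro cos_monotone_0_pi_le) auto
    also have "cos (pi * (2/3)) = - 1/2" using cos_120 by (simp add: mult.commute)
    finally show ?thesis using * am by (simp add: schoenberg_hat_def)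
  qed
qed

definition unit_cube :: "(real^'n::finite) set" where
  "unit_cube = {s. \<forall>i. 0 \<le> s $ i \<and> s $ i \<le> 1}"

text \<open>Schoenberg's curve: interleave the binary digits of the coordinates of a point of the cube as
  ternary digits \<open>0\<close> and \<open>2\<close> of the parameter.\<close>

lemma space_filling_curve:
  obtains \<phi> :: "real \<Rightarrow> real^'n::finite" where "continuous_on UNIV \<phi>" "range \<phi> \<subseteq> unit_cube"
    "unit_cube \<subseteq> \<phi> ` {0..1}"
proof -
  let ?n = "CARD('n)"
  obtain e where e: "bij_betw e (UNIV :: 'n set) {0..<?n}"
    using ex_bij_betw_finite_nat[OF finite_class.finite_UNIV] by blast
  have n0: "?n > 0" by simp
  define f where "f i k x = schoenberg_hat (3 ^ (?n * k + e i) * x) / 2 ^ Suc k" for i k x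
  define \<phi> :: "real \<Rightarrow> real^'n" where "\<phi> x = (\<chi> i. \<Sum>k. f i k x)" for x
  have hat01: "0 \<le> schoenberg_hat x" "schoenberg_hat x \<le> 1" for x by (auto simp: schoenberg_hat_def)
  have hatc: "continuous_on UNIV schoenberg_hat"
    unfolding schoenberg_hat_def by (intro continuous_intros)
  have geo: "(\<lambda>k. 1 / 2 ^ Suc k) sums (1 :: real)"
    using power_half_series by (simp add: power_divide)
  have fb: "0 \<le> f i k x" "f i k x \<le> 1 / 2 ^ Suc k" for i k x
    using hat01 by (auto simp: f_def intro!: divide_right_mono)
  have smm: "summable (\<lambda>k. f i k x)" for i x
    using fb by (intro summable_comparison_test'[OF sums_summable[OF geo]]) auto
  have comp: "continuous_on UNIV (\<lambda>x. \<Sum>k. f i k x)" for i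
  proof (rule uniform_limit_theorem)
    show "uniform_limit UNIV (\<lambda>n x. \<Sum>k<n. f i k x) (\<lambda>x. \<Sum>k. f i k x) sequentially"
      using fb by (intro Weierstrass_m_test[OF _ sums_summable[OF geo]]) auto
    have "continuous_on UNIV (f i k)" for k
      unfolding f_def by (intro continuous_intros continuous_on_compose2[OF hatc]) auto
    then show "\<forall>\<^sub>F n in sequentially. continuous_on UNIV (\<lambda>x. \<Sum>k<n. f i k x)"
      by (intro always_eventually allI continuous_on_sum) auto
  qed simp
  have "continuous_on UNIV \<phi>" unfolding \<phi>_def by (intro continuous_on_vec_lambda comp)
  moreover have "range \<phi> \<subseteq> unit_cube"
  proof -
    have "0 \<le> (\<Sum>k. f i k x)" "(\<Sum>k. f i k x) \<le> 1" for i x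
    proof -
      show "0 \<le> (\<Sum>k. f i k x)" by (intro suminf_nonneg smm fb)
      have "(\<Sum>k. f i k x) \<le> (\<Sum>k. 1 / 2 ^ Suc k)"
        by (intro suminf_le smm fb sums_summable[OF geo])
      then show "(\<Sum>k. f i k x) \<le> 1" using geo by (simp add: sums_iff)
    qed
    then show ?thesis by (auto simp: unit_cube_def \<phi>_def)
  qed
  moreover have "unit_cube \<subseteq> \<phi> ` {0..1}"
  proof
    fix s :: "real^'n" assume "s \<in> unit_cube"
    have "\<exists>b. (\<forall>k. b k \<in> {0, 1}) \<and> (\<lambda>k. b k / 2 ^ Suc k) sums (s $ i)" for i
    proof -
      have "0 \<le> s $ i" "s $ i \<le> 1" using \<open>s \<in> unit_cube\<close> by (auto simp: unit_cube_def)
      then obtain b where "\<And>k. b k \<in> {0, 1}" "(\<lambda>k. b k / 2 ^ Suc k) sums (s $ i)"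
        using binary_expansion by blast
      then show ?thesis by blast
    qed
    then obtain b :: "'n \<Rightarrow> nat \<Rightarrow> real" where b: "\<And>i k. b i k \<in> {0, 1}" "\<And>i. (\<lambda>k. b i k / 2 ^ Suc k) sums (s $ i)"
      by metis
    (* Digit k of coordinate i goes to position n k + e i. *)
    define a where "a m = b (inv_into UNIV e (m mod ?n)) (m div ?n)" for m
    have a01: "a m \<in> {0, 1}" for m using b(1) by (simp add: a_def)
    have ei: "e i < ?n" "inv_into UNIV e (e i) = i" for i
      using e by (auto simp: bij_betw_def)
    have ae: "a (?n * k + e i) = b i k" for i k
      using ei[of i] n0 by (simp add: a_def)
    define x where "x = (\<Sum>j. 2 * a j / 3 ^ Suc j)"
    have "\<phi> x $ i = s $ i" for i
    proof -
      have "f i k x = b i k / 2 ^ Suc k" for k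
        using schoenberg_hat_ternary[of a "?n * k + e i", OF a01] by (simp add: f_def x_def ae)
      then show ?thesis using b(2)[of i] by (simp add: \<phi>_def sums_iff)
    qed
    then have "\<phi> x = s" by (simp add: vec_eq_iff)
    moreover have "x \<in> {0..1}"
    proof -
      note geo3 = ternary_twos_sum
      have le: "0 \<le> 2 * a j / 3 ^ Suc j" "2 * a j / 3 ^ Suc j \<le> 2 / 3 ^ Suc j" for j
        using a01[of j] by (auto simp: field_simps)
      have smx: "summable (\<lambda>j. 2 * a j / 3 ^ Suc j)"
      proof (rule summable_comparison_test'[OF sums_summable[OF geo3], of 0])
        show "norm (2 * a j / 3 ^ Suc j) \<le> 2 / 3 ^ Suc j" for j
          unfolding real_norm_def by (subst abs_of_nonneg) (rule le)+
      qed
      have "x \<le> (\<Sum>j. 2 / 3 ^ Suc j)"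
        unfolding x_def by (intro suminf_le smx le sums_summable[OF geo3])
      moreover have "0 \<le> x" unfolding x_def by (intro suminf_nonneg smx le)
      ultimately show ?thesis using geo3 by (simp add: sums_iff)
    qed
    ultimately show "s \<in> \<phi> ` {0..1}" by blast
  qed
  ultimately show ?thesis using that by blast
qed

section \<open>Weak compactness on the cube\<close>

lemma unit_cube_sets [measurable]: "unit_cube \<in> sets (borel :: (real^'n::finite) measure)"
proof -
  have "closed (unit_cube :: (real^'n) set)"
    unfolding unit_cube_def by (intro closed_Collect_all closed_Collect_conj closed_Collect_le continuous_intros)
  then show ?thesis by simp
qed

text \<open>Measures on the cube that charge finitely many points lift along the space-filling curve to
  measures on \<open>[0,1]\<close>; there Helly's theorem gives a weak limit, which is pushed forward.\<close>

lemma weak_limit_on_cube_prob: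
  fixes I :: "nat \<Rightarrow> 'k set" and w :: "nat \<Rightarrow> 'k \<Rightarrow> real" and s :: "nat \<Rightarrow> 'k \<Rightarrow> real^'n::finite"
  assumes fin: "\<And>N. finite (I N)" and w: "\<And>N k. k \<in> I N \<Longrightarrow> 0 \<le> w N k"
    and one: "\<And>N. (\<Sum>k\<in>I N. w N k) = 1" and s: "\<And>N k. k \<in> I N \<Longrightarrow> s N k \<in> unit_cube"
  shows "\<exists>(r :: nat \<Rightarrow> nat) \<rho>. strict_mono r \<and> sets \<rho> = sets borel \<and> finite_measure \<rho> \<and>
    (AE x in \<rho>. x \<in> unit_cube) \<and>
    (\<forall>h. continuous_on UNIV h \<longrightarrow>
       (\<lambda>N. \<Sum>k\<in>I (r N). w (r N) k * h (s (r N) k)) \<longlonglongrightarrow> (\<integral>x. h x \<partial>\<rho> :: real))"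
proof -
  obtain \<phi> :: "real \<Rightarrow> real^'n" where \<phi>: "continuous_on UNIV \<phi>" "range \<phi> \<subseteq> unit_cube"
    "unit_cube \<subseteq> \<phi> ` {0..1}" by (rule space_filling_curve)
  define pre where "pre y = (SOME x. x \<in> {0..1} \<and> \<phi> x = y)" for y
  have pre: "pre y \<in> {0..1}" "\<phi> (pre y) = y" if "y \<in> unit_cube" for y
  proof -
    have "\<exists>x. x \<in> {0..1} \<and> \<phi> x = y" using \<phi>(3) that by blast
    then have "pre y \<in> {0..1} \<and> \<phi> (pre y) = y" unfolding pre_def by (rule someI_ex)
    then show "pre y \<in> {0..1}" "\<phi> (pre y) = y" by auto
  qed
  define P where "P N = point_measure (I N) (\<lambda>k. ennreal (w N k))" for N
  define \<mu> where "\<mu> N = distr (P N) borel (\<lambda>k. pre (s N k))" for N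
  have P_prob: "prob_space (P N)" for N
    unfolding P_def using fin w one
    by (intro prob_space_point_measure) (auto simp: sum_ennreal)
  have meas: "(\<lambda>k. pre (s N k)) \<in> measurable (P N) borel" for N
    unfolding P_def by simp
  have \<mu>_dist: "real_distribution (\<mu> N)" for N
    unfolding \<mu>_def by (intro prob_space.real_distribution_distr P_prob meas)
  have \<mu>_int: "(\<integral>x. h x \<partial>\<mu> N) = (\<Sum>k\<in>I N. w N k * h (pre (s N k)))"
    if "h \<in> borel_measurable borel" for h :: "real \<Rightarrow> real" and N
  proof -
    have "(\<integral>x. h x \<partial>\<mu> N) = (\<integral>k. h (pre (s N k)) \<partial>P N)"
      unfolding \<mu>_def by (intro integral_distr meas that)
    also have "\<dots> = (\<Sum>k\<in>I N. w N k * h (pre (s N k)))"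
      unfolding P_def by (subst lebesgue_integral_point_measure_finite) (auto simp: fin w)
    finally show ?thesis .
  qed
  have "measure (\<mu> N) {-1<..1} = 1" for N
  proof -
    interpret prob_space "P N" by (rule P_prob)
    have "measure (\<mu> N) {-1<..1} = measure (P N) ((\<lambda>k. pre (s N k)) -` {-1<..1} \<inter> space (P N))"
      unfolding \<mu>_def by (intro measure_distr meas) simp
    also have "(\<lambda>k. pre (s N k)) -` {-1<..1} \<inter> space (P N) = space (P N)"
      using pre(1)[OF s] by (force simp: P_def space_point_measure)
    finally show ?thesis by (simp add: prob_space)
  qed
  then have "tight \<mu>"
    unfolding tight_def using \<mu>_dist by (intro conjI allI impI exI[of _ "-1"] exI[of _ 1]) auto
  then obtain r M where r: "strict_mono (r :: nat \<Rightarrow> nat)" "real_distribution M" "weak_conv_m (\<mu> \<circ> id \<circ> r) M"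
    using tight_imp_convergent_subsubsequence[of \<mu> id] by (auto simp: strict_mono_id)
  interpret M: real_distribution M by fact
  have \<phi>_meas: "\<phi> \<in> borel_measurable M"
    using borel_measurable_continuous_onI[OF \<phi>(1)] by (simp add: measurable_def M.events_eq_borel M.space_eq_univ)
  define \<rho> where "\<rho> = distr M borel \<phi>"
  have "sets \<rho> = sets borel" by (simp add: \<rho>_def)
  moreover have "finite_measure \<rho>"
    unfolding \<rho>_def by (intro prob_space.finite_measure M.prob_space_distr \<phi>_meas)
  moreover have "AE x in \<rho>. x \<in> unit_cube"
    unfolding \<rho>_def by (subst AE_distr_iff[OF \<phi>_meas]) (use \<phi>(2) in auto)
  moreover have "(\<lambda>N. \<Sum>k\<in>I (r N). w (r N) k * h (s (r N) k)) \<longlonglongrightarrow> (\<integral>x. h x \<partial>\<rho> :: real)"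
    if h: "continuous_on UNIV h" for h
  proof -
    have hm: "h \<in> borel_measurable borel" by (rule borel_measurable_continuous_onI[OF h])
    have c: "continuous_on UNIV (\<lambda>x. h (\<phi> x))"
      by (rule continuous_on_compose2[OF h \<phi>(1)]) simp
    have "compact (h ` \<phi> ` {0..1})"
      by (intro compact_continuous_image compact_Icc continuous_on_subset[OF h] continuous_on_subset[OF \<phi>(1)]) auto
    then obtain B where bd: "\<forall>y\<in>h ` \<phi> ` {0..1}. norm y \<le> B"
      using compact_imp_bounded bounded_iff by blast
    have B: "norm (h (\<phi> x)) \<le> B" for x
    proof -
      have "\<phi> x \<in> \<phi> ` {0..1}" using \<phi>(2,3) by blast
      then show ?thesis using bd by blast
    qed
    have cm: "(\<lambda>x. h (\<phi> x)) \<in> borel_measurable borel" by (rule borel_measurable_continuous_onI[OF c])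
    have "(\<lambda>N. integral\<^sup>L ((\<mu> \<circ> id \<circ> r) N) (\<lambda>x. h (\<phi> x))) \<longlonglongrightarrow> integral\<^sup>L M (\<lambda>x. h (\<phi> x))"
    proof (rule weak_conv_imp_integral_bdd_continuous_conv[OF _ _ r(3)])
      show "real_distribution ((\<mu> \<circ> id \<circ> r) N)" for N using \<mu>_dist by simp
      show "real_distribution M" by fact
      show "isCont (\<lambda>x. h (\<phi> x)) x" for x using c by (simp add: continuous_on_eq_continuous_at)
    qed (rule B)
    moreover have "integral\<^sup>L ((\<mu> \<circ> id \<circ> r) N) (\<lambda>x. h (\<phi> x)) = (\<Sum>k\<in>I (r N). w (r N) k * h (s (r N) k))" for N
      using pre(2)[OF s] by (simp add: \<mu>_int[OF cm])
    moreover have "integral\<^sup>L M (\<lambda>x. h (\<phi> x)) = (\<integral>x. h x \<partial>\<rho>)"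
      unfolding \<rho>_def by (rule integral_distr[OF \<phi>_meas hm, symmetric])
    ultimately show ?thesis by simp
  qed
  ultimately show ?thesis using r(1) by blast
qed

lemma weak_limit_on_cube:
  fixes I :: "nat \<Rightarrow> 'k set" and w :: "nat \<Rightarrow> 'k \<Rightarrow> real" and s :: "nat \<Rightarrow> 'k \<Rightarrow> real^'n::finite"
  assumes fin: "\<And>N. finite (I N)" and w: "\<And>N k. k \<in> I N \<Longrightarrow> 0 \<le> w N k"
    and T: "\<And>N. (\<Sum>k\<in>I N. w N k) = T" and s: "\<And>N k. k \<in> I N \<Longrightarrow> s N k \<in> unit_cube"
  shows "\<exists>(r :: nat \<Rightarrow> nat) \<rho>. strict_mono r \<and> sets \<rho> = sets borel \<and> finite_measure \<rho> \<and>
    (AE x in \<rho>. x \<in> unit_cube) \<and>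
    (\<forall>h. continuous_on UNIV h \<longrightarrow>
       (\<lambda>N. \<Sum>k\<in>I (r N). w (r N) k * h (s (r N) k)) \<longlonglongrightarrow> (\<integral>x. h x \<partial>\<rho> :: real))"
proof (cases "T = 0")
  case True
  then have "w N k = 0" if "k \<in> I N" for N k
    using T[of N] w fin[of N] that by (simp add: sum_nonneg_eq_0_iff)
  then have "(\<lambda>N. \<Sum>k\<in>I (id N). w (id N) k * h (s (id N) k)) \<longlonglongrightarrow> (\<integral>x. h x \<partial>null_measure borel :: real)" for h
    by simp
  moreover have "AE x in null_measure (borel :: (real^'n) measure). x \<in> unit_cube"
    by (rule AE_I[where N = UNIV]) auto
  moreover have "finite_measure (null_measure (borel :: (real^'n) measure))"
    by (rule finite_measureI) simp
  ultimately show ?thesis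
    by (intro exI[of _ id] exI[of _ "null_measure borel"] conjI allI impI) (simp_all add: strict_mono_id)
next
  case False
  have "T \<ge> 0" unfolding T[of 0, symmetric] by (intro sum_nonneg w)
  with False have T0: "T > 0" by simp
  have one: "(\<Sum>k\<in>I N. w N k / T) = 1" for N using T T0 by (simp add: sum_divide_distrib[symmetric])
  have wT: "0 \<le> w N k / T" if "k \<in> I N" for N k using w[OF that] T0 by simp
  obtain r :: "nat \<Rightarrow> nat" and \<rho> :: "(real^'n) measure" where \<rho>: "strict_mono r" "sets \<rho> = sets borel" "finite_measure \<rho>"
    "AE x in \<rho>. x \<in> unit_cube"
    "\<And>h. continuous_on UNIV h \<Longrightarrow>
       (\<lambda>N. \<Sum>k\<in>I (r N). w (r N) k / T * h (s (r N) k)) \<longlonglongrightarrow> (\<integral>x. h x \<partial>\<rho> :: real)"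
    using weak_limit_on_cube_prob[of I "\<lambda>N k. w N k / T" s, OF fin wT one s] by blast
  interpret finite_measure \<rho> by fact
  let ?\<rho> = "density \<rho> (\<lambda>_. ennreal T)"
  have "finite_measure ?\<rho>"
    by (rule finite_measureI) (simp add: emeasure_density ennreal_mult_eq_top_iff)
  moreover have "AE x in ?\<rho>. x \<in> unit_cube" using \<rho>(4) by (simp add: AE_density)
  moreover have "(\<lambda>N. \<Sum>k\<in>I (r N). w (r N) k * h (s (r N) k)) \<longlonglongrightarrow> (\<integral>x. h x \<partial>?\<rho>)"
    if h: "continuous_on UNIV h" for h :: "real^'n \<Rightarrow> real"
  proof -
    have hm: "h \<in> borel_measurable \<rho>"
      using borel_measurable_continuous_onI[OF h] \<rho>(2) by (simp cong: measurable_cong_sets)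
    have "(\<lambda>N. T * (\<Sum>k\<in>I (r N). w (r N) k / T * h (s (r N) k))) \<longlonglongrightarrow> T * (\<integral>x. h x \<partial>\<rho>)"
      by (intro tendsto_intros \<rho>(5) h)
    moreover have "(\<integral>x. h x \<partial>?\<rho>) = T * (\<integral>x. h x \<partial>\<rho>)"
      using T0 hm by (subst integral_density) auto
    moreover have "T * (\<Sum>k\<in>I (r N). w (r N) k / T * h (s (r N) k)) = (\<Sum>k\<in>I (r N). w (r N) k * h (s (r N) k))" for N
      using T0 by (simp add: sum_distrib_left mult.assoc)
    ultimately show ?thesis by simp
  qed
  ultimately show ?thesis
    using \<rho>(1,2) by (intro exI[of _ r] exI[of _ ?\<rho>] conjI allI impI) simp_all
qed

section \<open>The moment problem on the cube\<close>

definition seq_diff :: "'n \<Rightarrow> (('n \<Rightarrow> nat) \<Rightarrow> real) \<Rightarrow> ('n \<Rightarrow> nat) \<Rightarrow> real" where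
  "seq_diff i F m = F m - F (m(i := Suc (m i)))"

definition cm_sequence :: "(('n \<Rightarrow> nat) \<Rightarrow> real) \<Rightarrow> bool" where
  "cm_sequence F \<longleftrightarrow> (\<forall>is m. 0 \<le> foldr seq_diff is F m)"

lemma cm_sequence_nonneg: "cm_sequence F \<Longrightarrow> 0 \<le> F m"
  unfolding cm_sequence_def by (metis foldr.simps(1) id_apply)

lemma cm_sequence_seq_diff: "cm_sequence F \<Longrightarrow> cm_sequence (seq_diff i F)"
  unfolding cm_sequence_def
proof (intro allI)
  fix js m assume "\<forall>is m. 0 \<le> foldr seq_diff is F m"
  then have "0 \<le> foldr seq_diff (js @ [i]) F m" by blast
  then show "0 \<le> foldr seq_diff js (seq_diff i F) m" by simp
qed

text \<open>The linear functional with \<open>x\<^sup>m \<mapsto> F m\<close>, on the product of the polynomials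
  \<open>w\<^sub>i\<close> in \<open>x\<^sub>i\<close>, all of degree at most \<open>M\<close>.\<close>

definition moment_functional :: "nat \<Rightarrow> (('n::finite \<Rightarrow> nat) \<Rightarrow> real) \<Rightarrow> ('n \<Rightarrow> real poly) \<Rightarrow> real" where
  "moment_functional M F w = (\<Sum>p\<in>(\<Pi>\<^sub>E i\<in>UNIV. {..M}). (\<Prod>i\<in>UNIV. coeff (w i) (p i)) * F p)"

lemma moment_functional_monom:
  assumes "\<And>i. m i \<le> M"
  shows "moment_functional M F (\<lambda>i. monom 1 (m i)) = F m"
proof -
  have eq: "(\<Prod>i\<in>UNIV. coeff (monom 1 (m i)) (p i)) * F p = (if p = m then F p else 0)" for p
  proof (cases "p = m")
    case False
    then obtain i where "p i \<noteq> m i" by (auto simp: fun_eq_iff)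
    then have "(\<Prod>i\<in>UNIV. coeff (monom (1::real) (m i)) (p i)) = 0"
      by (intro prod_zero bexI[of _ i]) auto
    then show ?thesis using False by simp
  qed simp
  have "finite (\<Pi>\<^sub>E i\<in>(UNIV :: 'a set). {..M})" by (intro finite_PiE) auto
  moreover have "m \<in> (\<Pi>\<^sub>E i\<in>UNIV. {..M})" using assms by (simp add: PiE_UNIV_domain)
  ultimately show ?thesis unfolding moment_functional_def eq by (simp only: sum.delta if_True)
qed

lemma moment_functional_sum:
  fixes a :: "'n::finite \<Rightarrow> nat \<Rightarrow> real"
  assumes "\<And>i. w i = (\<Sum>k\<le>K. smult (a i k) (B i k))"
  shows "moment_functional M F w =
     (\<Sum>k\<in>(\<Pi>\<^sub>E i\<in>UNIV. {..K}). (\<Prod>i\<in>UNIV. a i (k i)) * moment_functional M F (\<lambda>i. B i (k i)))"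
proof -
  have "moment_functional M F w = (\<Sum>p\<in>(\<Pi>\<^sub>E i\<in>UNIV. {..M}). (\<Prod>i\<in>UNIV. \<Sum>k\<le>K. a i k * coeff (B i k) (p i)) * F p)"
    unfolding moment_functional_def by (simp add: assms coeff_sum)
  also have "\<dots> = (\<Sum>p\<in>(\<Pi>\<^sub>E i\<in>UNIV. {..M}). \<Sum>k\<in>(\<Pi>\<^sub>E i\<in>UNIV. {..K}).
      (\<Prod>i\<in>UNIV. a i (k i)) * ((\<Prod>i\<in>UNIV. coeff (B i (k i)) (p i)) * F p))"
    by (subst prod_sum_PiE) (simp_all add: sum_distrib_right prod.distrib mult.assoc)
  also have "\<dots> = (\<Sum>k\<in>(\<Pi>\<^sub>E i\<in>UNIV. {..K}). (\<Prod>i\<in>UNIV. a i (k i)) * moment_functional M F (\<lambda>i. B i (k i)))"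
    by (subst sum.swap) (simp add: moment_functional_def sum_distrib_left)
  finally show ?thesis .
qed

text \<open>A factor \<open>1 - x\<^sub>i\<close> passes to the sequence as a difference.  Thus complete monotonicity is
  positivity of the functional on the products of \<open>x\<^sub>i\<^sup>k (1 - x\<^sub>i)\<^sup>j\<close>.\<close>

lemma moment_functional_mult_one_minus_X:
  assumes deg: "degree (w i) < M"
  shows "moment_functional M F (w(i := [:1, -1:] * w i)) = moment_functional M (seq_diff i F) w"
proof -
  let ?Q = "(\<Pi>\<^sub>E j\<in>UNIV-{i}. {..M})"
  have one_dim: "(\<Sum>x\<le>M. coeff ([:1, -1:] * w i) x * f x) = (\<Sum>x\<le>M. coeff (w i) x * (f x - f (Suc x)))" for f :: "nat \<Rightarrow> real"
  proof -
    have cf: "coeff ([:1, -1:] * w i) x = coeff (w i) x - (case x of 0 \<Rightarrow> 0 | Suc y \<Rightarrow> coeff (w i) y)" for x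
      by (cases x) simp_all
    obtain M' where M': "M = Suc M'" using deg by (cases M) auto
    have "coeff (w i) M = 0" using deg by (simp add: coeff_eq_0)
    then have "(\<Sum>x\<le>M. coeff (w i) x * f (Suc x)) = (\<Sum>y\<le>M'. coeff (w i) y * f (Suc y))"
      by (simp add: M')
    also have "\<dots> = (\<Sum>x\<le>M. (case x of 0 \<Rightarrow> 0 | Suc y \<Rightarrow> coeff (w i) y) * f x)"
      unfolding M' by (subst sum.atMost_Suc_shift) simp
    finally show ?thesis by (simp only: cf left_diff_distrib right_diff_distrib sum_subtractf)
  qed
  have pr: "(\<Prod>j\<in>UNIV. coeff (v j) ((q(i := x)) j)) = coeff (v i) x * (\<Prod>j\<in>UNIV-{i}. coeff (v j) (q j))"
    for v :: "'a \<Rightarrow> real poly" and q x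
    by (subst prod.remove[of _ i]) (auto intro!: prod.cong)
  have "moment_functional M F (w(i := [:1, -1:] * w i)) =
    (\<Sum>q\<in>?Q. (\<Prod>j\<in>UNIV-{i}. coeff (w j) (q j)) * (\<Sum>x\<le>M. coeff ([:1, -1:] * w i) x * F (q(i := x))))"
  proof -
    have *: "(\<Prod>j\<in>UNIV-{i}. coeff ((w(i := [:1, -1:] * w i)) j) (q j)) = (\<Prod>j\<in>UNIV-{i}. coeff (w j) (q j))" for q
      by (intro prod.cong) auto
    show ?thesis
      unfolding moment_functional_def
      by (subst sum_PiE_split[of _ _ i]) (simp only: pr * fun_upd_same sum_distrib_left, simp only: mult_ac)
  qed
  also have "\<dots> = (\<Sum>q\<in>?Q. (\<Prod>j\<in>UNIV-{i}. coeff (w j) (q j)) * (\<Sum>x\<le>M. coeff (w i) x * (F (q(i := x)) - F (q(i := Suc x)))))"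
    unfolding one_dim ..
  also have "\<dots> = moment_functional M (seq_diff i F) w"
    unfolding moment_functional_def
    by (subst sum_PiE_split[of _ _ i]) (simp only: pr seq_diff_def fun_upd_same fun_upd_upd sum_distrib_left, simp only: mult_ac)
  finally show ?thesis .
qed

lemma moment_functional_nonneg:
  fixes F :: "('n::finite \<Rightarrow> nat) \<Rightarrow> real"
  assumes "cm_sequence F" "\<And>i. j i + k i \<le> M"
  shows "0 \<le> moment_functional M F (\<lambda>i. [:1, -1:] ^ j i * monom 1 (k i))"
  using assms
proof (induction "\<Sum>i\<in>UNIV. j i" arbitrary: j F)
  case 0
  then have "j i = 0" for i by simp
  then show ?case
    using 0(3) cm_sequence_nonneg[OF 0(2)] by (simp add: moment_functional_monom)
next
  case (Suc S)
  have "\<exists>i. j i \<noteq> 0"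
  proof (rule ccontr)
    assume "\<nexists>i. j i \<noteq> 0"
    then have "(\<Sum>i\<in>UNIV. j i) = 0" by simp
    with Suc.hyps(2) show False by simp
  qed
  then obtain i where "j i \<noteq> 0" by blast
  then obtain l where l: "j i = Suc l" by (cases "j i") auto
  define j' where "j' = j(i := l)"
  define w where "w a = [:1, -1:] ^ j' a * (monom 1 (k a) :: real poly)" for a
  have eq: "(\<lambda>a. [:1, -1:] ^ j a * monom 1 (k a)) = w(i := [:1, -1:] * w i)"
    by (rule ext) (simp add: w_def j'_def l mult.assoc del: mult_pCons_left mult_pCons_right)
  have "(\<Sum>a\<in>UNIV. j a) = Suc (\<Sum>a\<in>UNIV. j' a)"
    unfolding j'_def by (subst (1 2) sum.remove[of _ i]) (auto simp: l intro!: sum.cong)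
  then have S: "S = (\<Sum>a\<in>UNIV. j' a)" using Suc.hyps(2) by simp
  have "w i = [:1, -1:] ^ l * monom 1 (k i)" by (simp add: w_def j'_def)
  then have "degree (w i) \<le> degree ([:1, -1:] ^ l :: real poly) + degree (monom (1::real) (k i))"
    by (simp only: degree_mult_le)
  also have "\<dots> \<le> l + k i"
    using degree_power_le[of "[:1, -1:] :: real poly" l] by (intro add_mono degree_monom_le) simp
  also have "\<dots> < M" using Suc.prems(2)[of i] l by simp
  finally have deg: "degree (w i) < M" .
  have "j' a + k a \<le> M" for a using Suc.prems(2)[of a] l by (auto simp: j'_def)
  then have "0 \<le> moment_functional M (seq_diff i F) w"
    unfolding w_def by (intro Suc.hyps(1)[OF S] cm_sequence_seq_diff Suc.prems(1))
  then show ?case unfolding eq moment_functional_mult_one_minus_X[of w i M, OF deg] .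
qed

text \<open>The coefficient of \<open>x\<^sup>k (1 - x)\<^bsup>M-k\<^esup>\<close> in the expansion of \<open>x\<^sup>m\<close>.\<close>

definition bernstein_coeff :: "nat \<Rightarrow> nat \<Rightarrow> nat \<Rightarrow> real" where
  "bernstein_coeff M m k = (if m \<le> k then real ((M - m) choose (k - m)) else 0)"

lemma monom_bernstein_expansion:
  assumes "m \<le> M"
  shows "(monom 1 m :: real poly) =
    (\<Sum>k\<le>M. smult (bernstein_coeff M m k) ([:1, -1:] ^ (M - k) * monom 1 k))"
proof -
  have "(monom 1 m :: real poly) = monom 1 m * ([:0, 1:] + [:1, -1:]) ^ (M - m)"
  proof -
    have "[:0, 1:] + [:1, -1:] = (1 :: real poly)" by (simp add: one_pCons)
    then show ?thesis by (simp only: power_one mult_1_right)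
  qed
  also have "\<dots> = (\<Sum>j\<le>M-m. smult (real ((M - m) choose j)) ([:1, -1:] ^ (M - m - j) * monom 1 (m + j)))"
    unfolding binomial_ring sum_distrib_left
  proof (intro sum.cong refl)
    fix j
    have mon: "[:0, 1:] ^ j = (monom 1 j :: real poly)" by (simp add: monom_altdef)
    have nat: "of_nat c * p = smult (real c) p" for c and p :: "real poly" by (simp add: of_nat_poly)
    have "monom 1 m * (of_nat ((M - m) choose j) * [:0, 1:] ^ j * [:1, - 1:] ^ (M - m - j)) =
        of_nat ((M - m) choose j) * ([:1, -1:] ^ (M - m - j) * (monom 1 m * monom (1::real) j))"
      unfolding mon by (simp only: mult_ac)
    also have "\<dots> = of_nat ((M - m) choose j) * ([:1, -1:] ^ (M - m - j) * monom (1::real) (m + j))"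
      by (simp only: mult_monom mult_1_left)
    finally show "monom 1 m * (of_nat ((M - m) choose j) * [:0, 1:] ^ j * [:1, - 1:] ^ (M - m - j)) =
      smult (real ((M - m) choose j)) ([:1, -1:] ^ (M - m - j) * monom 1 (m + j))"
      by (simp only: nat)
  qed
  also have "\<dots> = (\<Sum>k\<in>{m..M}. smult (bernstein_coeff M m k) ([:1, -1:] ^ (M - k) * monom 1 k))"
    using assms
    by (intro sum.reindex_bij_witness[of _ "\<lambda>k. k - m" "\<lambda>j. m + j"]) (auto simp: bernstein_coeff_def)
  also have "\<dots> = (\<Sum>k\<le>M. smult (bernstein_coeff M m k) ([:1, -1:] ^ (M - k) * monom 1 k))"
    by (intro sum.mono_neutral_left) (auto simp: bernstein_coeff_def)
  finally show ?thesis .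
qed

lemma bernstein_coeff_Suc:
  assumes "m < M" "k \<le> M"
  shows "bernstein_coeff M (Suc m) k * real (M - m) = bernstein_coeff M m k * real (k - m)"
proof (cases "m < k")
  case True
  then obtain l where l: "k - m = Suc l" "k - Suc m = l" by (metis Suc_diff_Suc)
  obtain L where L: "M - m = Suc L" "M - Suc m = L" using assms(1) by (metis Suc_diff_Suc)
  have "real (Suc L * (L choose l)) = real ((Suc L choose Suc l) * Suc l)"
    by (rule arg_cong[OF Suc_times_binomial_eq])
  then have "real (L choose l) * real (Suc L) = real (Suc L choose Suc l) * real (Suc l)"
    by (simp only: of_nat_mult mult.commute)
  moreover have "m \<le> k" "Suc m \<le> k" using True by simp_all
  ultimately show ?thesis unfolding bernstein_coeff_def l L by (simp only: if_True)
qed (auto simp: bernstein_coeff_def)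

text \<open>The ratio is \<open>\<Prod>\<^bsub>j<m\<^esub> (k - j) / (M - j)\<close>, and each factor is close to \<open>k / M\<close>.\<close>

lemma bernstein_coeff_ratio:
  assumes "m < M" "k \<le> M"
  defines "R \<equiv> \<lambda>m. bernstein_coeff M m k / real (M choose k)"
  shows "0 \<le> R m" "R m \<le> 1" "\<bar>R m - (real k / real M) ^ m\<bar> \<le> real (m * m) / real (M - m)"
proof -
  have "0 \<le> R m \<and> R m \<le> 1 \<and> \<bar>R m - (real k / real M) ^ m\<bar> \<le> real (m * m) / real (M - m)"
    using assms(1)
  proof (induction m)
    case 0
    have "real (M choose k) > 0" using assms(2) by (simp add: zero_less_binomial)
    then show ?case by (simp add: R_def bernstein_coeff_def)
  next
    case (Suc m)
    then have IH: "0 \<le> R m" "R m \<le> 1" "\<bar>R m - (real k / real M) ^ m\<bar> \<le> real (m * m) / real (M - m)" and mM: "m < M"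
      by auto
    define q where "q = real (k - m) / real (M - m)"
    define z where "z = real k / real M"
    have RS: "R (Suc m) = R m * q"
    proof -
      have "real (M - m) \<noteq> 0" using mM by simp
      then have "bernstein_coeff M (Suc m) k = bernstein_coeff M m k * real (k - m) / real (M - m)"
        using bernstein_coeff_Suc[OF mM assms(2)] by (simp only: eq_divide_eq) simp
      then show ?thesis by (simp add: R_def q_def)
    qed
    have q: "0 \<le> q" "q \<le> 1" using mM assms(2) by (auto simp: q_def)
    have z: "0 \<le> z" "z \<le> 1" using mM assms(2) by (auto simp: z_def)
    have qz: "\<bar>q - z\<bar> \<le> real m / real (M - m)"
    proof (cases "m \<le> k")
      case True
      have "z - q = real m * real (M - k) / (real M * real (M - m))"
        using True mM assms(2) by (simp add: q_def z_def of_nat_diff field_simps)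
      then have "\<bar>q - z\<bar> = real m / real (M - m) * (real (M - k) / real M)"
        by (simp add: abs_minus_commute[of q z])
      also have "\<dots> \<le> real m / real (M - m) * 1"
        using mM by (intro mult_left_mono) auto
      finally show ?thesis by simp
    next
      case False
      then have "q = 0" by (simp add: q_def)
      then have "\<bar>q - z\<bar> = real k / real M" using z by (simp add: z_def)
      also have "\<dots> \<le> real m / real (M - m)" using False mM by (intro frac_le) auto
      finally show ?thesis .
    qed
    have "\<bar>R m * q - z ^ m * z\<bar> = \<bar>(R m - z ^ m) * q + z ^ m * (q - z)\<bar>" by (simp add: algebra_simps)
    also have "\<dots> \<le> \<bar>R m - z ^ m\<bar> * 1 + 1 * \<bar>q - z\<bar>"
      using q z by (intro order_trans[OF abs_triangle_ineq] add_mono)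
        (auto simp: abs_mult power_le_one intro!: mult_left_le mult_left_le_one_le)
    also have "\<dots> \<le> real (m * m) / real (M - m) + real m / real (M - m)"
      using IH(3) qz by (simp add: z_def)
    also have "\<dots> = real (m * m + m) / real (M - m)" by (simp add: add_divide_distrib)
    also have "\<dots> \<le> real (Suc m * Suc m) / real (M - Suc m)"
      using Suc.prems by (intro frac_le) (auto simp: algebra_simps)
    finally have "\<bar>R (Suc m) - z ^ Suc m\<bar> \<le> real (Suc m * Suc m) / real (M - Suc m)"
      by (simp add: RS mult.commute)
    moreover have "0 \<le> R (Suc m)" "R (Suc m) \<le> 1"
      using IH q by (auto simp: RS intro: mult_le_one)
    ultimately show ?case unfolding z_def by blast
  qed
  then show "0 \<le> R m" "R m \<le> 1" "\<bar>R m - (real k / real M) ^ m\<bar> \<le> real (m * m) / real (M - m)" by auto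
qed

text \<open>Hausdorff's theorem in several variables.  Expand \<open>x\<^sup>m = x\<^sup>m (x + (1 - x))\<^bsup>M-m\<^esup>\<close> in Bernstein
  polynomials, whose values under the moment functional are nonnegative; as weights at the points
  \<open>k/M\<close> they give measures on the cube whose moments tend to the given sequence.\<close>

theorem hausdorff_moments:
  fixes F :: "('n::finite \<Rightarrow> nat) \<Rightarrow> real"
  assumes cm: "cm_sequence F"
  shows "\<exists>\<rho> :: (real^'n) measure. sets \<rho> = sets borel \<and> finite_measure \<rho> \<and> (AE s in \<rho>. s \<in> unit_cube) \<and>
    (\<forall>m. F m = (\<integral>s. (\<Prod>i\<in>UNIV. (s $ i) ^ m i) \<partial>\<rho>))"
proof -
  define I where "I N = (\<Pi>\<^sub>E i\<in>(UNIV :: 'n set). {..Suc N})" for N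
  define w where "w N k = (\<Prod>i\<in>UNIV. real (Suc N choose k i)) *
     moment_functional (Suc N) F (\<lambda>i. [:1, -1:] ^ (Suc N - k i) * monom 1 (k i))" for N k
  define s :: "nat \<Rightarrow> ('n \<Rightarrow> nat) \<Rightarrow> real^'n" where "s N k = (\<chi> i. real (k i) / real (Suc N))" for N k
  have finI: "finite (I N)" for N unfolding I_def by (intro finite_PiE) auto
  have kI: "k i \<le> Suc N" if "k \<in> I N" for k N i using that by (auto simp: I_def PiE_UNIV_domain)
  have w0: "0 \<le> w N k" if "k \<in> I N" for N k
    unfolding w_def using kI[OF that]
    by (intro mult_nonneg_nonneg prod_nonneg moment_functional_nonneg[OF cm]) auto
  have scube: "s N k \<in> unit_cube" if "k \<in> I N" for N k
  proof -
    have "real (k i) \<le> real (Suc N)" for i by (rule of_nat_mono[OF kI[OF that]])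
    then show ?thesis by (simp add: s_def unit_cube_def)
  qed
  have expand: "F m = (\<Sum>k\<in>I N. w N k * (\<Prod>i\<in>UNIV. bernstein_coeff (Suc N) (m i) (k i) / real (Suc N choose k i)))"
    if "\<And>i. m i \<le> Suc N" for N m
  proof -
    have "F m = moment_functional (Suc N) F (\<lambda>i. monom 1 (m i))"
      using that by (simp add: moment_functional_monom)
    also have "\<dots> = (\<Sum>k\<in>I N. (\<Prod>i\<in>UNIV. bernstein_coeff (Suc N) (m i) (k i)) *
       moment_functional (Suc N) F (\<lambda>i. [:1, -1:] ^ (Suc N - k i) * monom 1 (k i)))"
      unfolding I_def using monom_bernstein_expansion[OF that] by (rule moment_functional_sum)
    also have "\<dots> = (\<Sum>k\<in>I N. w N k * (\<Prod>i\<in>UNIV. bernstein_coeff (Suc N) (m i) (k i) / real (Suc N choose k i)))"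
    proof (intro sum.cong refl)
      fix k assume "k \<in> I N"
      then have "(\<Prod>i\<in>UNIV. real (Suc N choose k i)) \<noteq> 0"
        using kI by (auto simp: prod_zero_iff not_less)
      then show "(\<Prod>i\<in>UNIV. bernstein_coeff (Suc N) (m i) (k i)) *
          moment_functional (Suc N) F (\<lambda>i. [:1, -1:] ^ (Suc N - k i) * monom 1 (k i)) =
        w N k * (\<Prod>i\<in>UNIV. bernstein_coeff (Suc N) (m i) (k i) / real (Suc N choose k i))"
        by (simp add: w_def prod_dividef)
    qed
    finally show ?thesis .
  qed
  have mass: "(\<Sum>k\<in>I N. w N k) = F (\<lambda>_. 0)" for N
  proof -
    have "F (\<lambda>_. 0) = (\<Sum>k\<in>I N. w N k * (\<Prod>i\<in>UNIV. bernstein_coeff (Suc N) 0 (k i) / real (Suc N choose k i)))"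
      by (rule expand) simp
    also have "\<dots> = (\<Sum>k\<in>I N. w N k)"
      using kI by (intro sum.cong refl) (auto simp: bernstein_coeff_def not_less intro!: prod.neutral)
    finally show ?thesis by simp
  qed
  obtain r :: "nat \<Rightarrow> nat" and \<rho> :: "(real^'n) measure" where \<rho>: "strict_mono r" "sets \<rho> = sets borel" "finite_measure \<rho>"
    "AE x in \<rho>. x \<in> unit_cube"
    "\<And>h. continuous_on UNIV h \<Longrightarrow>
       (\<lambda>N. \<Sum>k\<in>I (r N). w (r N) k * h (s (r N) k)) \<longlonglongrightarrow> (\<integral>x. h x \<partial>\<rho> :: real)"
    using weak_limit_on_cube[of I w "F (\<lambda>_. 0)" s, OF finI w0 mass scube] by blast
  have "F m = (\<integral>s. (\<Prod>i\<in>UNIV. (s $ i) ^ m i) \<partial>\<rho>)" for m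
  proof -
    let ?h = "\<lambda>s::real^'n. \<Prod>i\<in>UNIV. (s $ i) ^ m i"
    let ?S = "\<lambda>N. \<Sum>k\<in>I N. w N k * ?h (s N k)"
    let ?e = "\<lambda>N. F (\<lambda>_. 0) * (\<Sum>i\<in>UNIV. real (m i * m i) / real (Suc N - m i))"
    define K where "K = (\<Sum>i\<in>UNIV. m i)"
    have mK: "m i \<le> K" for i unfolding K_def by (intro member_le_sum) auto
    have bound: "\<bar>F m - ?S N\<bar> \<le> ?e N" if N: "N \<ge> K" for N
    proof -
      have mN: "m i < Suc N" for i using mK[of i] N by simp
      have "F m - ?S N = (\<Sum>k\<in>I N. w N k * ((\<Prod>i\<in>UNIV. bernstein_coeff (Suc N) (m i) (k i) / real (Suc N choose k i)) - ?h (s N k)))"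
        using expand[of m N] mN by (simp add: less_imp_le sum_subtractf right_diff_distrib)
      also have "\<bar>\<dots>\<bar> \<le> (\<Sum>k\<in>I N. w N k * (\<Sum>i\<in>UNIV. real (m i * m i) / real (Suc N - m i)))"
      proof (intro order_trans[OF sum_abs] sum_mono)
        fix k assume k: "k \<in> I N"
        have "\<bar>(\<Prod>i\<in>UNIV. bernstein_coeff (Suc N) (m i) (k i) / real (Suc N choose k i)) - ?h (s N k)\<bar>
          \<le> (\<Sum>i\<in>UNIV. \<bar>bernstein_coeff (Suc N) (m i) (k i) / real (Suc N choose k i) - (s N k $ i) ^ m i\<bar>)"
        proof -
          have "norm (bernstein_coeff (Suc N) (m i) (k i) / real (Suc N choose k i)) \<le> 1" for i
            using bernstein_coeff_ratio(1,2)[OF mN[of i] kI[OF k, of i]] by (simp only: real_norm_def abs_of_nonneg)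
          moreover have "norm ((s N k $ i) ^ m i) \<le> 1" for i
          proof -
            have "0 \<le> s N k $ i" "s N k $ i \<le> 1" using scube[OF k] by (auto simp: unit_cube_def)
            then show ?thesis by (simp add: power_le_one)
          qed
          ultimately show ?thesis
            using norm_prod_diff[of UNIV "\<lambda>i. bernstein_coeff (Suc N) (m i) (k i) / real (Suc N choose k i)" "\<lambda>i. (s N k $ i) ^ m i"]
            by (simp only: real_norm_def)
        qed
        also have "\<dots> \<le> (\<Sum>i\<in>UNIV. real (m i * m i) / real (Suc N - m i))"
        proof (rule sum_mono)
          fix i
          show "\<bar>bernstein_coeff (Suc N) (m i) (k i) / real (Suc N choose k i) - (s N k $ i) ^ m i\<bar>
              \<le> real (m i * m i) / real (Suc N - m i)"
            using bernstein_coeff_ratio(3)[OF mN[of i] kI[OF k, of i]] unfolding s_def vec_lambda_beta .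
        qed
        finally show "\<bar>w N k * ((\<Prod>i\<in>UNIV. bernstein_coeff (Suc N) (m i) (k i) / real (Suc N choose k i)) - ?h (s N k))\<bar>
          \<le> w N k * (\<Sum>i\<in>UNIV. real (m i * m i) / real (Suc N - m i))"
          unfolding abs_mult abs_of_nonneg[OF w0[OF k]] by (rule mult_left_mono[OF _ w0[OF k]])
      qed
      also have "\<dots> = ?e N" by (simp only: sum_distrib_right[symmetric] mass)
      finally show ?thesis .
    qed
    have h0: "(\<lambda>N. real (m i * m i) / real (Suc N - m i)) \<longlonglongrightarrow> 0" for i
    proof -
      have "filterlim (\<lambda>N. Suc N - m i) at_top sequentially"
        unfolding filterlim_at_top
      proof
        fix Z
        show "\<forall>\<^sub>F N in sequentially. Z \<le> Suc N - m i"
          by (rule eventually_sequentiallyI[of "Z + m i"]) arith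
      qed
      then have "filterlim (\<lambda>N. real (Suc N - m i)) at_top sequentially"
        by (rule filterlim_compose[OF filterlim_real_sequentially])
      then show ?thesis by (intro tendsto_divide_0[OF tendsto_const] filterlim_at_top_imp_at_infinity)
    qed
    have he: "?e \<longlonglongrightarrow> F (\<lambda>_. 0) * (\<Sum>i\<in>(UNIV :: 'n set). 0)"
      by (rule tendsto_mult[OF tendsto_const tendsto_sum]) (rule h0)
    have "(\<lambda>N. F m - ?S N) \<longlonglongrightarrow> 0"
    proof (rule Lim_null_comparison[of _ ?e])
      show "\<forall>\<^sub>F N in sequentially. norm (F m - ?S N) \<le> ?e N"
        unfolding real_norm_def by (rule eventually_sequentiallyI[of K]) (rule bound)
      show "?e \<longlonglongrightarrow> 0" using he by simp
    qed
    from tendsto_diff[OF tendsto_const this, of "F m"] have "?S \<longlonglongrightarrow> F m" by simp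
    from LIMSEQ_subseq_LIMSEQ[OF this \<rho>(1)] have "(\<lambda>N. ?S (r N)) \<longlonglongrightarrow> F m" by (simp only: comp_def)
    moreover have "(\<lambda>N. ?S (r N)) \<longlonglongrightarrow> (\<integral>s. ?h s \<partial>\<rho>)"
    proof (rule \<rho>(5)[rule_format])
      show "continuous_on UNIV ?h" by (intro continuous_intros)
    qed
    ultimately show ?thesis by (rule LIMSEQ_unique)
  qed
  with \<rho>(2-4) show ?thesis by (intro exI[of _ \<rho>] conjI allI)
qed

lemma integrable_on_cube:
  fixes f :: "real^'n::finite \<Rightarrow> real"
  assumes "finite_measure \<rho>" "sets \<rho> = sets borel" "AE s in \<rho>. s \<in> unit_cube"
    and "f \<in> borel_measurable borel" "\<And>s. s \<in> unit_cube \<Longrightarrow> \<bar>f s\<bar> \<le> B"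
  shows "integrable \<rho> f"
proof (rule finite_measure.integrable_const_bound[OF assms(1), of _ B])
  show "AE x in \<rho>. norm (f x) \<le> B" using assms(3) by eventually_elim (simp add: assms(5))
  show "f \<in> borel_measurable \<rho>" using assms(4) measurable_cong_sets[OF assms(2) refl] by blast
qed

lemma compact_unit_cube: "compact (unit_cube :: (real^'n::finite) set)"
proof -
  have "unit_cube = cbox (0 :: real^'n) 1"
    by (auto simp: unit_cube_def mem_box_cart)
  show ?thesis by (subst \<open>unit_cube = cbox 0 1\<close>, rule compact_cbox)
qed

lemma integrable_continuous_on_cube:
  fixes f :: "real^'n::finite \<Rightarrow> real"
  assumes "finite_measure \<rho>" "sets \<rho> = sets borel" "AE s in \<rho>. s \<in> unit_cube" "continuous_on UNIV f"
  shows "integrable \<rho> f"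
proof -
  have "compact (f ` unit_cube)"
    by (intro compact_continuous_image compact_unit_cube continuous_on_subset[OF assms(4)]) auto
  then obtain B where "\<forall>y\<in>f ` unit_cube. norm y \<le> B" using compact_imp_bounded bounded_iff by blast
  then show ?thesis
    by (intro integrable_on_cube[OF assms(1-3) borel_measurable_continuous_onI[OF assms(4)], of B]) auto
qed

text \<open>The functions \<open>q\<close> for which all moments of \<open>q \<rho>\<close> and \<open>q \<rho>'\<close> agree form a module over
  the polynomials, because it is closed under multiplication by each coordinate.\<close>

lemma integral_eq_if_moments_eq:
  fixes \<rho> \<rho>' :: "(real^'n::finite) measure" and h :: "real^'n \<Rightarrow> real"
  assumes \<rho>: "finite_measure \<rho>" "sets \<rho> = sets borel" "AE s in \<rho>. s \<in> unit_cube"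
    and \<rho>': "finite_measure \<rho>'" "sets \<rho>' = sets borel" "AE s in \<rho>'. s \<in> unit_cube"
    and moments: "\<And>m. (\<integral>s. (\<Prod>i\<in>UNIV. (s $ i) ^ m i) \<partial>\<rho>) = (\<integral>s. (\<Prod>i\<in>UNIV. (s $ i) ^ m i) \<partial>\<rho>')"
    and h: "continuous_on UNIV h"
  shows "(\<integral>s. h s \<partial>\<rho>) = (\<integral>s. h s \<partial>\<rho>')"
proof -
  note int = integrable_continuous_on_cube[OF \<rho>] integrable_continuous_on_cube[OF \<rho>']
  let ?X = "\<lambda>m s::real^'n. \<Prod>i\<in>UNIV. (s $ i) ^ (m i :: nat)"
  have Xc: "continuous_on UNIV (?X m)" for m by (intro continuous_intros)
  define Good where "Good q \<longleftrightarrow> continuous_on UNIV q \<and>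
     (\<forall>m. (\<integral>s. q s * ?X m s \<partial>\<rho>) = (\<integral>s. q s * ?X m s \<partial>\<rho>'))" for q
  have GoodI: "Good q" if "continuous_on UNIV q" "\<And>m. (\<integral>s. q s * ?X m s \<partial>\<rho>) = (\<integral>s. q s * ?X m s \<partial>\<rho>')" for q
    using that by (simp add: Good_def)
  have Good_c: "continuous_on UNIV q" if "Good q" for q using that by (simp add: Good_def)
  have Good_e: "(\<integral>s. q s * ?X m s \<partial>\<rho>) = (\<integral>s. q s * ?X m s \<partial>\<rho>')" if "Good q" for q m
    using that by (simp add: Good_def)
  have qX: "continuous_on UNIV (\<lambda>s. q s * ?X m s)" if "Good q" for q m
    by (intro continuous_on_mult Good_c[OF that] Xc)
  have coord: "Good (\<lambda>s. s $ i * q s)" if q: "Good q" for i q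
  proof (rule GoodI)
    show "continuous_on UNIV (\<lambda>s. s $ i * q s)"
      by (intro continuous_on_mult Good_c[OF q] continuous_intros)
    fix m
    have eq: "s $ i * q s * ?X m s = q s * ?X (m(i := Suc (m i))) s" for s
    proof -
      have split: "?X m' s = (s $ i) ^ m' i * (\<Prod>j\<in>UNIV-{i}. (s $ j) ^ m' j)" for m'
        using prod.remove[OF finite_class.finite_UNIV UNIV_I, of "\<lambda>j. (s $ j) ^ m' j" i] .
      have "(\<Prod>j\<in>UNIV-{i}. (s $ j) ^ ((m(i := Suc (m i))) j)) = (\<Prod>j\<in>UNIV-{i}. (s $ j) ^ m j)"
        by (rule prod.cong[OF refl]) simp
      then show ?thesis unfolding split by (simp only: fun_upd_same power_Suc mult_ac)
    qed
    show "(\<integral>s. s $ i * q s * ?X m s \<partial>\<rho>) = (\<integral>s. s $ i * q s * ?X m s \<partial>\<rho>')"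
      unfolding eq by (rule Good_e[OF q])
  qed
  have scale: "Good (\<lambda>s. c * q s)" if q: "Good q" for c q
  proof (rule GoodI)
    show "continuous_on UNIV (\<lambda>s. c * q s)"
      by (intro continuous_on_mult Good_c[OF q] continuous_intros)
    show "(\<integral>s. c * q s * ?X m s \<partial>\<rho>) = (\<integral>s. c * q s * ?X m s \<partial>\<rho>')" for m
      using Good_e[OF q, of m] by (simp add: mult.assoc)
  qed
  have add: "Good (\<lambda>s. q s + q' s)" if q: "Good q" "Good q'" for q q'
  proof (rule GoodI)
    show "continuous_on UNIV (\<lambda>s. q s + q' s)"
      by (intro continuous_on_add Good_c q)
    show "(\<integral>s. (q s + q' s) * ?X m s \<partial>\<rho>) = (\<integral>s. (q s + q' s) * ?X m s \<partial>\<rho>')" for m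
      using Good_e[OF q(1), of m] Good_e[OF q(2), of m]
      by (simp add: distrib_right int qX q)
  qed
  have zero: "Good (\<lambda>s. 0)" by (rule GoodI) auto
  have sum: "Good (\<lambda>s. \<Sum>i\<in>A. q i s)" if "finite A" "\<And>i. i \<in> A \<Longrightarrow> Good (q i)" for A and q :: "'n \<Rightarrow> _"
    using that by (induction A rule: finite_induct) (auto intro: zero add)
  have poly: "Good (\<lambda>s. p s * q s)" if "real_polynomial_function p" "Good q" for p q
    using that
  proof (induction arbitrary: q rule: real_polynomial_function.induct)
    case (linear f)
    have lin: "f s = (\<Sum>i\<in>UNIV. f (axis i 1) * s $ i)" for s
    proof -
      interpret f: bounded_linear f by fact
      have "f s = f (\<Sum>i\<in>UNIV. (s $ i) *\<^sub>R axis i 1)"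
        by (rule arg_cong[where f = f]) (simp add: vec_eq_iff axis_def if_distrib sum.delta cong: if_cong)
      then show ?thesis by (simp add: f.sum f.scaleR mult.commute)
    qed
    have "f s * q s = (\<Sum>i\<in>UNIV. f (axis i 1) * (s $ i * q s))" for s
      by (subst lin) (simp only: sum_distrib_right mult.assoc)
    then have "(\<lambda>s. f s * q s) = (\<lambda>s. \<Sum>i\<in>UNIV. f (axis i 1) * (s $ i * q s))" ..
    moreover have "Good (\<lambda>s. \<Sum>i\<in>UNIV. f (axis i 1) * (s $ i * q s))"
      by (intro sum scale coord linear) simp
    ultimately show ?case by simp
  next
    case (const c)
    then show ?case by (rule scale)
  next
    case (add f g)
    then show ?case using \<open>\<And>q q'. Good q \<Longrightarrow> Good q' \<Longrightarrow> Good (\<lambda>s. q s + q' s)\<close>[of "\<lambda>s. f s * q s" "\<lambda>s. g s * q s"]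
      by (simp add: distrib_right)
  next
    case (mult f g)
    then have "Good (\<lambda>s. f s * (g s * q s))" by blast
    then show ?case by (simp add: mult.assoc)
  qed
  have one: "Good (\<lambda>s. 1)" by (rule GoodI) (use moments in auto)
  have poly_eq: "(\<integral>s. p s \<partial>\<rho>) = (\<integral>s. p s \<partial>\<rho>')" "continuous_on UNIV p" if "real_polynomial_function p" for p
    using Good_e[OF poly[OF that one], of "\<lambda>_. 0"] Good_c[OF poly[OF that one]] by simp_all
  define K where "K = measure \<rho> (space \<rho>) + measure \<rho>' (space \<rho>')"
  have K: "K \<ge> 0" by (simp add: K_def)
  have "\<bar>(\<integral>s. h s \<partial>\<rho>) - (\<integral>s. h s \<partial>\<rho>')\<bar> \<le> e * K" if e: "e > 0" for e
  proof -
    obtain p where p: "real_polynomial_function p" "\<And>s. s \<in> unit_cube \<Longrightarrow> \<bar>h s - p s\<bar> < e"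
      using Stone_Weierstrass_real_polynomial_function[OF compact_unit_cube continuous_on_subset[OF h subset_UNIV] e]
      by blast
    have near: "\<bar>(\<integral>s. h s \<partial>\<sigma>) - (\<integral>s. p s \<partial>\<sigma>)\<bar> \<le> e * measure \<sigma> (space \<sigma>)"
      if \<sigma>: "finite_measure \<sigma>" "sets \<sigma> = sets borel" "AE s in \<sigma>. s \<in> unit_cube" for \<sigma>
    proof -
      interpret finite_measure \<sigma> by fact
      have i: "integrable \<sigma> h" "integrable \<sigma> p"
        using integrable_continuous_on_cube[OF \<sigma>] h poly_eq(2)[OF p(1)] by blast+
      have "\<bar>(\<integral>s. h s \<partial>\<sigma>) - (\<integral>s. p s \<partial>\<sigma>)\<bar> = \<bar>\<integral>s. h s - p s \<partial>\<sigma>\<bar>" using i by simp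
      also have "\<dots> \<le> (\<integral>s. \<bar>h s - p s\<bar> \<partial>\<sigma>)" by (rule integral_abs_bound)
      also have "\<dots> \<le> (\<integral>s. e \<partial>\<sigma>)"
      proof (rule integral_mono_AE)
        show "AE s in \<sigma>. \<bar>h s - p s\<bar> \<le> e" using \<sigma>(3)
          by eventually_elim (simp add: p(2) less_imp_le)
      qed (use i in auto)
      finally show ?thesis by (simp add: mult.commute)
    qed
    have "\<bar>(\<integral>s. h s \<partial>\<rho>) - (\<integral>s. h s \<partial>\<rho>')\<bar> \<le> \<bar>(\<integral>s. h s \<partial>\<rho>) - (\<integral>s. p s \<partial>\<rho>)\<bar> + \<bar>(\<integral>s. h s \<partial>\<rho>') - (\<integral>s. p s \<partial>\<rho>')\<bar>"
      using poly_eq(1)[OF p(1)] by linarith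
    also have "\<dots> \<le> e * K" using near[OF \<rho>] near[OF \<rho>'] by (simp add: K_def distrib_left)
    finally show ?thesis .
  qed
  note le = this
  show ?thesis
  proof (rule ccontr)
    assume "(\<integral>s. h s \<partial>\<rho>) \<noteq> (\<integral>s. h s \<partial>\<rho>')"
    then have d: "\<bar>(\<integral>s. h s \<partial>\<rho>) - (\<integral>s. h s \<partial>\<rho>')\<bar> > 0" (is "?d > 0") by simp
    then have "?d \<le> ?d / (2 * (K + 1)) * K" using K by (intro le) auto
    also have "\<dots> = ?d * (K / (2 * (K + 1)))" by simp
    also have "\<dots> < ?d * 1" using K by (intro mult_strict_left_mono d) (simp add: field_simps)
    finally show False by simp
  qed
qed

text \<open>The indicator of a closed set is a pointwise limit of continuous functions of the distance.\<close>

lemma measure_eqI_continuous: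
  fixes \<rho> \<rho>' :: "'a::metric_space measure"
  assumes \<rho>: "finite_measure \<rho>" "sets \<rho> = sets borel" and \<rho>': "finite_measure \<rho>'" "sets \<rho>' = sets borel"
    and eq: "\<And>h::'a \<Rightarrow> real. continuous_on UNIV h \<Longrightarrow> (\<integral>s. h s \<partial>\<rho>) = (\<integral>s. h s \<partial>\<rho>')"
  shows "\<rho> = \<rho>'"
proof -
  interpret \<rho>: finite_measure \<rho> by fact
  interpret \<rho>': finite_measure \<rho>' by fact
  have closed_eq: "emeasure \<rho> C = emeasure \<rho>' C" if "closed C" for C
  proof (cases "C = {}")
    case False
    define f where "f k x = max 0 (1 - real k * infdist x C)" for k x
    have fc: "continuous_on UNIV (f k)" for k unfolding f_def by (intro continuous_intros)
    have lim: "(\<lambda>k. f k x) \<longlonglongrightarrow> indicator C x" for x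
    proof (cases "x \<in> C")
      case True
      then show ?thesis by (simp add: f_def)
    next
      case False
      then have pos: "infdist x C > 0"
        using in_closed_iff_infdist_zero[OF that \<open>C \<noteq> {}\<close>] infdist_nonneg[of x C] by force
      obtain N :: nat where "1 < real N * infdist x C" using reals_Archimedean3[OF pos] by blast
      then have "f k x = 0" if "k \<ge> N" for k
      proof -
        have "real N * infdist x C \<le> real k * infdist x C" using that pos by (intro mult_right_mono) auto
        with \<open>1 < real N * infdist x C\<close> show ?thesis by (simp add: f_def)
      qed
      then have "(\<lambda>k. f k x) \<longlonglongrightarrow> 0"
        by (intro tendsto_eventually eventually_sequentiallyI[of N])
      then show ?thesis using False by simp
    qed
    have int: "(\<lambda>k. \<integral>x. f k x \<partial>\<sigma>) \<longlonglongrightarrow> measure \<sigma> C" if \<sigma>: "finite_measure \<sigma>" "sets \<sigma> = sets borel" for \<sigma>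
    proof -
      interpret finite_measure \<sigma> by fact
      have C: "C \<in> sets \<sigma>" using \<open>closed C\<close> by (simp add: \<sigma>(2))
      have "(\<lambda>k. \<integral>x. f k x \<partial>\<sigma>) \<longlonglongrightarrow> (\<integral>x. indicator C x \<partial>\<sigma>)"
      proof (rule integral_dominated_convergence[where w = "\<lambda>_. 1"])
        show "f k \<in> borel_measurable \<sigma>" for k
          using borel_measurable_continuous_onI[OF fc] measurable_cong_sets[OF \<sigma>(2) refl] by blast
        show "AE x in \<sigma>. norm (f k x) \<le> 1" for k by (simp add: f_def infdist_nonneg)
        show "AE x in \<sigma>. (\<lambda>k. f k x) \<longlonglongrightarrow> indicator C x" by (simp add: lim)
      qed (use C in auto)
      then show ?thesis using C by simp
    qed
    have "measure \<rho> C = measure \<rho>' C"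
      using int[OF \<rho>] int[OF \<rho>'] eq[OF fc] by (simp add: LIMSEQ_unique)
    then show ?thesis by (simp add: \<rho>.emeasure_eq_measure \<rho>'.emeasure_eq_measure)
  qed simp
  show ?thesis
  proof (rule measure_eqI_generator_eq[where E = "Collect closed" and \<Omega> = UNIV and A = "\<lambda>_. UNIV"])
    show "Int_stable (Collect closed :: 'a set set)" by (auto simp: Int_stable_def)
    show "sets \<rho> = sigma_sets UNIV (Collect closed)" "sets \<rho>' = sigma_sets UNIV (Collect closed)"
      unfolding \<rho>(2) \<rho>'(2) by (simp_all add: borel_eq_closed)
    show "emeasure \<rho> UNIV \<noteq> \<infinity>" using \<rho>.emeasure_finite[of UNIV] by simp
  qed (auto simp: closed_eq)
qed

theorem moments_determine_measure:
  fixes \<rho> \<rho>' :: "(real^'n::finite) measure"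
  assumes "finite_measure \<rho>" "sets \<rho> = sets borel" "AE s in \<rho>. s \<in> unit_cube"
    and "finite_measure \<rho>'" "sets \<rho>' = sets borel" "AE s in \<rho>'. s \<in> unit_cube"
    and "\<And>m. (\<integral>s. (\<Prod>i\<in>UNIV. (s $ i) ^ m i) \<partial>\<rho>) = (\<integral>s. (\<Prod>i\<in>UNIV. (s $ i) ^ m i) \<partial>\<rho>')"
  shows "\<rho> = \<rho>'"
  by (rule measure_eqI_continuous[OF assms(1,2,4,5)]) (rule integral_eq_if_moments_eq[OF assms])

section \<open>Sequences vanishing on the boundary\<close>

definition seq_inc :: "'n \<Rightarrow> (('n \<Rightarrow> nat) \<Rightarrow> real) \<Rightarrow> ('n \<Rightarrow> nat) \<Rightarrow> real" where
  "seq_inc i G m = G (m(i := Suc (m i))) - G m"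

lemma seq_inc_integral_prod:
  fixes \<phi> :: "'n::finite \<Rightarrow> nat \<Rightarrow> 'a \<Rightarrow> real"
  assumes int: "\<And>m. integrable \<rho> (\<lambda>s. \<Prod>i\<in>UNIV. \<phi> i (m i) s)" and "distinct xs"
    and G: "\<And>m. G m = (\<integral>s. (\<Prod>i\<in>UNIV. \<phi> i (m i) s) \<partial>\<rho>)"
  shows "foldr seq_inc xs G m =
    (\<integral>s. (\<Prod>i\<in>UNIV. if i \<in> set xs then \<phi> i (Suc (m i)) s - \<phi> i (m i) s else \<phi> i (m i) s) \<partial>\<rho>)"
proof -
  let ?f = "\<lambda>xs m s. \<Prod>i\<in>UNIV. if i \<in> set xs then \<phi> i (Suc (m i)) s - \<phi> i (m i) s else \<phi> i (m i) s"
  have "integrable \<rho> (?f xs m) \<and> foldr seq_inc xs G m = (\<integral>s. ?f xs m s \<partial>\<rho>)" for m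
    using assms(2)
  proof (induction xs arbitrary: m)
    case Nil
    then show ?case using int[of m] G[of m] by simp
  next
    case (Cons x xs)
    let ?m = "m(x := Suc (m x))"
    have eq: "?f (x # xs) m s = ?f xs ?m s - ?f xs m s" for s
    proof -
      let ?R = "\<Prod>i\<in>UNIV-{x}. if i \<in> set xs then \<phi> i (Suc (m i)) s - \<phi> i (m i) s else \<phi> i (m i) s"
      let ?g = "\<lambda>m i. if i \<in> set xs then \<phi> i (Suc (m i)) s - \<phi> i (m i) s else \<phi> i (m i) s"
      have split: "?f xs m' s = \<phi> x (m' x) s * (\<Prod>i\<in>UNIV-{x}. ?g m' i)" for m'
        using prod.remove[OF finite_class.finite_UNIV UNIV_I, of "?g m'" x] Cons.prems by simp
      have "(\<Prod>i\<in>UNIV-{x}. ?g ?m i) = ?R"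
      proof (rule prod.cong[OF refl])
        fix i assume "i \<in> UNIV - {x}"
        then have "?m i = m i" by simp
        then show "?g ?m i = ?g m i" by (simp only:)
      qed
      then have "?f xs ?m s = \<phi> x (Suc (m x)) s * ?R" unfolding split by (simp only: fun_upd_same)
      moreover have "?f xs m s = \<phi> x (m x) s * ?R" by (rule split)
      moreover have "?f (x # xs) m s = (\<phi> x (Suc (m x)) s - \<phi> x (m x) s) * ?R"
        by (subst prod.remove[of _ x]) (auto intro!: prod.cong)
      ultimately show ?thesis by (simp only: left_diff_distrib)
    qed
    have IH: "integrable \<rho> (?f xs m')" "foldr seq_inc xs G m' = (\<integral>s. ?f xs m' s \<partial>\<rho>)" for m'
      using Cons by auto
    have "foldr seq_inc (x # xs) G m = (\<integral>s. ?f xs ?m s \<partial>\<rho>) - (\<integral>s. ?f xs m s \<partial>\<rho>)"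
      by (simp only: foldr.simps comp_def seq_inc_def IH)
    also have "\<dots> = (\<integral>s. ?f xs ?m s - ?f xs m s \<partial>\<rho>)"
      by (rule Bochner_Integration.integral_diff[OF IH(1) IH(1), symmetric])
    finally have "foldr seq_inc (x # xs) G m = (\<integral>s. ?f xs ?m s - ?f xs m s \<partial>\<rho>)" .
    with Bochner_Integration.integrable_diff[OF IH(1)[of ?m] IH(1)[of m]] show ?case
      unfolding eq by (rule conjI)
  qed
  then show ?thesis by (rule conjunct2)
qed

lemma foldr_seq_inc_boundary:
  assumes "\<And>m. m i = 0 \<Longrightarrow> G m = 0" "i \<notin> set xs" "m i = 0"
  shows "foldr seq_inc xs G m = 0"
  using assms(2,3)
proof (induction xs arbitrary: m)
  case (Cons x xs)
  have "foldr seq_inc xs G m' = 0" if "m' i = 0" for m'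
    by (rule Cons.IH) (use Cons.prems that in auto)
  moreover have "foldr seq_inc (x # xs) G m = foldr seq_inc xs G (m(x := Suc (m x))) - foldr seq_inc xs G m"
    by (simp add: seq_inc_def[of x "foldr seq_inc xs G"])
  ultimately show ?case using Cons.prems by simp
qed (simp add: assms(1))

text \<open>The sum telescopes in every coordinate, and the lower ends vanish by the boundary condition.\<close>

lemma sum_foldr_seq_inc:
  fixes G :: "('n::finite \<Rightarrow> nat) \<Rightarrow> real"
  assumes zero: "\<And>m i. m i = 0 \<Longrightarrow> G m = 0" and "distinct xs"
  shows "G m = (\<Sum>l\<in>(\<Pi>\<^sub>E i\<in>set xs. {..<m i}). foldr seq_inc xs G (\<lambda>j. if j \<in> set xs then l j else m j))"
  using assms(2)
proof (induction xs)
  case (Cons x xs)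
  let ?H = "foldr seq_inc xs G"
  let ?u = "\<lambda>l j. if j \<in> set xs then l j else m j"
  have x: "x \<notin> set xs" using Cons.prems by simp
  have tel: "(\<Sum>y<k. seq_inc x ?H ((?u l)(x := y))) = ?H ((?u l)(x := k))" for k l
  proof (induction k)
    case 0
    have "?H ((?u l)(x := 0)) = 0"
      by (rule foldr_seq_inc_boundary[of x]) (use zero x in auto)
    then show ?case by (simp only: lessThan_0 sum.empty)
  next
    case (Suc k)
    have "seq_inc x ?H (v(x := k)) = ?H (v(x := Suc k)) - ?H (v(x := k))" for v
      by (simp add: seq_inc_def[of x ?H])
    then show ?case by (simp only: sum.lessThan_Suc Suc)
  qed
  have "(\<Sum>l\<in>(\<Pi>\<^sub>E i\<in>set (x # xs). {..<m i}). foldr seq_inc (x # xs) G (\<lambda>j. if j \<in> set (x # xs) then l j else m j))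
     = (\<Sum>(y, l)\<in>{..<m x} \<times> (\<Pi>\<^sub>E i\<in>set xs. {..<m i}). seq_inc x ?H ((?u l)(x := y)))"
  proof -
    have u: "(\<lambda>j. if j \<in> set (x # xs) then (l(x := y)) j else m j) = (?u l)(x := y)" for l y
      using x by auto
    have "(\<Pi>\<^sub>E i\<in>set (x # xs). {..<m i}) = (\<lambda>(y, l). l(x := y)) ` ({..<m x} \<times> (\<Pi>\<^sub>E i\<in>set xs. {..<m i}))"
      by (simp add: PiE_insert_eq)
    then have "(\<Sum>l\<in>(\<Pi>\<^sub>E i\<in>set (x # xs). {..<m i}). foldr seq_inc (x # xs) G (\<lambda>j. if j \<in> set (x # xs) then l j else m j))
      = (\<Sum>(y, l)\<in>{..<m x} \<times> (\<Pi>\<^sub>E i\<in>set xs. {..<m i}). foldr seq_inc (x # xs) G (\<lambda>j. if j \<in> set (x # xs) then (l(x := y)) j else m j))"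
      by (elim ssubst) (subst sum.reindex[OF inj_combinator[OF x]], rule sum.cong[OF refl], simp only: comp_def case_prod_beta)
    then show ?thesis unfolding u foldr.simps comp_def .
  qed
  also have "\<dots> = (\<Sum>y\<in>{..<m x}. \<Sum>l\<in>(\<Pi>\<^sub>E i\<in>set xs. {..<m i}). seq_inc x ?H ((?u l)(x := y)))"
    by (rule sum.cartesian_product[symmetric])
  also have "\<dots> = (\<Sum>l\<in>(\<Pi>\<^sub>E i\<in>set xs. {..<m i}). \<Sum>y\<in>{..<m x}. seq_inc x ?H ((?u l)(x := y)))"
    by (rule sum.swap)
  also have "\<dots> = (\<Sum>l\<in>(\<Pi>\<^sub>E i\<in>set xs. {..<m i}). ?H (?u l))"
  proof (intro sum.cong refl)
    fix l
    have "(?u l)(x := m x) = ?u l" using x by auto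
    then show "(\<Sum>y\<in>{..<m x}. seq_inc x ?H ((?u l)(x := y))) = ?H (?u l)" unfolding tel by (simp only:)
  qed
  also have "\<dots> = G m" using Cons.IH Cons.prems by (simp only: distinct.simps)
  finally show ?case by (rule sym)
qed simp

definition geo :: "nat \<Rightarrow> real \<Rightarrow> real" where
  "geo m x = (\<Sum>l<m. x ^ l)"

lemma geo_integrable:
  fixes \<rho> :: "(real^'n::finite) measure"
  assumes "finite_measure \<rho>" "sets \<rho> = sets borel" "AE s in \<rho>. s \<in> unit_cube"
  shows "integrable \<rho> (\<lambda>s. \<Prod>i\<in>UNIV. geo (m i) (s $ i))"
  unfolding geo_def by (intro integrable_continuous_on_cube[OF assms] continuous_intros)

text \<open>The increments of \<open>m \<mapsto> \<integral> \<Prod>\<^sub>i (1 + s\<^sub>i + \<dots> + s\<^sub>i\<^bsup>m_i-1\<^esup>) d\<rho>\<close> are the moments of \<open>\<rho>\<close>.\<close>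

lemma geo_integrals_determine_measure:
  fixes \<rho> \<rho>' :: "(real^'n::finite) measure"
  assumes \<rho>: "finite_measure \<rho>" "sets \<rho> = sets borel" "AE s in \<rho>. s \<in> unit_cube"
    and \<rho>': "finite_measure \<rho>'" "sets \<rho>' = sets borel" "AE s in \<rho>'. s \<in> unit_cube"
    and eq: "\<And>m. (\<integral>s. (\<Prod>i\<in>UNIV. geo (m i) (s $ i)) \<partial>\<rho>) = (\<integral>s. (\<Prod>i\<in>UNIV. geo (m i) (s $ i)) \<partial>\<rho>')"
  shows "\<rho> = \<rho>'"
proof (rule moments_determine_measure[OF assms(1-6)])
  fix m :: "'n \<Rightarrow> nat"
  obtain xs :: "'n list" where xs: "distinct xs" "set xs = UNIV"
    using finite_distinct_list[OF finite_class.finite_UNIV] by blast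
  define G where "G m = (\<integral>s. (\<Prod>i\<in>UNIV. geo (m i) (s $ i)) \<partial>\<rho>)" for m :: "'n \<Rightarrow> nat"
  have 1: "foldr seq_inc xs G m = (\<integral>s. (\<Prod>i\<in>UNIV. (s $ i) ^ m i) \<partial>\<rho>)"
    by (subst seq_inc_integral_prod[where \<phi> = "\<lambda>i k s. geo k (s $ i)", OF geo_integrable[OF \<rho>] xs(1)])
       (simp_all add: G_def xs(2) geo_def)
  have 2: "foldr seq_inc xs G m = (\<integral>s. (\<Prod>i\<in>UNIV. (s $ i) ^ m i) \<partial>\<rho>')"
    by (subst seq_inc_integral_prod[where \<phi> = "\<lambda>i k s. geo k (s $ i)", OF geo_integrable[OF \<rho>'] xs(1)])
       (simp only: G_def eq, simp add: xs(2) geo_def)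
  show "(\<integral>s. (\<Prod>i\<in>UNIV. (s $ i) ^ m i) \<partial>\<rho>) = (\<integral>s. (\<Prod>i\<in>UNIV. (s $ i) ^ m i) \<partial>\<rho>')"
    using 1 2 by (rule trans[OF sym])
qed

text \<open>The increments have a representing measure by Hausdorff's theorem; summing the moments
  \<open>s\<^sup>l\<close> over \<open>l < m\<close> gives geometric sums.\<close>

lemma geo_representation:
  fixes G :: "('n::finite \<Rightarrow> nat) \<Rightarrow> real"
  assumes zero: "\<And>m i. m i = 0 \<Longrightarrow> G m = 0" and xs: "distinct xs" "set xs = UNIV"
    and cm: "cm_sequence (foldr seq_inc xs G)"
  shows "\<exists>\<rho> :: (real^'n) measure. sets \<rho> = sets borel \<and> finite_measure \<rho> \<and> (AE s in \<rho>. s \<in> unit_cube) \<and>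
    (\<forall>m. G m = (\<integral>s. (\<Prod>i\<in>UNIV. geo (m i) (s $ i)) \<partial>\<rho>))"
proof -
  from hausdorff_moments[OF cm] obtain \<rho> :: "(real^'n) measure" where
    "sets \<rho> = sets borel \<and> finite_measure \<rho> \<and> (AE s in \<rho>. s \<in> unit_cube) \<and>
    (\<forall>m. foldr seq_inc xs G m = (\<integral>s. (\<Prod>i\<in>UNIV. (s $ i) ^ m i) \<partial>\<rho>))" ..
  then have \<rho>: "sets \<rho> = sets borel" "finite_measure \<rho>" "AE s in \<rho>. s \<in> unit_cube"
    and F: "\<And>m. foldr seq_inc xs G m = (\<integral>s. (\<Prod>i\<in>UNIV. (s $ i) ^ m i) \<partial>\<rho>)"
    by simp_all
  have int: "integrable \<rho> (\<lambda>s. \<Prod>i\<in>UNIV. (s $ i) ^ l i)" for l :: "'n \<Rightarrow> nat"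
    by (intro integrable_continuous_on_cube[OF \<rho>(2,1,3)] continuous_intros)
  have "G m = (\<integral>s. (\<Prod>i\<in>UNIV. geo (m i) (s $ i)) \<partial>\<rho>)" for m
  proof -
    have "G m = (\<Sum>l\<in>(\<Pi>\<^sub>E i\<in>UNIV. {..<m i}). foldr seq_inc xs G l)"
      using sum_foldr_seq_inc[of G xs m, OF zero xs(1)] by (simp only: xs(2) UNIV_I if_True)
    also have "\<dots> = (\<Sum>l\<in>(\<Pi>\<^sub>E i\<in>UNIV. {..<m i}). \<integral>s. (\<Prod>i\<in>UNIV. (s $ i) ^ l i) \<partial>\<rho>)"
      by (simp only: F)
    also have "\<dots> = (\<integral>s. (\<Sum>l\<in>(\<Pi>\<^sub>E i\<in>UNIV. {..<m i}). \<Prod>i\<in>UNIV. (s $ i) ^ l i) \<partial>\<rho>)"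
      by (rule Bochner_Integration.integral_sum[symmetric]) (rule int)
    also have "\<dots> = (\<integral>s. (\<Prod>i\<in>UNIV. geo (m i) (s $ i)) \<partial>\<rho>)"
      unfolding geo_def by (subst prod_sum_PiE) simp_all
    finally show ?thesis .
  qed
  then have "\<forall>m. G m = (\<integral>s. (\<Prod>i\<in>UNIV. geo (m i) (s $ i)) \<partial>\<rho>)" ..
  with \<rho> show ?thesis by (intro exI[of _ \<rho>] conjI)
qed

lemma foldr_commute:
  assumes "\<And>x y F. f x (f y F) = f y (f x F)"
  shows "foldr f (xs @ ys) F = foldr f (ys @ xs) F"
proof -
  have 1: "f x (foldr f ys F) = foldr f ys (f x F)" for x F
    by (induction ys) (simp, metis assms comp_apply foldr.simps(2))
  have "foldr f xs (foldr f ys F) = foldr f ys (foldr f xs F)"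
    by (induction xs) (simp_all add: 1)
  then show ?thesis by simp
qed

lemma seq_diff_commute: "seq_diff i (seq_diff j F) = seq_diff j (seq_diff i F)"
proof (cases "i = j")
  case False
  then have "m(i := a, j := b) = m(j := b, i := a)" for m :: "'a \<Rightarrow> nat" and a b by (rule fun_upd_twist)
  then show ?thesis using False by (intro ext) (simp add: seq_diff_def)
qed simp

lemma foldr_seq_diff_scale: "foldr seq_diff xs (\<lambda>m. c * G m) = (\<lambda>m. c * foldr seq_diff xs G m)"
  by (induction xs) (simp_all add: seq_diff_def[of _ "\<lambda>m. c * _ m"] seq_diff_def[of _ "foldr seq_diff _ _"] fun_eq_iff right_diff_distrib)

lemma foldr_seq_inc_eq: "foldr seq_inc xs G = (\<lambda>m. (-1) ^ length xs * foldr seq_diff xs G m)"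
proof (induction xs)
  case (Cons x xs)
  show ?case
  proof
    fix m
    have "foldr seq_inc (x # xs) G m = foldr seq_inc xs G (m(x := Suc (m x))) - foldr seq_inc xs G m"
      by (simp add: seq_inc_def[of x "foldr seq_inc xs G"])
    then show "foldr seq_inc (x # xs) G m = (-1) ^ length (x # xs) * foldr seq_diff (x # xs) G m"
      unfolding Cons.IH by (simp add: seq_diff_def[of x "foldr seq_diff xs G"] algebra_simps)
  qed
qed simp

definition grid :: "nat \<Rightarrow> ('n::finite \<Rightarrow> nat) \<Rightarrow> real^'n" where
  "grid N m = (\<chi> i. real (m i) / real N)"

lemma grid_in_orthant: "grid N m \<in> closed_orthant"
  by (simp add: grid_def closed_orthant_def)

lemma foldr_seq_diff_grid:
  "foldr seq_diff xs (\<lambda>m. f (grid N m)) m = decs (map (\<lambda>i. (i, 1 / real N)) xs) f (grid N m)"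
proof (induction xs arbitrary: m)
  case (Cons x xs)
  have g: "grid N (m(x := Suc (m x))) = grid N m + (1 / real N) *\<^sub>R axis x 1"
    by (simp add: vec_eq_iff grid_def axis_def add_divide_distrib)
  have "foldr seq_diff (x # xs) (\<lambda>m. f (grid N m)) m =
     foldr seq_diff xs (\<lambda>m. f (grid N m)) m - foldr seq_diff xs (\<lambda>m. f (grid N m)) (m(x := Suc (m x)))"
    by (simp add: seq_diff_def[of x "foldr seq_diff xs _"])
  also have "\<dots> = decs (map (\<lambda>i. (i, 1 / real N)) (x # xs)) f (grid N m)"
    unfolding Cons.IH g by (simp add: decs_Cons dec_def)
  finally show ?case .
qed simp

text \<open>Up to the sign, the increments of \<open>g\<close> on the grid and their differences are iterated differences
  with step \<open>1/N\<close>, hence nonnegative.\<close>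

lemma grid_representation:
  fixes g :: "real^'n::finite \<Rightarrow> real"
  assumes bd: "\<And>t. t \<in> closed_orthant \<Longrightarrow> \<exists>i. t $ i = 0 \<Longrightarrow> g t = 0"
    and alt: "alternating_differences (\<lambda>t. (-1) ^ CARD('n) * g t)" and N: "N > 0"
  shows "\<exists>\<rho> :: (real^'n) measure. sets \<rho> = sets borel \<and> finite_measure \<rho> \<and> (AE s in \<rho>. s \<in> unit_cube) \<and>
    (\<forall>m. g (grid N m) = (\<integral>s. (\<Prod>i\<in>UNIV. geo (m i) (s $ i)) \<partial>\<rho>))"
proof -
  obtain xs :: "'n list" where xs: "distinct xs" "set xs = UNIV"
    using finite_distinct_list[OF finite_class.finite_UNIV] by blast
  have len: "length xs = CARD('n)" using xs by (metis distinct_card)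
  let ?G = "\<lambda>m. g (grid N m)"
  show ?thesis
  proof (rule geo_representation[OF _ xs])
    show "g (grid N m) = 0" if "m i = 0" for m :: "'n \<Rightarrow> nat" and i
      using that by (intro bd grid_in_orthant) (auto simp: grid_def intro!: exI[of _ i])
    show "cm_sequence (foldr seq_inc xs ?G)"
      unfolding cm_sequence_def
    proof (intro allI)
      fix js and m :: "'n \<Rightarrow> nat"
      let ?L = "\<lambda>xs. map (\<lambda>i. (i, 1 / real N)) xs"
      have "foldr seq_inc xs ?G = foldr seq_diff xs (\<lambda>m. (-1) ^ CARD('n) * ?G m)"
        unfolding foldr_seq_inc_eq foldr_seq_diff_scale len ..
      then have "foldr seq_diff js (foldr seq_inc xs ?G) m = foldr seq_diff (js @ xs) (\<lambda>m. (-1) ^ CARD('n) * ?G m) m"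
        by simp
      also have "\<dots> = foldr seq_diff (xs @ js) (\<lambda>m. (-1) ^ CARD('n) * ?G m) m"
        by (rule arg_cong[where f = "\<lambda>F. F m"]) (rule foldr_commute, rule seq_diff_commute)
      also have "\<dots> = decs (?L xs @ ?L js) (\<lambda>t. (-1) ^ CARD('n) * g t) (grid N m)"
        using foldr_seq_diff_grid[of "xs @ js" "\<lambda>t. (-1) ^ CARD('n) * g t" N m] by simp
      also have "\<dots> \<ge> 0"
      proof -
        have "distinct (map fst (?L xs)) \<and> set (map fst (?L xs)) = UNIV \<and> (\<forall>(i, h)\<in>set (?L xs @ ?L js). 0 < h)"
          using xs N by (auto simp: comp_def)
        then show ?thesis using alt grid_in_orthant[of N m] unfolding alternating_differences_def by blast
      qed
      finally show "0 \<le> foldr seq_diff js (foldr seq_inc xs ?G) m" .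
    qed
  qed
qed

text \<open>The kernel \<open>(1 - s\<^sup>t) / (1 - s)\<close>, which is \<open>geo t s\<close> for integer \<open>t\<close>.  The case
  \<open>t = 0\<close> is set apart because \<open>0 powr 0 = 0\<close>.\<close>

definition geo_real :: "real \<Rightarrow> real \<Rightarrow> real" where
  "geo_real t s = (if s = 1 then t else if t = 0 then 0 else (1 - s powr t) / (1 - s))"

lemma geo_eq: "s \<noteq> 1 \<Longrightarrow> geo m s = (1 - s ^ m) / (1 - s)"
  by (simp add: geo_def sum_gp_strict)

lemma geo_one: "geo m 1 = real m" by (simp add: geo_def)

lemma geo_real_nonneg:
  assumes "0 \<le> s" "s \<le> 1" "0 \<le> t" shows "0 \<le> geo_real t s"
  using assms by (auto simp: geo_real_def powr_le1)

lemma geo_bounds: assumes "0 \<le> s" "s \<le> 1" shows "0 \<le> geo m s" "geo m s \<le> real m"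
proof -
  show "0 \<le> geo m s" unfolding geo_def using assms by (intro sum_nonneg) auto
  have "geo m s \<le> (\<Sum>l<m. 1)" unfolding geo_def using assms by (intro sum_mono power_le_one)
  then show "geo m s \<le> real m" by simp
qed

lemma geo_real_le:
  assumes s: "0 \<le> s" "s \<le> 1" and t: "0 \<le> t" "t \<le> real m" "0 < m"
  shows "geo_real t s \<le> real m"
proof (cases "s = 1 \<or> t = 0")
  case True
  then show ?thesis using t by (auto simp: geo_real_def)
next
  case False
  have "s ^ m \<le> s powr t"
  proof (cases "s = 0")
    case False
    then have "s powr real m \<le> s powr t" using s t by (intro powr_mono') auto
    then show ?thesis using False s by (simp add: powr_realpow)
  qed (use t in \<open>simp add: zero_power\<close>)
  then have "geo_real t s \<le> geo m s"
    using False s by (simp add: geo_real_def geo_eq divide_right_mono)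
  then show ?thesis using geo_bounds(2)[OF s, of m] by linarith
qed

lemma geo_real_power:
  assumes s: "0 \<le> s" "s \<le> 1" and N: "N > 0"
  shows "geo_real (real m / real N) (s ^ N) * geo N s = geo m s"
proof (cases "s = 1")
  case True
  then show ?thesis using N by (simp add: geo_real_def geo_one)
next
  case False
  then have "s < 1" using s by simp
  then have sN: "s ^ N < 1" using s N by (simp add: power_less_one_iff)
  show ?thesis
  proof (cases "m = 0")
    case True
    then show ?thesis using sN by (simp add: geo_real_def geo_def)
  next
    case m: False
    have "(s ^ N) powr (real m / real N) = s ^ m"
    proof (cases "s = 0")
      case True
      then show ?thesis using m N by (simp add: zero_power)
    next
      case False
      then have "s > 0" using s by simp
      then show ?thesis using N by (simp add: powr_realpow[symmetric] powr_powr)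
    qed
    then show ?thesis using sN m N False by (simp add: geo_real_def geo_eq)
  qed
qed

lemma geo_real_tendsto:
  assumes "0 \<le> s" "s \<le> 1" "0 < t" "(T \<longlongrightarrow> t) F"
  shows "((\<lambda>k. geo_real (T k) s) \<longlongrightarrow> geo_real t s) F"
proof (cases "s = 1")
  case True
  then show ?thesis using assms by (simp add: geo_real_def)
next
  case False
  have "eventually (\<lambda>k. 0 < T k) F" using assms(3,4) by (rule order_tendstoD(1)[rotated])
  then have ev: "eventually (\<lambda>k. (1 - s powr T k) / (1 - s) = geo_real (T k) s) F"
    by eventually_elim (use False in \<open>simp add: geo_real_def\<close>)
  have "((\<lambda>k. s powr T k) \<longlongrightarrow> s powr t) F"
  proof (cases "s = 0")
    case False
    then show ?thesis by (intro tendsto_powr assms(4) tendsto_const)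
  qed simp
  then have "((\<lambda>k. (1 - s powr T k) / (1 - s)) \<longlongrightarrow> (1 - s powr t) / (1 - s)) F"
    using False by (intro tendsto_divide tendsto_diff tendsto_const) auto
  then show ?thesis using ev False assms(3) by (simp add: geo_real_def[of t] tendsto_cong)
qed

lemma geo_real_one: "0 \<le> s \<Longrightarrow> s \<le> 1 \<Longrightarrow> geo_real 1 s = 1"
  by (simp add: geo_real_def)

lemma geo_real_small_tendsto:
  assumes "0 \<le> s" "s \<le> 1"
  shows "(\<lambda>k. geo_real (1 / real (Suc k)) s) \<longlonglongrightarrow> (if s = 0 then 1 else 0)"
proof (cases "s = 0 \<or> s = 1")
  case True
  then show ?thesis using LIMSEQ_inverse_real_of_nat by (auto simp: geo_real_def inverse_eq_divide)
next
  case False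
  have "(\<lambda>k. 1 / real (Suc k)) \<longlonglongrightarrow> 0"
    using LIMSEQ_inverse_real_of_nat by (simp add: inverse_eq_divide)
  then have "(\<lambda>k. s powr (1 / real (Suc k))) \<longlonglongrightarrow> s powr 0"
    using False by (intro tendsto_powr tendsto_const) auto
  then have "(\<lambda>k. (1 - s powr (1 / real (Suc k))) / (1 - s)) \<longlonglongrightarrow> (1 - s powr 0) / (1 - s)"
    using False by (intro tendsto_divide tendsto_diff tendsto_const) auto
  then show ?thesis using False by (simp add: geo_real_def)
qed

lemma geo_real_measurable [measurable]: "geo_real t \<in> borel_measurable borel"
  unfolding geo_real_def by measurable

lemma prod_geo_real_integrable:
  fixes \<rho> :: "(real^'n::finite) measure"
  assumes "finite_measure \<rho>" "sets \<rho> = sets borel" "AE s in \<rho>. s \<in> unit_cube" "\<And>i. 0 \<le> t i"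
  shows "integrable \<rho> (\<lambda>s. \<Prod>i\<in>UNIV. geo_real (t i) (s $ i))"
proof (rule integrable_on_cube[OF assms(1-3)])
  show "(\<lambda>s. \<Prod>i\<in>UNIV. geo_real (t i) (s $ i)) \<in> borel_measurable borel" by measurable
  fix s :: "real^'n" assume s: "s \<in> unit_cube"
  have *: "0 \<le> geo_real (t i) (s $ i) \<and> geo_real (t i) (s $ i) \<le> real (Suc (nat \<lceil>t i\<rceil>))" for i
    using s assms(4)[of i] by (intro conjI geo_real_nonneg geo_real_le) (auto simp: unit_cube_def, linarith)
  then have "\<bar>\<Prod>i\<in>UNIV. geo_real (t i) (s $ i)\<bar> = (\<Prod>i\<in>UNIV. geo_real (t i) (s $ i))"
    by (simp add: prod_nonneg)
  also have "\<dots> \<le> (\<Prod>i\<in>UNIV. real (Suc (nat \<lceil>t i\<rceil>)))" using * by (intro prod_mono) blast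
  finally show "\<bar>\<Prod>i\<in>UNIV. geo_real (t i) (s $ i)\<bar> \<le> (\<Prod>i\<in>UNIV. real (Suc (nat \<lceil>t i\<rceil>)))" .
qed

section \<open>From grids to the orthant\<close>

lemma power_map_measurable: "(\<lambda>s::real^'n::finite. \<chi> i. (s $ i) ^ N) \<in> borel_measurable borel"
  by (intro borel_measurable_continuous_onI continuous_intros continuous_on_vec_lambda)

lemma geo_measurable [measurable]: "geo m \<in> borel_measurable borel"
  unfolding geo_def by measurable

text \<open>The measures of all grids are compatible: the image of the measure of the finer grid under
  \<open>s \<mapsto> s\<^sup>N\<close>, weighted by \<open>\<Prod>\<^sub>i geo N s\<^sub>i\<close>, represents the coarse values, hence is the
  measure of the coarse grid, by uniqueness.\<close>

lemma grid_refinement: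
  fixes \<rho> \<rho>' :: "(real^'n::finite) measure"
  assumes \<rho>: "sets \<rho> = sets borel" "finite_measure \<rho>" "AE s in \<rho>. s \<in> unit_cube"
    and g1: "\<And>m. g (grid 1 m) = (\<integral>s. (\<Prod>i\<in>UNIV. geo (m i) (s $ i)) \<partial>\<rho>)"
    and \<rho>': "sets \<rho>' = sets borel" "finite_measure \<rho>'" "AE s in \<rho>'. s \<in> unit_cube"
    and gN: "\<And>m. g (grid N m) = (\<integral>s. (\<Prod>i\<in>UNIV. geo (m i) (s $ i)) \<partial>\<rho>')" and N: "N > 0"
  shows "g (grid N m) = (\<integral>s. (\<Prod>i\<in>UNIV. geo_real (real (m i) / real N) (s $ i)) \<partial>\<rho>)"
proof -
  define w where "w s = (\<Prod>i\<in>UNIV. geo N (s $ i))" for s :: "real^'n"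
  define p where "p s = (\<chi> i. (s $ i) ^ N)" for s :: "real^'n"
  have wm: "w \<in> borel_measurable borel" unfolding w_def by measurable
  have pm: "p \<in> borel_measurable borel" unfolding p_def by (rule power_map_measurable)
  have wm': "w \<in> borel_measurable \<rho>'" using wm measurable_cong_sets[OF \<rho>'(1) refl] by blast
  have pm': "p \<in> borel_measurable \<rho>'" using pm measurable_cong_sets[OF \<rho>'(1) refl] by blast
  have w0: "AE s in \<rho>'. 0 \<le> w s" using \<rho>'(3)
    by eventually_elim (auto simp: w_def unit_cube_def intro!: prod_nonneg geo_bounds)
  define D where "D = density \<rho>' (\<lambda>s. ennreal (w s))"
  have pD: "p \<in> borel_measurable D" using pm' by (simp add: D_def)
  define \<sigma> where "\<sigma> = distr D borel p"
  have w_int: "integrable \<rho>' w"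
    unfolding w_def by (rule geo_integrable[OF \<rho>'(2,1,3)])
  have D_fin: "finite_measure D"
  proof (rule finite_measureI)
    have "emeasure D (space D) = (\<integral>\<^sup>+ s. ennreal (w s) \<partial>\<rho>')"
      unfolding D_def using wm' by (subst emeasure_density) (auto intro!: nn_integral_cong)
    also have "\<dots> = ennreal (\<integral>s. w s \<partial>\<rho>')" using w_int w0 by (rule nn_integral_eq_integral)
    finally show "emeasure D (space D) \<noteq> \<infinity>" by simp
  qed
  interpret D: finite_measure D by fact
  have \<sigma>_fin: "finite_measure \<sigma>" unfolding \<sigma>_def by (rule D.finite_measure_distr[OF pD])
  have \<sigma>_sets: "sets \<sigma> = sets borel" by (simp add: \<sigma>_def)
  have \<sigma>_cube: "AE s in \<sigma>. s \<in> unit_cube"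
  proof -
    have "AE s in D. p s \<in> unit_cube"
      unfolding D_def using wm' \<rho>'(3)
      by (subst AE_density) (auto simp: unit_cube_def p_def intro!: power_le_one elim!: eventually_mono)
    then show ?thesis unfolding \<sigma>_def by (subst AE_distr_iff[OF pD]) auto
  qed
  have \<sigma>_int: "(\<integral>s. f s \<partial>\<sigma>) = (\<integral>s. w s * f (p s) \<partial>\<rho>')" if f: "f \<in> borel_measurable borel" for f :: "real^'n \<Rightarrow> real"
  proof -
    have "(\<integral>s. f s \<partial>\<sigma>) = (\<integral>s. f (p s) \<partial>D)" unfolding \<sigma>_def by (rule integral_distr[OF pD f])
    also have "\<dots> = (\<integral>s. w s *\<^sub>R f (p s) \<partial>\<rho>')"
      unfolding D_def by (rule integral_density[OF measurable_compose[OF pm' f] wm' w0])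
    finally show ?thesis by simp
  qed
  have kernel: "AE s in \<rho>'. w s * (\<Prod>i\<in>UNIV. geo_real (real (m i) / real N) (p s $ i)) = (\<Prod>i\<in>UNIV. geo (m i) (s $ i))"
    for m :: "'n \<Rightarrow> nat"
    using \<rho>'(3)
  proof eventually_elim
    fix s :: "real^'n" assume "s \<in> unit_cube"
    then have "geo_real (real (m i) / real N) ((s $ i) ^ N) * geo N (s $ i) = geo (m i) (s $ i)" for i
      by (intro geo_real_power N) (auto simp: unit_cube_def)
    then show "w s * (\<Prod>i\<in>UNIV. geo_real (real (m i) / real N) (p s $ i)) = (\<Prod>i\<in>UNIV. geo (m i) (s $ i))"
      by (simp add: w_def p_def prod.distrib[symmetric] mult.commute)
  qed
  have repr: "(\<integral>s. (\<Prod>i\<in>UNIV. geo_real (real (m i) / real N) (s $ i)) \<partial>\<sigma>) = g (grid N m)" for m :: "'n \<Rightarrow> nat"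
  proof -
    have meas: "(\<lambda>s::real^'n. \<Prod>i\<in>UNIV. geo_real (real (m i) / real N) (s $ i)) \<in> borel_measurable borel" by measurable
    have "(\<integral>s. (\<Prod>i\<in>UNIV. geo_real (real (m i) / real N) (s $ i)) \<partial>\<sigma>) =
      (\<integral>s. w s * (\<Prod>i\<in>UNIV. geo_real (real (m i) / real N) (p s $ i)) \<partial>\<rho>')"
      by (rule \<sigma>_int[OF meas])
    also have "\<dots> = (\<integral>s. (\<Prod>i\<in>UNIV. geo (m i) (s $ i)) \<partial>\<rho>')"
    proof (rule integral_cong_AE[OF _ _ kernel])
      have "(\<lambda>s. \<Prod>i\<in>UNIV. geo_real (real (m i) / real N) (p s $ i)) \<in> borel_measurable \<rho>'"
        using measurable_compose[OF pm' meas] .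
      then show "(\<lambda>s. w s * (\<Prod>i\<in>UNIV. geo_real (real (m i) / real N) (p s $ i))) \<in> borel_measurable \<rho>'"
        using wm' by simp
      show "(\<lambda>s. \<Prod>i\<in>UNIV. geo (m i) (s $ i)) \<in> borel_measurable \<rho>'"
        by (rule borel_measurable_integrable[OF geo_integrable[OF \<rho>'(2,1,3)]])
    qed
    also have "\<dots> = g (grid N m)" by (rule gN[symmetric])
    finally show ?thesis .
  qed
  have "\<sigma> = \<rho>"
  proof (rule geo_integrals_determine_measure[OF \<sigma>_fin \<sigma>_sets \<sigma>_cube \<rho>(2,1,3)])
    fix m :: "'n \<Rightarrow> nat"
    have "AE s in \<sigma>. (\<Prod>i\<in>UNIV. geo (m i) (s $ i)) = (\<Prod>i\<in>UNIV. geo_real (real (N * m i) / real N) (s $ i))"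
      using \<sigma>_cube
    proof eventually_elim
      fix s :: "real^'n" assume "s \<in> unit_cube"
      then have "geo_real (real (m i) / real 1) ((s $ i) ^ 1) * geo 1 (s $ i) = geo (m i) (s $ i)" for i
        by (intro geo_real_power) (auto simp: unit_cube_def)
      then have "geo_real (real (N * m i) / real N) (s $ i) = geo (m i) (s $ i)" for i
        using N by (simp add: geo_def[of "Suc 0"])
      then show "(\<Prod>i\<in>UNIV. geo (m i) (s $ i)) = (\<Prod>i\<in>UNIV. geo_real (real (N * m i) / real N) (s $ i))"
        by simp
    qed
    then have "(\<integral>s. (\<Prod>i\<in>UNIV. geo (m i) (s $ i)) \<partial>\<sigma>) = (\<integral>s. (\<Prod>i\<in>UNIV. geo_real (real (N * m i) / real N) (s $ i)) \<partial>\<sigma>)"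
      by (intro integral_cong_AE borel_measurable_integrable[OF geo_integrable[OF \<sigma>_fin \<sigma>_sets \<sigma>_cube]]
          borel_measurable_integrable[OF prod_geo_real_integrable[OF \<sigma>_fin \<sigma>_sets \<sigma>_cube]]) auto
    also have "\<dots> = g (grid N (\<lambda>i. N * m i))" by (rule repr)
    also have "grid N (\<lambda>i. N * m i) = grid 1 m" using N by (simp add: grid_def)
    also have "g (grid 1 m) = (\<integral>s. (\<Prod>i\<in>UNIV. geo (m i) (s $ i)) \<partial>\<rho>)" by (rule g1)
    finally show "(\<integral>s. (\<Prod>i\<in>UNIV. geo (m i) (s $ i)) \<partial>\<sigma>) = (\<integral>s. (\<Prod>i\<in>UNIV. geo (m i) (s $ i)) \<partial>\<rho>)" .
  qed
  then show ?thesis using repr[of m] by simp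
qed

text \<open>The measure of the integer grid represents \<open>g\<close> on all grids, hence everywhere by continuity.\<close>

lemma cube_representation:
  fixes g :: "real^'n::finite \<Rightarrow> real"
  assumes cont: "continuous_on closed_orthant g"
    and bd: "\<And>t. t \<in> closed_orthant \<Longrightarrow> \<exists>i. t $ i = 0 \<Longrightarrow> g t = 0"
    and alt: "alternating_differences (\<lambda>t. (-1) ^ CARD('n) * g t)"
  shows "\<exists>\<rho> :: (real^'n) measure. sets \<rho> = sets borel \<and> finite_measure \<rho> \<and>
    (AE s in \<rho>. \<forall>i. 0 < s $ i \<and> s $ i \<le> 1) \<and>
    (\<forall>t\<in>closed_orthant. g t = (\<integral>s. (\<Prod>i\<in>UNIV. geo_real (t $ i) (s $ i)) \<partial>\<rho>))"
proof -
  from grid_representation[OF bd alt zero_less_one] obtain \<rho> :: "(real^'n) measure" where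
    "sets \<rho> = sets borel \<and> finite_measure \<rho> \<and> (AE s in \<rho>. s \<in> unit_cube) \<and>
    (\<forall>m. g (grid 1 m) = (\<integral>s. (\<Prod>i\<in>UNIV. geo (m i) (s $ i)) \<partial>\<rho>))" by auto
  then have \<rho>: "sets \<rho> = sets borel" "finite_measure \<rho>" "AE s in \<rho>. s \<in> unit_cube"
    and g1: "\<And>m. g (grid 1 m) = (\<integral>s. (\<Prod>i\<in>UNIV. geo (m i) (s $ i)) \<partial>\<rho>)" by blast+
  interpret finite_measure \<rho> by fact
  have gridN: "g (grid N m) = (\<integral>s. (\<Prod>i\<in>UNIV. geo_real (real (m i) / real N) (s $ i)) \<partial>\<rho>)" if N: "N > 0" for N m
  proof -
    from grid_representation[OF bd alt N] obtain \<rho>' :: "(real^'n) measure" where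
      "sets \<rho>' = sets borel \<and> finite_measure \<rho>' \<and> (AE s in \<rho>'. s \<in> unit_cube) \<and>
      (\<forall>m. g (grid N m) = (\<integral>s. (\<Prod>i\<in>UNIV. geo (m i) (s $ i)) \<partial>\<rho>'))" by auto
    then have \<rho>': "sets \<rho>' = sets borel" "finite_measure \<rho>'" "AE s in \<rho>'. s \<in> unit_cube"
      and gN: "\<And>m. g (grid N m) = (\<integral>s. (\<Prod>i\<in>UNIV. geo (m i) (s $ i)) \<partial>\<rho>')" by blast+
    show ?thesis by (rule grid_refinement[OF \<rho> g1 \<rho>' gN N])
  qed
  have meas: "(\<lambda>s. \<Prod>i\<in>UNIV. geo_real (T i) (s $ i)) \<in> borel_measurable \<rho>" for T :: "'n \<Rightarrow> real"
  proof -
    have "(\<lambda>s::real^'n. \<Prod>i\<in>UNIV. geo_real (T i) (s $ i)) \<in> borel_measurable borel" by measurable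
    then show ?thesis using measurable_cong_sets[OF \<rho>(1) refl] by blast
  qed
  have repr: "g t = (\<integral>s. (\<Prod>i\<in>UNIV. geo_real (t $ i) (s $ i)) \<partial>\<rho>)" if t: "t \<in> closed_orthant" for t
  proof (cases "\<exists>i. t $ i = 0")
    case True
    then obtain i where "t $ i = 0" by blast
    then have zero: "(\<Prod>i\<in>UNIV. geo_real (t $ i) (s $ i)) = 0" for s :: "real^'n"
      by (intro prod_zero bexI[of _ i]) (auto simp: geo_real_def)
    show ?thesis unfolding zero using bd[OF t True] by simp
  next
    case False
    have tpos: "t $ i > 0" for i
    proof -
      have "t $ i \<ge> 0" using t by (simp add: closed_orthant_def)
      moreover have "t $ i \<noteq> 0" using False by blast
      ultimately show ?thesis by simp
    qed
    (* Rounding up keeps the approximating grid points off the boundary. *)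
    define m where "m N i = nat \<lceil>t $ i * real (Suc N)\<rceil>" for N i
    define T where "T N i = real (m N i) / real (Suc N)" for N i
    have mreal: "real (m N i) = of_int \<lceil>t $ i * real (Suc N)\<rceil>" for N i
    proof -
      have "0 < t $ i * real (Suc N)" using tpos[of i] by (intro mult_pos_pos) simp_all
      then have "-1 < t $ i * real (Suc N)" by linarith
      then show ?thesis unfolding m_def by (intro of_nat_nat) (simp only: zero_le_ceiling)
    qed
    have lower: "t $ i \<le> T N i" for N i
    proof -
      have "t $ i * real (Suc N) \<le> real (m N i)" unfolding mreal by (rule le_of_int_ceiling)
      then show ?thesis unfolding T_def by (subst pos_le_divide_eq) auto
    qed
    have upper: "T N i \<le> t $ i + 1 / real (Suc N)" for N i
    proof -
      have "real (m N i) \<le> t $ i * real (Suc N) + 1" unfolding mreal by (rule of_int_ceiling_le_add_one)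
      then have "T N i \<le> (t $ i * real (Suc N) + 1) / real (Suc N)" unfolding T_def by (rule divide_right_mono) simp
      also have "\<dots> = t $ i + 1 / real (Suc N)" by (simp add: add_divide_distrib)
      finally show ?thesis .
    qed
    have Tlim: "(\<lambda>N. T N i) \<longlonglongrightarrow> t $ i" for i
    proof (rule tendsto_sandwich[of "\<lambda>_. t $ i" _ _ "\<lambda>N. t $ i + 1 / real (Suc N)"])
      have "(\<lambda>N. 1 / real (Suc N)) \<longlonglongrightarrow> 0"
        using LIMSEQ_inverse_real_of_nat by (simp add: inverse_eq_divide)
      from tendsto_add[OF tendsto_const this] show "(\<lambda>N. t $ i + 1 / real (Suc N)) \<longlonglongrightarrow> t $ i" by simp
      show "\<forall>\<^sub>F N in sequentially. t $ i \<le> T N i" by (rule always_eventually[OF allI]) (rule lower)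
      show "\<forall>\<^sub>F N in sequentially. T N i \<le> t $ i + 1 / real (Suc N)" by (rule always_eventually[OF allI]) (rule upper)
    qed (rule tendsto_const)
    have gridT: "grid (Suc N) (m N) = (\<chi> i. T N i)" for N by (simp add: grid_def T_def)
    have "(\<lambda>N. grid (Suc N) (m N)) \<longlonglongrightarrow> t"
      unfolding gridT using Tlim by (intro vec_tendstoI) simp
    then have left: "(\<lambda>N. g (grid (Suc N) (m N))) \<longlonglongrightarrow> g t"
      by (rule continuous_on_tendsto_compose[OF cont _ t]) (rule always_eventually[OF allI], rule grid_in_orthant)
    define B where "B = (\<Prod>i\<in>(UNIV::'n set). real (Suc (nat \<lceil>t $ i + 1\<rceil>)))"
    have "(\<lambda>N. \<integral>s. (\<Prod>i\<in>UNIV. geo_real (T N i) (s $ i)) \<partial>\<rho>) \<longlonglongrightarrow> (\<integral>s. (\<Prod>i\<in>UNIV. geo_real (t $ i) (s $ i)) \<partial>\<rho>)"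
    proof (rule integral_dominated_convergence[where w = "\<lambda>_. B"])
      show "AE s in \<rho>. (\<lambda>N. \<Prod>i\<in>UNIV. geo_real (T N i) (s $ i)) \<longlonglongrightarrow> (\<Prod>i\<in>UNIV. geo_real (t $ i) (s $ i))"
        using \<rho>(3)
      proof eventually_elim
        fix s :: "real^'n" assume "s \<in> unit_cube"
        then have "0 \<le> s $ i" "s $ i \<le> 1" for i by (auto simp: unit_cube_def)
        then show "(\<lambda>N. \<Prod>i\<in>UNIV. geo_real (T N i) (s $ i)) \<longlonglongrightarrow> (\<Prod>i\<in>UNIV. geo_real (t $ i) (s $ i))"
          by (intro tendsto_prod geo_real_tendsto tpos Tlim)
      qed
      show "AE s in \<rho>. norm (\<Prod>i\<in>UNIV. geo_real (T N i) (s $ i)) \<le> B" for N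
        using \<rho>(3)
      proof eventually_elim
        fix s :: "real^'n" assume "s \<in> unit_cube"
        then have s: "0 \<le> s $ i" "s $ i \<le> 1" for i by (auto simp: unit_cube_def)
        have T0: "0 \<le> T N i" for i by (simp add: T_def)
        have T1: "T N i \<le> real (Suc (nat \<lceil>t $ i + 1\<rceil>))" for i
        proof -
          have "1 / real (Suc N) \<le> 1" by simp
          then have "T N i \<le> t $ i + 1" using upper[of N i] by linarith
          also have "\<dots> \<le> real (nat \<lceil>t $ i + 1\<rceil>)" by (rule real_nat_ceiling_ge)
          finally show ?thesis by simp
        qed
        have *: "0 \<le> geo_real (T N i) (s $ i)" "geo_real (T N i) (s $ i) \<le> real (Suc (nat \<lceil>t $ i + 1\<rceil>))" for i
          by (rule geo_real_nonneg[OF s T0], rule geo_real_le[OF s T0 T1]) simp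
        have "norm (\<Prod>i\<in>UNIV. geo_real (T N i) (s $ i)) = (\<Prod>i\<in>UNIV. geo_real (T N i) (s $ i))"
          unfolding real_norm_def by (intro abs_of_nonneg prod_nonneg *(1))
        also have "\<dots> \<le> B" unfolding B_def using * by (intro prod_mono conjI)
        finally show "norm (\<Prod>i\<in>UNIV. geo_real (T N i) (s $ i)) \<le> B" .
      qed
    qed (use meas in auto)
    then have "(\<lambda>N. g (grid (Suc N) (m N))) \<longlonglongrightarrow> (\<integral>s. (\<Prod>i\<in>UNIV. geo_real (t $ i) (s $ i)) \<partial>\<rho>)"
      by (simp only: gridN[OF zero_less_Suc] T_def)
    with left show ?thesis by (rule LIMSEQ_unique)
  qed
  (* The continuity of g at the boundary excludes mass at s_i = 0: for t_i = 1/(k+1) and all other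
     coordinates 1 the kernel tends to the indicator of s_i = 0. *)
  have nomass: "AE s in \<rho>. s $ i \<noteq> 0" for i
  proof -
    define T where "T k j = (if j = i then 1 / real (Suc k) else 1)" for k j
    have T0: "0 \<le> T k j" "T k j \<le> 1" for k j by (auto simp: T_def)
    define t0 :: "real^'n" where "t0 = (\<chi> j. if j = i then 0 else 1)"
    have t0: "t0 \<in> closed_orthant" by (simp add: t0_def closed_orthant_def)
    have Tin: "(\<chi> j. T k j) \<in> closed_orthant" for k using T0 by (simp add: closed_orthant_def)
    have lim0: "(\<lambda>k. 1 / real (Suc k)) \<longlonglongrightarrow> 0"
      using LIMSEQ_inverse_real_of_nat by (simp add: inverse_eq_divide)
    have "(\<lambda>k. \<chi> j. T k j) \<longlonglongrightarrow> t0"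
    proof (rule vec_tendstoI)
      fix j show "(\<lambda>k. (\<chi> j. T k j) $ j) \<longlonglongrightarrow> t0 $ j"
        using lim0 by (cases "j = i") (simp_all add: T_def t0_def)
    qed
    then have "(\<lambda>k. g (\<chi> j. T k j)) \<longlonglongrightarrow> g t0"
      by (rule continuous_on_tendsto_compose[OF cont _ t0]) (rule always_eventually[OF allI], rule Tin)
    also have "g t0 = 0" by (rule bd[OF t0]) (auto simp: t0_def intro!: exI[of _ i])
    finally have left: "(\<lambda>k. g (\<chi> j. T k j)) \<longlonglongrightarrow> 0" .
    have ind: "indicator {s. s $ i = 0} s = (if s $ i = 0 then 1 else 0 :: real)" for s :: "real^'n" by simp
    have Z: "{s::real^'n. s $ i = 0} \<in> sets \<rho>"
    proof -
      have "closed {s::real^'n. s $ i = 0}" by (intro closed_Collect_eq continuous_intros)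
      then show ?thesis by (simp add: \<rho>(1))
    qed
    have "(\<lambda>k. \<integral>s. (\<Prod>j\<in>UNIV. geo_real (T k j) (s $ j)) \<partial>\<rho>) \<longlonglongrightarrow> (\<integral>s. indicator {s. s $ i = 0} s \<partial>\<rho>)"
    proof (rule integral_dominated_convergence[where w = "\<lambda>_. 1"])
      show "AE s in \<rho>. (\<lambda>k. \<Prod>j\<in>UNIV. geo_real (T k j) (s $ j)) \<longlonglongrightarrow> indicator {s. s $ i = 0} s"
        using \<rho>(3)
      proof eventually_elim
        fix s :: "real^'n" assume "s \<in> unit_cube"
        then have s: "0 \<le> s $ j" "s $ j \<le> 1" for j by (auto simp: unit_cube_def)
        have "(\<Prod>j\<in>UNIV. geo_real (T k j) (s $ j)) = geo_real (1 / real (Suc k)) (s $ i)" for k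
        proof -
          have "(\<Prod>j\<in>UNIV-{i}. geo_real (T k j) (s $ j)) = 1"
            by (intro prod.neutral ballI) (simp add: T_def geo_real_one s)
          then show ?thesis
            using prod.remove[OF finite_class.finite_UNIV UNIV_I, of "\<lambda>j. geo_real (T k j) (s $ j)" i]
            by (simp add: T_def)
        qed
        then show "(\<lambda>k. \<Prod>j\<in>UNIV. geo_real (T k j) (s $ j)) \<longlonglongrightarrow> indicator {s. s $ i = 0} s"
          using geo_real_small_tendsto[OF s, of i] by (simp only: ind)
      qed
      show "AE s in \<rho>. norm (\<Prod>j\<in>UNIV. geo_real (T k j) (s $ j)) \<le> 1" for k
        using \<rho>(3)
      proof eventually_elim
        fix s :: "real^'n" assume "s \<in> unit_cube"
        then have s: "0 \<le> s $ j" "s $ j \<le> 1" for j by (auto simp: unit_cube_def)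
        have *: "0 \<le> geo_real (T k j) (s $ j)" "geo_real (T k j) (s $ j) \<le> 1" for j
          using geo_real_nonneg[OF s T0(1)] geo_real_le[OF s T0(1), of k j 1 j] T0(2) by auto
        have "norm (\<Prod>j\<in>UNIV. geo_real (T k j) (s $ j)) = (\<Prod>j\<in>UNIV. geo_real (T k j) (s $ j))"
          unfolding real_norm_def by (intro abs_of_nonneg prod_nonneg *(1))
        also have "\<dots> \<le> 1" using * by (intro prod_le_1 conjI)
        finally show "norm (\<Prod>j\<in>UNIV. geo_real (T k j) (s $ j)) \<le> 1" .
      qed
    qed (use meas Z in auto)
    moreover have "(\<integral>s. (\<Prod>j\<in>UNIV. geo_real (T k j) (s $ j)) \<partial>\<rho>) = g (\<chi> j. T k j)" for k
      using repr[OF Tin[of k]] by simp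
    ultimately have "(\<integral>s. indicator {s. s $ i = 0} s \<partial>\<rho>) = (0 :: real)"
      using left by (simp add: LIMSEQ_unique)
    then have "measure \<rho> {s. s $ i = 0} = 0" using Z by simp
    then have "{s. s $ i = 0} \<in> null_sets \<rho>" using Z by (simp add: null_sets_def emeasure_eq_measure)
    then show ?thesis using AE_not_in[of "{s. s $ i = 0}" \<rho>] by simp
  qed
  have "AE s in \<rho>. \<forall>i. 0 < s $ i \<and> s $ i \<le> 1"
  proof -
    have "AE s in \<rho>. \<forall>i\<in>UNIV. s $ i \<noteq> 0" using nomass by (intro AE_finite_allI) auto
    with \<rho>(3) show ?thesis by eventually_elim (auto simp: unit_cube_def less_le)
  qed
  then show ?thesis using \<rho>(1,2) repr by (intro exI[of _ \<rho>] conjI ballI)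
qed

section \<open>The change of variables \<open>s = e\<^sup>-\<^sup>r\<close>\<close>

abbreviation (input) orthant_algebra :: "(real^'n::finite) measure" where
  "orthant_algebra \<equiv> restrict_space borel closed_orthant"

lemma bernstein_factor_one_bounds:
  assumes "0 \<le> r" shows "1 \<le> bernstein_factor r 1" "bernstein_factor r 1 \<le> 2"
proof -
  show "1 \<le> bernstein_factor r 1"
  proof (cases "r = 0")
    case False
    then have r: "r > 0" using assms by simp
    have "1 + r \<le> exp r" by (rule exp_ge_add_one_self)
    then have "(1 + r) * exp (-r) \<le> 1" by (simp add: exp_minus field_simps)
    then have "r \<le> (1 - exp (-r)) * (1 + r)" by (simp add: algebra_simps)
    then show ?thesis using r by (simp add: bernstein_factor_def le_divide_eq)
  qed (simp add: bernstein_factor_def)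
  show "bernstein_factor r 1 \<le> 2"
  proof (cases "r = 0")
    case False
    then have r: "r > 0" using assms by simp
    have "1 - exp (-r) \<le> r" using exp_ge_add_one_self[of "-r"] by simp
    moreover have "(1 - exp (-r)) * r \<le> 1 * r" using r by (intro mult_right_mono) auto
    ultimately have "(1 - exp (-r)) * (1 + r) \<le> 2 * r" by (simp add: algebra_simps)
    then show ?thesis using r by (simp add: bernstein_factor_def divide_le_eq)
  qed (simp add: bernstein_factor_def)
qed

lemma geo_real_exp:
  assumes "0 \<le> r" "0 \<le> t"
  shows "geo_real t (exp (-r)) * bernstein_factor r 1 = bernstein_factor r t"
proof (cases "r = 0")
  case False
  then have r: "r > 0" using assms by simp
  then have e: "exp (-r) < 1" by simp
  show ?thesis
  proof (cases "t = 0")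
    case False
    have "exp (-r) powr t = exp (-r * t)" by (simp add: powr_def mult.commute)
    then show ?thesis using False e r by (simp add: geo_real_def bernstein_factor_def)
  qed (use e r in \<open>simp add: geo_real_def bernstein_factor_def\<close>)
qed (simp add: geo_real_def bernstein_factor_def)

lemma geo_exp:
  assumes "0 \<le> r" shows "geo m (exp (-r)) * bernstein_factor r 1 = bernstein_factor r (real m)"
proof -
  have "geo_real (real m / real 1) (exp (-r) ^ 1) * geo 1 (exp (-r)) = geo m (exp (-r))"
    using assms by (intro geo_real_power) auto
  then have "geo_real (real m) (exp (-r)) = geo m (exp (-r))" by (simp add: geo_def[of "Suc 0"])
  then show ?thesis using geo_real_exp[OF assms, of "real m"] by simp
qed

definition exp_neg :: "real^'n::finite \<Rightarrow> real^'n" where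
  "exp_neg r = (\<chi> i. exp (- (r $ i)))"

text \<open>The value \<open>0\<close> outside of \<open>(0,1]\<close>, where the measures in question have no mass, keeps the image in
  the orthant.\<close>

definition neg_ln :: "real^'n::finite \<Rightarrow> real^'n" where
  "neg_ln s = (\<chi> i. if 0 < s $ i \<and> s $ i \<le> 1 then - ln (s $ i) else 0)"

definition weight :: "real^'n::finite \<Rightarrow> real" where
  "weight r = (\<Prod>i\<in>UNIV. bernstein_factor (r $ i) 1)"

text \<open>\<open>to_cube\<close> and \<open>from_cube\<close> exchange measures on the orthant and measures on the
  cube; the weight turns the kernel \<open>\<Prod>\<^sub>i (1 - e\<^bsup>-r_i t_i\<^esup>) (1 + r\<^sub>i) / r\<^sub>i\<close> into
  \<open>\<Prod>\<^sub>i (1 - s\<^sub>i\<^bsup>t_i\<^esup>) / (1 - s\<^sub>i)\<close> and is bounded away from \<open>0\<close> and \<open>\<infinity>\<close>.\<close>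

definition to_cube :: "(real^'n::finite) measure \<Rightarrow> (real^'n) measure" where
  "to_cube \<eta> = distr (density \<eta> (\<lambda>r. ennreal (weight r))) borel exp_neg"

definition from_cube :: "(real^'n::finite) measure \<Rightarrow> (real^'n) measure" where
  "from_cube \<rho> = density (distr \<rho> orthant_algebra neg_ln) (\<lambda>r. ennreal (1 / weight r))"

lemma exp_neg_measurable: "exp_neg \<in> borel_measurable borel"
  unfolding exp_neg_def
  by (intro borel_measurable_continuous_onI continuous_intros continuous_on_vec_lambda)

lemma weight_measurable: "weight \<in> borel_measurable borel"
  unfolding weight_def by (rule prod_bernstein_factor_measurable)

lemma neg_ln_measurable: "neg_ln \<in> measurable borel orthant_algebra"
proof (rule measurable_restrict_space2)
  show "neg_ln \<in> space borel \<rightarrow> closed_orthant" by (auto simp: neg_ln_def closed_orthant_def)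
  have "(\<lambda>s::real^'n. if 0 < s $ i \<and> s $ i \<le> 1 then - ln (s $ i) else 0) \<in> borel_measurable borel" for i
    by measurable
  then have comp: "(\<lambda>s::real^'n. neg_ln s \<bullet> axis i 1) \<in> borel_measurable borel" for i
    by (simp add: inner_axis neg_ln_def)
  show "neg_ln \<in> borel_measurable (borel :: (real^'n) measure)"
  proof (rule borel_measurable_euclidean_space[THEN iffD2], rule ballI)
    fix b :: "real^'n" assume "b \<in> Basis"
    then obtain i where "b = axis i 1" by (auto simp: Basis_vec_def)
    then show "(\<lambda>s. neg_ln s \<bullet> b) \<in> borel_measurable borel" using comp[of i] by simp
  qed
qed

lemma weight_bounds:
  fixes r :: "real^'n::finite"
  assumes "r \<in> closed_orthant" shows "1 \<le> weight r" "weight r \<le> 2 ^ CARD('n)"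
proof -
  have r: "0 \<le> r $ i" for i using assms by (simp add: closed_orthant_def)
  show "1 \<le> weight r" unfolding weight_def by (intro prod_ge_1 bernstein_factor_one_bounds r)
  have "0 \<le> bernstein_factor (r $ i) 1 \<and> bernstein_factor (r $ i) 1 \<le> 2" for i
    using bernstein_factor_one_bounds[OF r[of i]] by linarith
  then have "weight r \<le> (\<Prod>i\<in>(UNIV :: 'n set). 2)"
    unfolding weight_def by (intro prod_mono)
  then show "weight r \<le> 2 ^ CARD('n)" by simp
qed

lemma neg_ln_exp_neg: "r \<in> closed_orthant \<Longrightarrow> neg_ln (exp_neg r) = r"
  by (simp add: vec_eq_iff neg_ln_def exp_neg_def closed_orthant_def)

lemma
  fixes \<eta> :: "(real^'n::finite) measure"
  assumes \<eta>: "sets \<eta> = sets orthant_algebra" "finite_measure \<eta>"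
  shows space_orthant: "space \<eta> = closed_orthant"
    and finite_measure_to_cube: "finite_measure (to_cube \<eta>)"
    and AE_to_cube: "AE s in to_cube \<eta>. s \<in> unit_cube"
    and integral_to_cube: "\<And>h. h \<in> borel_measurable borel \<Longrightarrow>
      (\<integral>s. h s \<partial>to_cube \<eta>) = (\<integral>r. weight r * h (exp_neg r) \<partial>\<eta> :: real)"
    and from_cube_to_cube: "from_cube (to_cube \<eta>) = \<eta>"
proof -
  show sp: "space \<eta> = closed_orthant"
    using sets_eq_imp_space_eq[OF \<eta>(1)] by (simp add: space_restrict_space)
  interpret finite_measure \<eta> by fact
  let ?D = "density \<eta> (\<lambda>r. ennreal (weight r))"
  have wm: "weight \<in> borel_measurable \<eta>" using measurable_restrict_space1[OF weight_measurable] measurable_cong_sets[OF \<eta>(1) refl] by blast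
  have em: "exp_neg \<in> borel_measurable \<eta>" using measurable_restrict_space1[OF exp_neg_measurable] measurable_cong_sets[OF \<eta>(1) refl] by blast
  have emD: "exp_neg \<in> borel_measurable ?D" using em by simp
  have w1: "1 \<le> weight r" "weight r \<le> 2 ^ CARD('n)" if "r \<in> space \<eta>" for r
    using weight_bounds[of r] that sp by simp_all
  have w0: "AE r in \<eta>. 0 \<le> weight r"
  proof (rule AE_I2)
    fix r assume "r \<in> space \<eta>"
    from w1(1)[OF this] show "0 \<le> weight r" by linarith
  qed
  have "finite_measure ?D"
  proof (rule finite_measureI)
    have "emeasure ?D (space ?D) = (\<integral>\<^sup>+ r. ennreal (weight r) \<partial>\<eta>)"
      using wm by (subst emeasure_density) (auto intro!: nn_integral_cong)
    also have "\<dots> \<le> (\<integral>\<^sup>+ r. ennreal (2 ^ CARD('n)) \<partial>\<eta>)"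
      using w1(2) by (intro nn_integral_mono ennreal_leI)
    also have "\<dots> = ennreal (2 ^ CARD('n) * measure \<eta> (space \<eta>))"
      by (simp add: emeasure_eq_measure ennreal_mult'[symmetric])
    also have "\<dots> < \<infinity>" by simp
    finally show "emeasure ?D (space ?D) \<noteq> \<infinity>" by simp
  qed
  then show "finite_measure (to_cube \<eta>)"
    unfolding to_cube_def by (rule finite_measure.finite_measure_distr[OF _ emD])
  show "AE s in to_cube \<eta>. s \<in> unit_cube"
  proof -
    have "AE r in ?D. exp_neg r \<in> unit_cube"
      by (rule AE_I2) (simp add: sp exp_neg_def unit_cube_def closed_orthant_def)
    then show ?thesis unfolding to_cube_def by (subst AE_distr_iff[OF emD]) auto
  qed
  show "(\<integral>s. h s \<partial>to_cube \<eta>) = (\<integral>r. weight r * h (exp_neg r) \<partial>\<eta>)"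
    if h: "h \<in> borel_measurable borel" for h :: "real^'n \<Rightarrow> real"
  proof -
    have "(\<integral>s. h s \<partial>to_cube \<eta>) = (\<integral>r. h (exp_neg r) \<partial>?D)"
      unfolding to_cube_def by (rule integral_distr[OF emD h])
    also have "\<dots> = (\<integral>r. weight r *\<^sub>R h (exp_neg r) \<partial>\<eta>)"
      by (rule integral_density[OF measurable_compose[OF em h] wm w0])
    finally show ?thesis by simp
  qed
  show "from_cube (to_cube \<eta>) = \<eta>"
  proof (rule measure_eqI)
    show s: "sets (from_cube (to_cube \<eta>)) = sets \<eta>" by (simp add: from_cube_def \<eta>(1))
    fix A assume "A \<in> sets (from_cube (to_cube \<eta>))"
    then have A: "A \<in> sets \<eta>" "A \<in> sets orthant_algebra" using s \<eta>(1) by auto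
    have wR: "weight \<in> borel_measurable orthant_algebra" by (rule measurable_restrict_space1[OF weight_measurable])
    have wRe: "(\<lambda>r. ennreal (1 / weight r)) \<in> borel_measurable orthant_algebra"
      by (intro measurable_compose[OF _ measurable_ennreal] borel_measurable_divide borel_measurable_const wR)
    have Am: "(\<lambda>r. ennreal (1 / weight r) * indicator A r) \<in> borel_measurable orthant_algebra"
      by (intro borel_measurable_times_ennreal wRe borel_measurable_indicator A(2))
    have nm: "neg_ln \<in> measurable (to_cube \<eta>) orthant_algebra"
      using neg_ln_measurable by (simp add: to_cube_def)
    have "emeasure (from_cube (to_cube \<eta>)) A = (\<integral>\<^sup>+ r. ennreal (1 / weight r) * indicator A r \<partial>distr (to_cube \<eta>) orthant_algebra neg_ln)"
      unfolding from_cube_def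
    proof (rule emeasure_density)
      show "(\<lambda>r. ennreal (1 / weight r)) \<in> borel_measurable (distr (to_cube \<eta>) orthant_algebra neg_ln)"
        using wRe by simp
      show "A \<in> sets (distr (to_cube \<eta>) orthant_algebra neg_ln)" using A(2) by simp
    qed
    also have "\<dots> = (\<integral>\<^sup>+ s. ennreal (1 / weight (neg_ln s)) * indicator A (neg_ln s) \<partial>to_cube \<eta>)"
      by (rule nn_integral_distr[OF nm]) (use Am in simp)
    also have "\<dots> = (\<integral>\<^sup>+ r. ennreal (1 / weight (neg_ln (exp_neg r))) * indicator A (neg_ln (exp_neg r)) \<partial>?D)"
      unfolding to_cube_def
      by (rule nn_integral_distr[OF emD]) (use measurable_compose[OF neg_ln_measurable Am] in simp)
    also have "\<dots> = (\<integral>\<^sup>+ r. ennreal (weight r) * (ennreal (1 / weight (neg_ln (exp_neg r))) * indicator A (neg_ln (exp_neg r))) \<partial>\<eta>)"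
      by (rule nn_integral_density[OF measurable_compose[OF wm measurable_ennreal]
            measurable_compose[OF em measurable_compose[OF neg_ln_measurable Am]]])
    also have "\<dots> = (\<integral>\<^sup>+ r. indicator A r \<partial>\<eta>)"
    proof (rule nn_integral_cong)
      fix r assume r: "r \<in> space \<eta>"
      have "ennreal (weight r) * ennreal (1 / weight r) = 1"
        using w1(1)[OF r] by (subst ennreal_mult[symmetric]) auto
      then show "ennreal (weight r) * (ennreal (1 / weight (neg_ln (exp_neg r))) * indicator A (neg_ln (exp_neg r))) = indicator A r"
        using neg_ln_exp_neg[of r] r sp by (simp add: mult.assoc[symmetric])
    qed
    also have "\<dots> = emeasure \<eta> A" using A by simp
    finally show "emeasure (from_cube (to_cube \<eta>)) A = emeasure \<eta> A" .
  qed
qed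

text \<open>At integer points \<open>t = m\<close> the representation is the integral of geometric sums against
  \<open>to_cube \<eta>\<close>, which determines this measure, and \<open>from_cube\<close> recovers \<open>\<eta>\<close>.\<close>

theorem represents_unique:
  fixes g :: "real^'n::finite \<Rightarrow> real"
  assumes "represents \<eta> g" "represents \<eta>' g" shows "\<eta> = \<eta>'"
proof -
  have geo_int: "(\<integral>s. (\<Prod>i\<in>UNIV. geo (m i) (s $ i)) \<partial>to_cube \<eta>) = g (\<chi> i. real (m i))"
    if "represents \<eta> g" for \<eta> and m :: "'n \<Rightarrow> nat"
  proof -
    have \<eta>: "sets \<eta> = sets orthant_algebra" "finite_measure \<eta>"
      and rep: "\<forall>t\<in>closed_orthant. g t = (\<integral>r. (\<Prod>i\<in>UNIV. bernstein_factor (r $ i) (t $ i)) \<partial>\<eta>)"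
      using that by (auto simp: represents_def)
    have hm: "(\<lambda>s::real^'n. \<Prod>i\<in>UNIV. geo (m i) (s $ i)) \<in> borel_measurable borel" by measurable
    have "(\<integral>s. (\<Prod>i\<in>UNIV. geo (m i) (s $ i)) \<partial>to_cube \<eta>) = (\<integral>r. weight r * (\<Prod>i\<in>UNIV. geo (m i) (exp_neg r $ i)) \<partial>\<eta>)"
      by (rule integral_to_cube[OF \<eta> hm])
    also have "\<dots> = (\<integral>r. (\<Prod>i\<in>UNIV. bernstein_factor (r $ i) (real (m i))) \<partial>\<eta>)"
    proof (rule Bochner_Integration.integral_cong[OF refl])
      fix r assume "r \<in> space \<eta>"
      then have "0 \<le> r $ i" for i using space_orthant[OF \<eta>] by (simp add: closed_orthant_def)
      then have "geo (m i) (exp (- (r $ i))) * bernstein_factor (r $ i) 1 = bernstein_factor (r $ i) (real (m i))" for i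
        by (rule geo_exp)
      then show "weight r * (\<Prod>i\<in>UNIV. geo (m i) (exp_neg r $ i)) = (\<Prod>i\<in>UNIV. bernstein_factor (r $ i) (real (m i)))"
        by (simp add: weight_def exp_neg_def prod.distrib[symmetric] mult.commute)
    qed
    also have "\<dots> = g (\<chi> i. real (m i))"
      using rep by (simp add: closed_orthant_def)
    finally show ?thesis .
  qed
  have \<eta>: "sets \<eta> = sets orthant_algebra" "finite_measure \<eta>" "sets \<eta>' = sets orthant_algebra" "finite_measure \<eta>'"
    using assms by (auto simp: represents_def)
  have "to_cube \<eta> = to_cube \<eta>'"
  proof (rule geo_integrals_determine_measure)
    show "sets (to_cube \<eta>) = sets borel" "sets (to_cube \<eta>') = sets borel" by (simp_all add: to_cube_def)
    show "finite_measure (to_cube \<eta>)" "finite_measure (to_cube \<eta>')"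
      by (rule finite_measure_to_cube[OF \<eta>(1,2)], rule finite_measure_to_cube[OF \<eta>(3,4)])
    show "AE s in to_cube \<eta>. s \<in> unit_cube" "AE s in to_cube \<eta>'. s \<in> unit_cube"
      by (rule AE_to_cube[OF \<eta>(1,2)], rule AE_to_cube[OF \<eta>(3,4)])
    show "(\<integral>s. (\<Prod>i\<in>UNIV. geo (m i) (s $ i)) \<partial>to_cube \<eta>) = (\<integral>s. (\<Prod>i\<in>UNIV. geo (m i) (s $ i)) \<partial>to_cube \<eta>')" for m :: "'n \<Rightarrow> nat"
      by (simp only: geo_int[OF assms(1)] geo_int[OF assms(2)])
  qed
  then have "from_cube (to_cube \<eta>) = from_cube (to_cube \<eta>')" by simp
  then show ?thesis by (simp only: from_cube_to_cube[OF \<eta>(1,2)] from_cube_to_cube[OF \<eta>(3,4)])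
qed

theorem represents_if_alternating:
  fixes g :: "real^'n::finite \<Rightarrow> real"
  assumes cont: "continuous_on closed_orthant g"
    and bd: "\<And>t. t \<in> closed_orthant \<Longrightarrow> \<exists>i. t $ i = 0 \<Longrightarrow> g t = 0"
    and alt: "alternating_differences (\<lambda>t. (-1) ^ CARD('n) * g t)"
  shows "\<exists>\<eta>. represents \<eta> g"
proof -
  from cube_representation[OF cont bd alt] obtain \<rho> :: "(real^'n) measure" where
    *: "sets \<rho> = sets borel \<and> finite_measure \<rho> \<and>
    (AE s in \<rho>. \<forall>i. 0 < s $ i \<and> s $ i \<le> 1) \<and>
    (\<forall>t\<in>closed_orthant. g t = (\<integral>s. (\<Prod>i\<in>UNIV. geo_real (t $ i) (s $ i)) \<partial>\<rho>))" by auto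
  from * have \<rho>: "sets \<rho> = sets borel" and fin: "finite_measure \<rho>"
    and ae: "AE s in \<rho>. \<forall>i. 0 < s $ i \<and> s $ i \<le> 1"
    and rep: "\<forall>t\<in>closed_orthant. g t = (\<integral>s. (\<Prod>i\<in>UNIV. geo_real (t $ i) (s $ i)) \<partial>\<rho>)"
    by simp_all
  interpret finite_measure \<rho> by fact
  have nm: "neg_ln \<in> measurable \<rho> orthant_algebra"
    using neg_ln_measurable measurable_cong_sets[OF \<rho> refl] by blast
  let ?D = "distr \<rho> orthant_algebra neg_ln"
  have wR: "weight \<in> borel_measurable orthant_algebra" by (rule measurable_restrict_space1[OF weight_measurable])
  have wR': "(\<lambda>r. 1 / weight r) \<in> borel_measurable orthant_algebra"
    by (intro borel_measurable_divide borel_measurable_const wR)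
  have wD: "(\<lambda>r. 1 / weight r) \<in> borel_measurable ?D" using wR' by simp
  have spD: "space ?D = closed_orthant" by (simp add: space_restrict_space)
  have w1: "0 \<le> 1 / weight r \<and> 1 / weight r \<le> 1" if "r \<in> space ?D" for r
    using weight_bounds(1)[of r] that spD by simp
  interpret D: finite_measure ?D by (rule finite_measure_distr[OF nm])
  have "finite_measure (from_cube \<rho>)"
  proof (rule finite_measureI)
    have "emeasure (from_cube \<rho>) (space (from_cube \<rho>)) = (\<integral>\<^sup>+ r. ennreal (1 / weight r) \<partial>?D)"
      unfolding from_cube_def using wD by (subst emeasure_density) (auto intro!: nn_integral_cong)
    also have "\<dots> \<le> (\<integral>\<^sup>+ r. ennreal 1 \<partial>?D)"
      using w1 by (intro nn_integral_mono ennreal_leI) blast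
    also have "\<dots> < \<infinity>" by (simp add: D.emeasure_finite less_top[symmetric])
    finally show "emeasure (from_cube \<rho>) (space (from_cube \<rho>)) \<noteq> \<infinity>" by simp
  qed
  moreover have "sets (from_cube \<rho>) = sets orthant_algebra" by (simp add: from_cube_def)
  moreover have "g t = (\<integral>r. (\<Prod>i\<in>UNIV. bernstein_factor (r $ i) (t $ i)) \<partial>from_cube \<rho>)" if t: "t \<in> closed_orthant" for t
  proof -
    let ?b = "\<lambda>r::real^'n. \<Prod>i\<in>UNIV. bernstein_factor (r $ i) (t $ i)"
    have bR: "?b \<in> borel_measurable orthant_algebra"
      by (rule measurable_restrict_space1[OF prod_bernstein_factor_measurable])
    have "(\<integral>r. ?b r \<partial>from_cube \<rho>) = (\<integral>r. (1 / weight r) *\<^sub>R ?b r \<partial>?D)"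
      unfolding from_cube_def
    proof (rule integral_density[OF _ wD])
      show "?b \<in> borel_measurable ?D" using bR by simp
      show "AE r in ?D. 0 \<le> 1 / weight r" using w1 by (intro AE_I2) blast
    qed
    also have "\<dots> = (\<integral>s. (1 / weight (neg_ln s)) *\<^sub>R ?b (neg_ln s) \<partial>\<rho>)"
      by (rule integral_distr[OF nm borel_measurable_scaleR[OF wR' bR]])
    also have "\<dots> = (\<integral>s. (\<Prod>i\<in>UNIV. geo_real (t $ i) (s $ i)) \<partial>\<rho>)"
    proof (rule integral_cong_AE)
      have bm: "(\<lambda>r. (1 / weight r) *\<^sub>R ?b r) \<in> borel_measurable orthant_algebra"
        by (rule borel_measurable_scaleR[OF wR' bR])
      from measurable_compose[OF nm bm]
      show "(\<lambda>s. (1 / weight (neg_ln s)) *\<^sub>R ?b (neg_ln s)) \<in> borel_measurable \<rho>" .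
      have "(\<lambda>s::real^'n. \<Prod>i\<in>UNIV. geo_real (t $ i) (s $ i)) \<in> borel_measurable borel" by measurable
      then show "(\<lambda>s. \<Prod>i\<in>UNIV. geo_real (t $ i) (s $ i)) \<in> borel_measurable \<rho>"
        using measurable_cong_sets[OF \<rho> refl] by blast
      show "AE s in \<rho>. (1 / weight (neg_ln s)) *\<^sub>R ?b (neg_ln s) = (\<Prod>i\<in>UNIV. geo_real (t $ i) (s $ i))"
        using ae
      proof eventually_elim
        fix s :: "real^'n" assume s: "\<forall>i. 0 < s $ i \<and> s $ i \<le> 1"
        let ?r = "neg_ln s"
        have r: "?r $ i = - ln (s $ i)" "0 \<le> ?r $ i" "exp (- (?r $ i)) = s $ i" for i
          using s by (simp_all add: neg_ln_def)
        have t0: "0 \<le> t $ i" for i using t by (simp add: closed_orthant_def)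
        have "geo_real (t $ i) (s $ i) * bernstein_factor (?r $ i) 1 = bernstein_factor (?r $ i) (t $ i)" for i
          using geo_real_exp[OF r(2) t0, of i i] unfolding r(3) .
        then have eq: "?b ?r = (\<Prod>i\<in>UNIV. geo_real (t $ i) (s $ i)) * weight ?r"
          by (simp only: weight_def prod.distrib[symmetric])
        have "1 \<le> weight ?r" using r(2) by (intro weight_bounds) (simp add: closed_orthant_def)
        then show "(1 / weight ?r) *\<^sub>R ?b ?r = (\<Prod>i\<in>UNIV. geo_real (t $ i) (s $ i))"
          unfolding eq by simp
      qed
    qed
    also have "\<dots> = g t" using rep t by simp
    finally show ?thesis by simp
  qed
  ultimately have "represents (from_cube \<rho>) g" unfolding represents_def by (intro conjI ballI)
  then show ?thesis by (rule exI)
qed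

section \<open>The equivalences\<close>

theorem theorem4p7:
  fixes g :: "real^'n::finite \<Rightarrow> real"
  assumes cont: "continuous_on closed_orthant g"
    and boundary: "\<And>t. t \<in> closed_orthant \<Longrightarrow> \<exists>i. t $ i = 0 \<Longrightarrow> g t = 0"
  shows
      "((\<forall>d\<ge>1. \<forall>\<mu> :: 'n \<Rightarrow> (nat \<Rightarrow> real) \<Rightarrow> real.
          (\<forall>i. discrete_measure_on (topspace (Euclidean_space d)) (\<mu> i) \<and>
               dmeasure (\<mu> i) (topspace (Euclidean_space d)) = 0)
          \<longrightarrow> 0 \<le> energy d g (product_measure \<mu>))
        \<longleftrightarrow> PDI_inf g) \<and>
       (2 \<le> CARD('n) \<longrightarrow>
        ((\<forall>d\<ge>1. \<forall>P. discrete_probability_on (prod_points d) P \<longrightarrow> 0 \<le> energy d g (lancaster P))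
         \<longleftrightarrow> PDI_inf g)) \<and>
       (2 \<le> CARD('n) \<longrightarrow>
        ((\<forall>d\<ge>1. \<forall>P. discrete_probability_on (prod_points d) P \<longrightarrow> 0 \<le> energy d g (streitberg P))
         \<longleftrightarrow> PDI_inf g)) \<and>
       ((\<exists>\<eta>. represents \<eta> g) \<longleftrightarrow> PDI_inf g) \<and>
       (\<forall>\<eta> \<eta>'. represents \<eta> g \<longrightarrow> represents \<eta>' g \<longrightarrow> \<eta> = \<eta>') \<and>
       (bernstein_order_n g \<longleftrightarrow> PDI_inf g)"
proof -
  define I where "I \<longleftrightarrow> (\<forall>d\<ge>1. \<forall>\<mu> :: 'n \<Rightarrow> (nat \<Rightarrow> real) \<Rightarrow> real.
          (\<forall>i. discrete_measure_on (topspace (Euclidean_space d)) (\<mu> i) \<and>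
               dmeasure (\<mu> i) (topspace (Euclidean_space d)) = 0)
          \<longrightarrow> 0 \<le> energy d g (product_measure \<mu>))"
  have I_intro: "I" if pos: "\<And>d \<mu>. 1 \<le> d \<Longrightarrow> (\<And>i. discrete_measure_on (R_pow d) (\<mu> i)) \<Longrightarrow>
      (\<And>i. dmeasure (\<mu> i) UNIV = 0) \<Longrightarrow> 0 \<le> energy d g (product_measure \<mu>)"
    unfolding I_def
  proof (intro allI impI)
    fix d :: nat and \<mu> :: "'n \<Rightarrow> (nat \<Rightarrow> real) \<Rightarrow> real"
    assume d: "1 \<le> d" and \<mu>: "\<forall>i. discrete_measure_on (R_pow d) (\<mu> i) \<and> dmeasure (\<mu> i) (R_pow d) = 0"
    then have dm: "discrete_measure_on (R_pow d) (\<mu> i)" for i by blast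
    have "dmeasure (\<mu> i) UNIV = 0" for i using \<mu> dmeasure_UNIV_eq[OF dm] by simp
    with d dm show "0 \<le> energy d g (product_measure \<mu>)" by (rule pos)
  qed
  have I_dest: "0 \<le> energy d g (product_measure \<mu>)"
    if "I" "1 \<le> d" and dm: "\<And>i. discrete_measure_on (R_pow d) (\<mu> i)" and zero: "\<And>i. dmeasure (\<mu> i) UNIV = 0" for d \<mu>
  proof -
    have "dmeasure (\<mu> i) (R_pow d) = 0" for i using zero dmeasure_UNIV_eq[OF dm] by simp
    then show ?thesis using \<open>I\<close> \<open>1 \<le> d\<close> dm unfolding I_def by blast
  qed
  have PDI_D: "0 \<le> energy d g \<mu>" if "PDI_inf g" "1 \<le> d" "\<mu> \<in> null_marginal_measures d" for d \<mu>
    using that unfolding PDI_inf_def by blast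
  have repr: "\<exists>\<eta>. represents \<eta> g" if "alternating_differences (\<lambda>t. (-1) ^ CARD('n) * g t)"
    by (rule represents_if_alternating[OF cont boundary that])
  have I_repr: "\<exists>\<eta>. represents \<eta> g" if "I"
    by (rule repr, rule alternating_if_product_energies, rule I_dest[OF that])
  have repr_PDI: "PDI_inf g" if "\<exists>\<eta>. represents \<eta> g" using that PDI_if_represents by blast
  have PDI_I: "I" if "PDI_inf g"
    by (rule I_intro, rule PDI_D[OF that], assumption, rule product_measure_null)
  have inter_I: "I" if n2: "2 \<le> CARD('n)"
    and pos: "\<And>d P. 1 \<le> d \<Longrightarrow> discrete_probability_on (prod_points d) P \<Longrightarrow> 0 \<le> energy d g (\<Psi> P)"
    and \<Psi>: "\<Psi> = lancaster \<or> \<Psi> = streitberg" for \<Psi>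
  proof (rule I_intro)
    fix d :: nat and \<mu> :: "'n \<Rightarrow> (nat \<Rightarrow> real) \<Rightarrow> real"
    assume d: "1 \<le> d" and dm: "\<And>i. discrete_measure_on (R_pow d) (\<mu> i)" and zero: "\<And>i. dmeasure (\<mu> i) UNIV = 0"
    obtain P \<epsilon> where P: "discrete_probability_on (prod_points d) P" and \<epsilon>: "\<epsilon> > 0"
      and L: "lancaster P = (\<lambda>x. \<epsilon> * product_measure \<mu> x)" "streitberg P = (\<lambda>x. \<epsilon> * product_measure \<mu> x)"
      by (rule product_measure_is_interaction[OF dm zero n2])
    have "\<Psi> P = (\<lambda>x. \<epsilon> * product_measure \<mu> x)" using \<Psi> L by metis
    then have "0 \<le> \<epsilon>\<^sup>2 * energy d g (product_measure \<mu>)"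
      using pos[OF d P] energy_scale[of \<epsilon> d g "product_measure \<mu>"] \<epsilon> by simp
    then show "0 \<le> energy d g (product_measure \<mu>)" using \<epsilon> by (simp add: zero_le_mult_iff)
  qed
  have "I \<longleftrightarrow> PDI_inf g" using I_repr repr_PDI PDI_I by blast
  moreover have "2 \<le> CARD('n) \<longrightarrow>
      ((\<forall>d\<ge>1. \<forall>P. discrete_probability_on (prod_points d) P \<longrightarrow> 0 \<le> energy d g (lancaster P)) \<longleftrightarrow> PDI_inf g)"
  proof (intro impI iffI)
    assume n2: "2 \<le> CARD('n)"
      and "\<forall>d\<ge>1. \<forall>P. discrete_probability_on (prod_points d) P \<longrightarrow> 0 \<le> energy d g (lancaster P)"
    then have "I" by (intro inter_I[of lancaster]) simp_all
    then show "PDI_inf g" by (intro repr_PDI I_repr)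
  next
    assume "PDI_inf g"
    then show "\<forall>d\<ge>1. \<forall>P. discrete_probability_on (prod_points d) P \<longrightarrow> 0 \<le> energy d g (lancaster P)"
      using PDI_D lancaster_null by blast
  qed
  moreover have "2 \<le> CARD('n) \<longrightarrow>
      ((\<forall>d\<ge>1. \<forall>P. discrete_probability_on (prod_points d) P \<longrightarrow> 0 \<le> energy d g (streitberg P)) \<longleftrightarrow> PDI_inf g)"
  proof (intro impI iffI)
    assume n2: "2 \<le> CARD('n)"
      and "\<forall>d\<ge>1. \<forall>P. discrete_probability_on (prod_points d) P \<longrightarrow> 0 \<le> energy d g (streitberg P)"
    then have "I" by (intro inter_I[of streitberg]) simp_all
    then show "PDI_inf g" by (intro repr_PDI I_repr)
  next
    assume "2 \<le> CARD('n)" "PDI_inf g"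
    then show "\<forall>d\<ge>1. \<forall>P. discrete_probability_on (prod_points d) P \<longrightarrow> 0 \<le> energy d g (streitberg P)"
      using PDI_D streitberg_null by blast
  qed
  moreover have "(\<exists>\<eta>. represents \<eta> g) \<longleftrightarrow> PDI_inf g" using repr_PDI I_repr PDI_I by blast
  moreover have "\<forall>\<eta> \<eta>'. represents \<eta> g \<longrightarrow> represents \<eta>' g \<longrightarrow> \<eta> = \<eta>'"
    using represents_unique by blast
  moreover have "bernstein_order_n g \<longleftrightarrow> PDI_inf g"
  proof
    assume "bernstein_order_n g"
    then show "PDI_inf g" by (intro repr_PDI repr alternating_if_bernstein cont)
  next
    assume "PDI_inf g"
    then obtain \<eta> where "represents \<eta> g" using PDI_I I_repr by blast
    then show "bernstein_order_n g" by (rule bernstein_if_represents)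
  qed
  ultimately show ?thesis unfolding I_def by (intro conjI)
qed

end
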